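(* For every integer $n\geq 3$, $$ \overline{\Upsilon}(n)<\frac{\log n}{1+\log n}\log n\,\log\log (n-1)+\frac{c_4\log^2 n}{1+\log n}+\frac{\log n}{1+\log n}+\frac{1717433}{(1+\log n)\log^3 n}. $$
   Context: Here $\log$ is the natural logarithm and $\log^k x$ means $(\log x)^k$. For a positive integer $n$ and a prime $p$, $v_p(n!)$ denotes the exponent of $p$ in the prime factorization of $n!$. Put $$\Upsilon(n)=\sum_{p\leq n}v_p(n!),\qquad \overline{\Upsilon}(n)=\frac{\Upsilon(n)}{\pi(n)},$$ the sum being over primes $p\le n$, where $\pi(n)$ is the number of primes not exceeding $n$ (so $\overline{\Upsilon}(n)$ is the mean of $v_p(n!)$ over primes $p\le n$). The exponential integral is $\mathrm{Ei}(a,z)=\int_1^\infty e^{-tz}t^{-a}\,dt$ for $\Re(z)>0$. The constant $c_4$ is $c_4=c_1+c_3\approx 21.18095291$, where $$c_1=\frac{-5937\log^2 2+3965\log 2+1586}{600\log^3 2}\approx 7.416262921,$$ $$c_2=\int_2^{e+1}\frac{1200x^3+365x^2+9944x-1993}{1200(x-1)^4\log x}\,dx\approx 12.35466367,$$ $$c_3=\frac{793}{240}\mathrm{Ei}(1,1)+\frac{2379}{200}\mathrm{Ei}(1,2)+\frac{793}{100}\mathrm{Ei}(1,3)+c_2\approx 13.76468999.$$ *)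

theory Defs
  imports "HOL-Analysis.Analysis" "HOL-Computational_Algebra.Primes"
begin

definition prime_pi :: "nat \<Rightarrow> nat" where
  "prime_pi n = card {p. prime p \<and> p \<le> n}"

definition Upsilon :: "nat \<Rightarrow> nat" where
  "Upsilon n = (\<Sum>p | prime p \<and> p \<le> n. multiplicity p (fact n :: nat))"

definition Upsilon_mean :: "nat \<Rightarrow> real" where
  "Upsilon_mean n = real (Upsilon n) / real (prime_pi n)"

(* Generalized exponential integral, meaningful for Re z > 0. The type variable covers
   both real and complex arguments; the constants below use the real instance. *)
definition Ei :: "'a::{ln,real_normed_field} \<Rightarrow> 'a \<Rightarrow> 'a" where
  "Ei a z = integral {1..} (\<lambda>t::real. exp (- of_real t * z) * of_real t powr (- a))"

definition c1 :: real where
  "c1 = (- 5937 * (ln 2)^2 + 3965 * ln 2 + 1586) / (600 * (ln 2)^3)"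

definition c2 :: real where
  "c2 = integral {2..exp 1 + 1}
     (\<lambda>x::real. (1200 * x^3 + 365 * x^2 + 9944 * x - 1993) / (1200 * (x - 1)^4 * ln x))"

definition c3 :: real where
  "c3 = 793 / 240 * Ei 1 1 + 2379 / 200 * Ei 1 2 + 793 / 100 * Ei 1 3 + c2"

definition c4 :: real where
  "c4 = c1 + c3"

end

theory Submission
  imports
    Defs
    "HOL-Complex_Analysis.Complex_Analysis"
    "HOL-Number_Theory.Prime_Powers"
begin

text \<open>
Write \<open>L = log n\<close> and \<open>l = log log n\<close>. Legendre's formula gives \<open>v\<^sub>p(n!) \<le> n / (p - 1)\<close>, and
Mertens' estimate for the sum of \<open>1 / p\<close> turns this into \<open>Upsilon n \<le> n (l + 4)\<close>
(\<open>Upsilon_le\<close>). Since \<open>psi n \<le> prime_pi n * L\<close>, where \<open>psi\<close> is Chebyshev's function, every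
bound \<open>psi n \<ge> r n\<close> yields \<open>Upsilon_mean n \<le> L (l + 4) / r\<close>. The right-hand side of the theorem is
essentially \<open>L (l + c4)\<close>, and \<open>c4 \<ge> 18.5\<close>. So what has to be shown is a lower bound for
\<open>psi n / n\<close> of roughly \<open>(l + 4) / (l + 18.5)\<close>. This tends to 1: the theorem contains the
lower half of the prime number theorem, but only with a relative error of about \<open>14 / log log n\<close>,
which leaves a great deal of room.

Three ranges are treated separately. For \<open>n < 20000\<close> the bound \<open>psi n \<ge> 0.22 n\<close>, from the central
binomial coefficient, is enough because of the last term of the right-hand side. For larger \<open>n\<close>
with \<open>l < 140\<close>, Chebyshev's argument with \<open>n! (n/30)! / ((n/2)! (n/3)! (n/5)!)\<close> gives
\<open>psi n \<ge> 0.914 n\<close>. For \<open>l \<ge> 140\<close> an explicit form of the prime number theorem,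
\<open>psi n \<ge> (1 - 12 / l) n\<close>, is proved (\<open>psi_prime_number_theorem_lower\<close>). As \<open>L \<ge> exp 140\<close> there,
an error term of size \<open>T ^ 11 / L\<close> with a parameter \<open>T\<close> of size \<open>l\<^sup>2\<close> and an enormous constant is
harmless, so crude polynomial bounds for the zeta function suffice.

The proof of that form of the prime number theorem follows Wiener and Ikehara, made quantitative.
Everything takes place in the half-plane \<open>Re s > 1\<close>, with \<open>s = 1 + d + \<i> t\<close> and \<open>d\<close> tending to 0
at the end; the only thing needed further left is that \<open>Z s = (s - 1) zeta s\<close> extends
holomorphically to \<open>Re s > 1/2\<close> with polynomial growth, so that Cauchy's inequality bounds the
derivatives of \<open>Z\<close> near the line \<open>Re s = 1\<close>. The inequality \<open>3 + 4 cos y + cos 2y \<ge> 0\<close> bounds \<open>Z\<close>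
from below there by a negative power of \<open>\<bar>t\<bar>\<close> (\<open>Z_lower_bound\<close>). The Fourier transform of
\<open>(psi (exp v) exp (- v) - 1) exp (- d v)\<close> is then a smooth function of \<open>t\<close> with explicit bounds;
convolving with the Fejer kernel of bandwidth \<open>T\<close> restricts it to \<open>\<bar>t\<bar> \<le> T\<close>, and one integration
by parts shows that the convolution at \<open>V\<close> is \<open>O(1 / V)\<close> uniformly in \<open>d\<close>
(\<open>psi_exp_fourier_bound\<close>). Because \<open>psi\<close> is monotone and \<open>psi (exp v) exp (- v)\<close> is bounded, a lower
bound for this average is a lower bound for a single value (\<open>psi_exp_lower_smoothed\<close>).
\<close>

section \<open>Elementary bounds for logarithms\<close>

lemma ln_diff_ge: fixes x y :: real assumes "0 < x" "x \<le> y" shows "1 - x / y \<le> ln y - ln x"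
proof -
  have "ln (x / y) \<le> x / y - 1" using assms by (intro ln_le_minus_one) auto
  thus ?thesis using assms by (simp add: ln_div)
qed

lemma ln_diff_le: fixes x y :: real assumes "0 < x" "0 < y" shows "ln y - ln x \<le> y / x - 1"
proof -
  have "ln (y / x) \<le> y / x - 1" using assms by (intro ln_le_minus_one) auto
  thus ?thesis using assms by (simp add: ln_div)
qed

lemma ln_le_linear: 
  fixes x a :: real assumes "x > 0" "a > 0" shows "ln x \<le> x / a - 1 + ln a"
proof -
  have "ln (x / a) \<le> x / a - 1" using assms by (intro ln_le_minus_one) auto
  thus ?thesis using assms by (simp add: ln_div)
qed

lemma exp_1_ge: "exp (1::real) \<ge> 27/10"
  using e_approx_32 by (simp add: abs_if split: if_splits)

lemma ln_20000_le: "ln (20000::real) \<le> 10"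
proof -
  have "(27/10) ^ 10 \<le> exp (1::real) ^ 10" using exp_1_ge by (intro power_mono) auto
  also have "exp (1::real) ^ 10 = exp (real 10 * 1)" by (rule exp_of_nat_mult[symmetric])
  finally have "ln ((27/10) ^ 10) \<le> real 10 * 1" by (subst ln_exp[symmetric], intro ln_mono) simp_all
  moreover have "ln (20000 :: real) \<le> ln ((27/10) ^ 10)" by (intro ln_mono) (simp_all add: power_divide)
  ultimately have "ln 20000 \<le> real 10 * 1" by (rule order_trans[rotated])
  thus ?thesis by simp
qed

section \<open>Chebyshev bounds\<close>

definition psi :: "nat \<Rightarrow> real" where
  "psi n = (\<Sum>d=1..n. mangoldt d)"

lemma psi_mono: "m \<le> n \<Longrightarrow> psi m \<le> psi n"
  unfolding psi_def by (intro sum_mono2) (auto simp: mangoldt_nonneg)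

lemma psi_nonneg: "psi n \<ge> 0"
  unfolding psi_def by (intro sum_nonneg) (auto simp: mangoldt_nonneg)

lemma card_multiples: "d > 0 \<Longrightarrow> card {m\<in>{1..n}. d dvd m} = n div d"
proof -
  assume d: "d > 0"
  have "{m\<in>{1..n}. d dvd m} = (\<lambda>k. d * k) ` {1..n div d}"
  proof (intro equalityI subsetI)
    fix m assume "m \<in> {m\<in>{1..n}. d dvd m}"
    then obtain k where k: "m = d * k" "1 \<le> m" "m \<le> n" by auto
    hence "k \<le> n div d" using d by (simp add: less_eq_div_iff_mult_less_eq mult.commute)
    moreover have "k \<ge> 1" using k by (cases k) auto
    ultimately show "m \<in> (\<lambda>k. d * k) ` {1..n div d}" using k by auto
  next
    fix m assume "m \<in> (\<lambda>k. d * k) ` {1..n div d}"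
    then obtain k where "m = d * k" "k \<in> {1..n div d}" by blast
    hence k: "m = d * k" "1 \<le> k" "k \<le> n div d" by auto
    hence "d * k \<le> n" using d by (simp add: less_eq_div_iff_mult_less_eq mult.commute)
    thus "m \<in> {m\<in>{1..n}. d dvd m}" using k d by auto
  qed
  thus ?thesis using d by (simp add: card_image inj_on_def)
qed

text \<open>
Count \<open>log 1 + \<dots> + log m\<close> by means of \<open>log k = \<Sum> mangoldt d\<close> over the divisors \<open>d\<close> of \<open>k\<close>. The upper
limit \<open>N\<close> is free because the terms with \<open>d > m\<close> vanish; this lets factorials of several
arguments be compared in one sum.
\<close>

lemma ln_fact_eq: 
  assumes "m \<le> N" shows "ln (fact m) = (\<Sum>d=1..N. mangoldt d * real (m div d))"
proof -
  have "ln (fact m :: real) = (\<Sum>k=1..m. ln (real k))"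
    by (induction m) (auto simp: ln_mult algebra_simps simp del: of_nat_Suc)
  also have "\<dots> = (\<Sum>k=1..m. \<Sum>d\<in>{1..N}. if d dvd k then mangoldt d else 0)"
  proof (intro sum.cong refl)
    fix k assume k: "k \<in> {1..m}"
    have "ln (real k) = (\<Sum>d | d dvd k. mangoldt d)" using mangoldt_sum[of k, where ?'a = real] k by simp
    also have "{d. d dvd k} = {d\<in>{1..N}. d dvd k}"
    proof -
      have "1 \<le> d \<and> d \<le> N" if "d dvd k" for d
        using that k assms dvd_imp_le[of d k] dvd_pos_nat[of k d] by auto
      thus ?thesis by auto
    qed
    also have "sum mangoldt {d\<in>{1..N}. d dvd k} = (\<Sum>d\<in>{1..N}. if d dvd k then mangoldt d else (0::real))"
      by (rule sum.inter_filter) auto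
    finally show "ln (real k) = (\<Sum>d\<in>{1..N}. if d dvd k then mangoldt d else 0)" .
  qed
  also have "\<dots> = (\<Sum>d\<in>{1..N}. \<Sum>k=1..m. if d dvd k then mangoldt d else 0)" by (rule sum.swap)
  also have "\<dots> = (\<Sum>d=1..N. mangoldt d * real (m div d))"
  proof (intro sum.cong refl)
    fix d assume d: "d \<in> {1..N}"
    have "(\<Sum>k=1..m. if d dvd k then mangoldt d else 0) = (\<Sum>k\<in>{k\<in>{1..m}. d dvd k}. mangoldt d :: real)"
      by (rule sum.inter_filter[symmetric]) auto
    thus "(\<Sum>k=1..m. if d dvd k then mangoldt d else 0) = mangoldt d * real (m div d)"
      using card_multiples[of d m] d by simp
  qed
  finally show ?thesis .
qed

lemma div_double_diff: "(2 * n) div d = 2 * (n div d) \<or> (2 * n) div d = 2 * (n div d) + (1::nat)"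
proof (cases "d = 0")
  case False
  have "2 * (n div d) * d \<le> 2 * n" by (metis div_times_less_eq_dividend mult.assoc mult_le_mono2)
  hence "2 * (n div d) \<le> (2 * n) div d"
    using False by (simp add: less_eq_div_iff_mult_less_eq)
  moreover have "(2 * n) div d < 2 * (n div d) + 2"
  proof -
    have "n < (n div d + 1) * d" using False by (metis Suc_eq_plus1 dividend_less_div_times mult_Suc add.commute neq0_conv)
    thus ?thesis using False by (simp add: div_less_iff_less_mult algebra_simps)
  qed
  ultimately show ?thesis by linarith
qed auto

lemma ln_central_binomial: 
  "ln (real ((2 * n) choose n)) = (\<Sum>d=1..2*n. mangoldt d * real ((2 * n) div d - 2 * (n div d)))"
proof -
  have "real ((2 * n) choose n) = fact (2 * n) / (fact n * fact n)"
    by (subst binomial_fact) (auto simp: mult_2)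
  hence "ln (real ((2 * n) choose n)) = ln (fact (2 * n)) - 2 * ln (fact n)"
    by (simp add: ln_div ln_mult)
  also have "\<dots> = (\<Sum>d=1..2*n. mangoldt d * real ((2 * n) div d) - 2 * (mangoldt d * real (n div d)))"
    by (subst (1 2) ln_fact_eq[of _ "2 * n"]) (auto simp: sum_subtractf sum_distrib_left)
  also have "\<dots> = (\<Sum>d=1..2*n. mangoldt d * real ((2 * n) div d - 2 * (n div d)))"
  proof (intro sum.cong refl)
    fix d
    have "real ((2 * n) div d - 2 * (n div d)) = real ((2 * n) div d) - 2 * real (n div d)"
      using div_double_diff[of n d] by auto
    thus "mangoldt d * real ((2 * n) div d) - 2 * (mangoldt d * real (n div d)) = mangoldt d * real ((2 * n) div d - 2 * (n div d))"
      by (simp add: algebra_simps)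
  qed
  finally show ?thesis .
qed

lemma psi_double_ge: "ln (real ((2 * n) choose n)) \<le> psi (2 * n)"
  unfolding ln_central_binomial psi_def
proof (intro sum_mono)
  fix d
  have "real ((2 * n) div d - 2 * (n div d)) \<le> 1" using div_double_diff[of n d] by auto
  hence "mangoldt d * real ((2 * n) div d - 2 * (n div d)) \<le> mangoldt d * 1"
    by (intro mult_left_mono mangoldt_nonneg)
  thus "mangoldt d * real ((2 * n) div d - 2 * (n div d)) \<le> mangoldt d" by simp
qed

text \<open>
Each prime power in \<open>{n<..2n}\<close> contributes with coefficient 1 to the logarithm of the central
binomial coefficient, which is at most \<open>2 ^ (2n)\<close>.
\<close>

lemma psi_double_le: "psi (2 * n) \<le> psi n + 2 * ln 2 * real n"
proof -
  have "psi (2 * n) - psi n = (\<Sum>d\<in>{n+1..2*n}. mangoldt d)"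
  proof -
    have "{1..2*n} = {1..n} \<union> {n+1..2*n}" by auto
    thus ?thesis unfolding psi_def by (simp only:) (subst sum.union_disjoint, auto)
  qed
  also have "\<dots> = (\<Sum>d\<in>{n+1..2*n}. mangoldt d * real ((2 * n) div d - 2 * (n div d)))"
  proof (intro sum.cong refl)
    fix d assume d: "d \<in> {n+1..2*n}"
    hence "n div d = 0" "(2 * n) div d = 1" by (auto intro!: div_nat_eqI)
    thus "mangoldt d = mangoldt d * real ((2 * n) div d - 2 * (n div d))" by simp
  qed
  also have "\<dots> \<le> ln (real ((2 * n) choose n))"
    unfolding ln_central_binomial by (intro sum_mono2) (auto intro!: mult_nonneg_nonneg mangoldt_nonneg)
  also have "\<dots> \<le> ln (2 ^ (2 * n))"
  proof -
    have "(2 * n) choose n \<le> 2 ^ (2 * n)" by (rule binomial_le_pow2)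
    hence "real ((2 * n) choose n) \<le> 2 ^ (2 * n)" by (metis of_nat_le_iff of_nat_numeral of_nat_power)
    thus ?thesis by (subst ln_le_cancel_iff) auto
  qed
  also have "\<dots> = 2 * ln 2 * real n" by (simp add: ln_realpow)
  finally show ?thesis by simp
qed

text \<open>
Induction by halving. The step from \<open>m\<close> to \<open>2m\<close> costs \<open>2 m log 2\<close>, against an allowance of
\<open>1.7 m\<close>; the surplus of about \<open>0.31 m\<close> pays for the extra term \<open>log (2m + 1)\<close> when \<open>n\<close> is odd. Having
\<open>n - 1\<close> instead of \<open>n\<close> saves a constant that improves Mertens' bound below.
\<close>

lemma psi_le:
  assumes "n \<ge> 1" shows "psi n \<le> 17/10 * (real n - 1)"
  using assms
proof (induction n rule: less_induct)
  case (less n)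
  show ?case
  proof (cases "n = 1")
    case True
    thus ?thesis by (simp add: psi_def)
  next
    case False
    define m where "m = n div 2"
    have m: "m \<ge> 1" "m < n" using less.prems False by (auto simp: m_def)
    have "psi (2 * m) \<le> 17/10 * (real m - 1) + 2 * ln 2 * real m"
      using psi_double_le[of m] less.IH[OF m(2,1)] by linarith
    also have "ln 2 * real m \<le> 25/36 * real m" using ln2_le_25_over_36 by (intro mult_right_mono) auto
    hence "2 * ln 2 * real m \<le> 25/18 * real m" by simp
    finally have even: "psi (2 * m) \<le> 17/10 * (real m - 1) + 25/18 * real m" by simp
    show ?thesis
    proof (cases "even n")
      case True
      hence "n = 2 * m" by (simp add: m_def)
      moreover have "real m \<ge> 1" using m by simp
      ultimately show ?thesis using even by (simp add: field_simps)
    next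
      case odd: False
      hence n: "n = 2 * m + 1" by (simp add: m_def)
      have psi_n: "psi n = psi (2 * m) + mangoldt (2 * m + 1)" by (simp add: psi_def n)
      have ml: "mangoldt (2 * m + 1) \<le> ln (real (2 * m + 1))" by (rule mangoldt_le) simp
      have l1: "ln (real (2 * m + 1)) \<le> 8/27 * real m + 4/27 - 1 + ln (27/4)" 
        using m ln_le_linear[of "real (2 * m + 1)" "27/4"] by (simp add: field_simps)
      have l2: "ln (27/4) \<le> 3 * ln (2::real)"
      proof -
        have "ln (27/4) \<le> ln ((2::real) ^ 3)" by (rule ln_mono) auto
        also have "ln ((2::real) ^ 3) = 3 * ln 2" by (subst ln_realpow) auto
        finally show ?thesis .
      qed
      have "ln (real (2 * m + 1)) \<le> 8/27 * real m + 4/27 - 1 + 3 * (25/36)"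
        using l1 l2 ln2_le_25_over_36 by linarith
      hence "mangoldt (2 * m + 1) \<le> 8/27 * real m + 4/27 - 1 + 3 * (25/36)"
        by (rule order_trans[OF ml])
      hence "psi n \<le> (17/10 * (real m - 1) + 25/18 * real m) + (8/27 * real m + 4/27 - 1 + 3 * (25/36))"
        unfolding psi_n using even by (intro add_mono)
      also have "\<dots> = 17/10 * (2 * real m) - 2/135 * real m - 253/540" by (simp add: field_simps)
      also have "\<dots> \<le> 17/10 * (2 * real m)" by simp
      also have "2 * real m = real n - 1" using n by simp
      finally show ?thesis .
    qed
  qed
qed

text \<open>
The central binomial coefficient of \<open>m = n div 2\<close> is at least \<open>4 ^ m / (2 m)\<close>. The constant is dictated
by the case \<open>n = 3\<close>, treated together with \<open>n = 2\<close>, where only \<open>log 2 \<ge> 2/3\<close> is available.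
\<close>

lemma psi_ge:
  assumes "n \<ge> 2" shows "psi n \<ge> 22/100 * real n"
proof -
  define m where "m = n div 2"
  have m: "m \<ge> 1" "2 * m \<le> n" "n \<le> 2 * m + 1" using assms by (auto simp: m_def)
  have l2: "ln 2 \<ge> (2/3::real)" by (rule ln2_ge_two_thirds)
  have "ln (4 ^ m / (2 * real m)) \<le> ln (real ((2 * m) choose m))"
    using central_binomial_lower_bound[of m] m by (subst ln_le_cancel_iff) auto
  also have "\<dots> \<le> psi (2 * m)" by (rule psi_double_ge)
  also have "\<dots> \<le> psi n" using m by (intro psi_mono)
  also have "ln (4 ^ m / (2 * real m)) = real m * (2 * ln 2) - (ln 2 + ln (real m))"
    using m ln_realpow[of "2::real" 2] by (simp add: ln_div ln_mult ln_realpow)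
  finally have *: "real m * (2 * ln 2) - (ln 2 + ln (real m)) \<le> psi n" .
  show ?thesis
  proof (cases "m = 1")
    case True
    hence "real n \<le> 3" "ln 2 \<le> psi n" using * m by auto
    thus ?thesis using l2 by linarith
  next
    case False
    hence m2: "m \<ge> 2" using m by simp
    have "ln (real m) \<le> real m / 4 - 1 + ln (2 ^ 2)"
      using m ln_le_linear[of "real m" 4] by simp
    also have "ln (2 ^ 2 :: real) = 2 * ln 2" by (subst ln_realpow) auto
    finally have "psi n \<ge> (2 * real m - 3) * ln 2 - real m / 4 + 1" using * by (simp add: algebra_simps)
    moreover have "(2 * real m - 3) * ln 2 \<ge> (2 * real m - 3) * (2/3)"
      using l2 m2 by (intro mult_left_mono) auto
    ultimately have "psi n \<ge> 13/12 * real m - 1" by simp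
    moreover have "real n \<le> 2 * real m + 1" using m by linarith
    moreover have "real m \<ge> 2" using m2 by simp
    ultimately show ?thesis by linarith
  qed
qed

text \<open>
Stirling's formula without its constant: both bounds follow by induction from
\<open>1 / (x + 1) \<le> log (x + 1) - log x \<le> 1 / x\<close>.
\<close>

lemma ln_fact_bounds:
  assumes "n \<ge> 1"
  shows "ln (fact n :: real) \<ge> real n * ln (real n) - real n + 1"
    and "ln (fact n :: real) \<le> real n * ln (real n) - real n + 1 + ln (real n)"
proof -
  have "real n * ln (real n) - real n + 1 \<le> ln (fact n :: real) \<and>
     ln (fact n :: real) \<le> real n * ln (real n) - real n + 1 + ln (real n)"
    using assms
  proof (induction n rule: dec_induct)
    case (step n)
    define x where "x = real n"
    have x: "x \<ge> 1" using step by (simp add: x_def)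
    have f: "ln (fact (Suc n) :: real) = ln (x + 1) + ln (fact n)" 
      by (simp add: x_def ln_mult add.commute)
    have "x * (ln (x + 1) - ln x) \<le> x * ((x + 1) / x - 1)"
      using x by (intro mult_left_mono ln_diff_le) auto
    hence 1: "x * ln (x + 1) - x * ln x \<le> 1" using x by (simp add: field_simps)
    have "(x + 1) * (1 - x / (x + 1)) \<le> (x + 1) * (ln (x + 1) - ln x)"
      using x by (intro mult_left_mono ln_diff_ge) auto
    hence 2: "1 \<le> x * ln (x + 1) + ln (x + 1) - x * ln x - ln x" using x by (simp add: field_simps)
    have s: "real (Suc n) = x + 1" by (simp add: x_def)
    show ?case using step.IH 1 2 unfolding f s x_def[symmetric] by (auto simp: algebra_simps)
  qed simp
  thus "ln (fact n :: real) \<ge> real n * ln (real n) - real n + 1"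
    "ln (fact n :: real) \<le> real n * ln (real n) - real n + 1 + ln (real n)" by blast+
qed

text \<open>
The previous bounds for \<open>m = \<lfloor>x\<rfloor>\<close>, expressed in \<open>x\<close>; the function \<open>x log x - x\<close> moves by at most
\<open>log x\<close> over an interval of length 1. In these terms the main parts cancel exactly in
Chebyshev's combination.
\<close>

lemma ln_fact_floor_bounds:
  fixes x :: real
  assumes x: "x \<ge> 1" and m: "real m \<le> x" "x < real m + 1"
  shows "ln (fact m :: real) \<ge> x * ln x - x + 1 - ln x"
    and "ln (fact m :: real) \<le> x * ln x - x + 1 + ln x"
proof -
  define y where "y = real m"
  have "m \<ge> 1" using x m by (cases m) auto
  hence y: "y \<ge> 1" "y \<le> x" "x \<le> y + 1" using m by (auto simp: y_def)
  note F = ln_fact_bounds[OF \<open>m \<ge> 1\<close>, folded y_def]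
  have "y * (ln x - ln y) \<le> y * (x / y - 1)" using y by (intro mult_left_mono ln_diff_le) auto
  hence 1: "y * ln x - y * ln y \<le> x - y" using y by (simp add: algebra_simps)
  have "(x - y) * ln x \<le> 1 * ln x" using y x by (intro mult_right_mono) auto
  hence "x * ln x - x - (y * ln y - y) \<le> ln x" using 1 by (simp add: algebra_simps)
  thus "ln (fact m :: real) \<ge> x * ln x - x + 1 - ln x" using F(1) by linarith
  have "x * (1 - y / x) \<le> x * (ln x - ln y)" using y by (intro mult_left_mono ln_diff_ge) auto
  hence 2: "x - y \<le> x * ln x - x * ln y" using y by (simp add: algebra_simps)
  have "0 \<le> (x - y) * ln y" using y by (intro mult_nonneg_nonneg) auto
  hence "y * ln y - y \<le> x * ln x - x" using 2 by (simp add: algebra_simps)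
  moreover have "ln y \<le> ln x" using y by simp
  ultimately show "ln (fact m :: real) \<le> x * ln x - x + 1 + ln x" using F(2) by linarith
qed

text \<open>
Since \<open>1 + 1/30 = 1/2 + 1/3 + 1/5\<close>, the difference of the two sides is periodic modulo 30, which
leaves 30 cases.
\<close>

lemma chebyshev_floor_ineq: "(m::nat) + m div 30 \<le> 1 + m div 2 + m div 3 + m div 5"
proof -
  define q r where "q = m div 30" and "r = m mod 30"
  have m: "m = r + 30 * q" and r: "r < 30" by (auto simp: q_def r_def)
  have a: "m div 30 = q" by (simp add: q_def)
  have "m = r + 2 * (15 * q)" using m by simp
  hence b: "m div 2 = r div 2 + 15 * q" by (simp only: div_mult_self2)
  have "m = r + 3 * (10 * q)" using m by simp
  hence c: "m div 3 = r div 3 + 10 * q" by (simp only: div_mult_self2)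
  have "m = r + 5 * (6 * q)" using m by simp
  hence d: "m div 5 = r div 5 + 6 * q" by (simp only: div_mult_self2)
  have "\<forall>r\<in>{..<30::nat}. r \<le> 1 + r div 2 + r div 3 + r div 5" by (simp add: lessThan_nat_numeral lessThan_Suc)
  hence "r \<le> 1 + r div 2 + r div 3 + r div 5" using r by simp
  thus ?thesis unfolding a b c d using m by linarith
qed

lemma psi_ge_ln_facts:
  "ln (fact n) + ln (fact (n div 30)) - ln (fact (n div 2)) - ln (fact (n div 3)) - ln (fact (n div 5)) \<le> psi n"
proof -
  have T: "ln (fact (n div k)) = (\<Sum>d=1..n. mangoldt d * real ((n div d) div k))" for k
    by (subst ln_fact_eq[of _ n]) (auto simp: div_mult2_eq[symmetric] mult.commute)
  have "ln (fact n) + ln (fact (n div 30)) - ln (fact (n div 2)) - ln (fact (n div 3)) - ln (fact (n div 5))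
     = (\<Sum>d=1..n. mangoldt d * (real (n div d) + real ((n div d) div 30) - real ((n div d) div 2) - real ((n div d) div 3) - real ((n div d) div 5)))"
    unfolding T ln_fact_eq[OF order_refl, of n] by (simp add: sum.distrib sum_subtractf algebra_simps)
  also have "\<dots> \<le> (\<Sum>d=1..n. mangoldt d * 1)"
  proof (intro sum_mono mult_left_mono mangoldt_nonneg)
    fix d
    define m where "m = n div d"
    have "real (m + m div 30) \<le> real (1 + m div 2 + m div 3 + m div 5)"
      by (rule of_nat_mono[OF chebyshev_floor_ineq])
    thus "real (n div d) + real ((n div d) div 30) - real ((n div d) div 2) - real ((n div d) div 3) - real ((n div d) div 5) \<le> 1"
      by (simp add: m_def)
  qed
  finally show ?thesis by (simp add: psi_def)
qed

text \<open>
The left-hand side is the logarithm of \<open>N = 2 ^ 14 * 3 ^ 9 * 5 ^ 5\<close>, and \<open>N\<^sup>2\<close> exceeds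
\<open>2.72 ^ 55\<close>. Divided by 30 it is Chebyshev's constant, about 0.9212; the bound loses half a
percent and keeps the integers small.
\<close>

lemma chebyshev_constant: "14 * ln 2 + 9 * ln 3 + 5 * ln (5::real) \<ge> 55 / 2"
proof -
  define N :: real where "N = 2^14 * 3^9 * 5^5"
  have N: "N > 0" by (simp add: N_def)
  have "exp (real 55 * 1) = exp (1::real) ^ 55" by (rule exp_of_nat_mult)
  also have "\<dots> \<le> (68/25) ^ 55" using e_less_272 by (intro power_mono) auto
  also have "\<dots> \<le> N ^ 2" by (simp add: N_def power_divide)
  finally have "real 55 * 1 \<le> ln (N ^ 2)" using N by (subst ln_ge_iff) (simp_all only: zero_less_power)
  also have "ln (N ^ 2) = 2 * ln N" using N by (subst ln_realpow) auto
  also have "ln N = ln (2^14) + ln (3^9) + ln (5^5)"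
  proof -
    have "ln (a * b * c) = ln a + ln b + ln c" if "a > 0" "b > 0" "c > 0" for a b c :: real
      using that by (simp add: ln_mult)
    thus ?thesis unfolding N_def by this simp_all
  qed
  also have "\<dots> = 14 * ln 2 + 9 * ln 3 + 5 * ln 5"
    using ln_realpow[of "2::real" 14] ln_realpow[of "3::real" 9] ln_realpow[of "5::real" 5] by linarith
  finally show ?thesis by simp
qed

lemma psi_chebyshev:
  assumes n: "n \<ge> 30"
  shows "psi n \<ge> 55/60 * real n - 4 * ln (real n)"
proof -
  define x where "x = real n"
  define L where "L = ln x"
  have x: "x \<ge> 30" using n by (simp add: x_def)
  have fl: "real (n div k) \<le> x / real k" "x / real k < real (n div k) + 1" if "k > 0" for k
  proof -
    have "real n = real (k * (n div k) + n mod k)" by simp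
    hence "x = real k * real (n div k) + real (n mod k)" unfolding x_def by (simp only: of_nat_add of_nat_mult)
    moreover have "real (n mod k) < real k" using that by simp
    ultimately show "real (n div k) \<le> x / real k" "x / real k < real (n div k) + 1"
      using that by (simp_all add: field_simps)
  qed
  have lnk: "ln (x / k) = L - ln k" if "k > 0" for k using that x by (simp add: L_def ln_div)
  have t30: "ln (fact (n div 30)) \<ge> x / 30 * (L - ln 30) - x / 30 + 1 - (L - ln 30)"
    using ln_fact_floor_bounds(1)[of "x / 30" "n div 30"] fl[of 30] x lnk[of 30] by simp
  have t2: "ln (fact (n div 2)) \<le> x / 2 * (L - ln 2) - x / 2 + 1 + (L - ln 2)"
    using ln_fact_floor_bounds(2)[of "x / 2" "n div 2"] fl[of 2] x lnk[of 2] by simp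
  have t3: "ln (fact (n div 3)) \<le> x / 3 * (L - ln 3) - x / 3 + 1 + (L - ln 3)"
    using ln_fact_floor_bounds(2)[of "x / 3" "n div 3"] fl[of 3] x lnk[of 3] by simp
  have t5: "ln (fact (n div 5)) \<le> x / 5 * (L - ln 5) - x / 5 + 1 + (L - ln 5)"
    using ln_fact_floor_bounds(2)[of "x / 5" "n div 5"] fl[of 5] x lnk[of 5] by simp
  have t1: "ln (fact n) \<ge> x * L - x + 1" using ln_fact_bounds(1)[of n] n by (simp add: x_def L_def)
  have l30: "ln 30 = ln 2 + ln 3 + ln (5::real)" using ln_mult[of 2 "15::real"] ln_mult[of 3 "5::real"] by simp
  have l1: "ln 30 \<ge> (1::real)"
  proof -
    have "ln (exp 1) \<le> ln (30::real)" using exp_le by (intro ln_mono) auto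
    thus ?thesis by simp
  qed
  have "psi n \<ge> x * ((14 * ln 2 + 9 * ln 3 + 5 * ln 5) / 30) - 4 * L + 2 * ln 30 - 1"
  proof -
    have e30: "x / 30 * (L - ln 30) - x / 30 + 1 - (L - ln 30) = 1/30 * (x * L) - 1/30 * (x * ln 2) - 1/30 * (x * ln 3) - 1/30 * (x * ln 5) - x / 30 + 1 - L + ln 30"
      by (simp add: l30 field_simps)
    have e2: "x / 2 * (L - ln 2) - x / 2 + 1 + (L - ln 2) = 1/2 * (x * L) - 1/2 * (x * ln 2) - x / 2 + 1 + L - ln 2"
      by (simp add: field_simps)
    have e3: "x / 3 * (L - ln 3) - x / 3 + 1 + (L - ln 3) = 1/3 * (x * L) - 1/3 * (x * ln 3) - x / 3 + 1 + L - ln 3"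
      by (simp add: field_simps)
    have e5: "x / 5 * (L - ln 5) - x / 5 + 1 + (L - ln 5) = 1/5 * (x * L) - 1/5 * (x * ln 5) - x / 5 + 1 + L - ln 5"
      by (simp add: field_simps)
    have e: "x * ((14 * ln 2 + 9 * ln 3 + 5 * ln 5) / 30) = 14/30 * (x * ln 2) + 9/30 * (x * ln 3) + 5/30 * (x * ln 5)"
      by (simp add: field_simps)
    show ?thesis
      using psi_ge_ln_facts[of n] t1 t2 t3 t5 t30 l30 unfolding e30 e2 e3 e5 e by linarith
  qed
  moreover have "x * ((14 * ln 2 + 9 * ln 3 + 5 * ln 5) / 30) \<ge> x * (55/2 / 30)"
    using chebyshev_constant x by (intro mult_left_mono divide_right_mono) auto
  ultimately show ?thesis using l1 by (simp add: x_def L_def)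
qed

text \<open>
For \<open>n \<ge> 20000\<close> one has \<open>log n \<le> n / 2000\<close>, so the logarithmic error costs at most \<open>0.002 n\<close>.
\<close>

lemma psi_chebyshev_914:
  assumes n: "n \<ge> 20000"
  shows "psi n \<ge> 914/1000 * real n"
proof -
  have "ln (real n) \<le> real n / 20000 - 1 + 10" using ln_le_linear[of "real n" 20000] ln_20000_le n by simp
  also have "\<dots> \<le> real n / 2000" using n by simp
  finally have "4 * ln (real n) \<le> real n / 500" by simp
  thus ?thesis using psi_chebyshev[of n] n by simp
qed

text \<open>
A prime \<open>p\<close> contributes \<open>log p\<close> once for every power \<open>p ^ k \<le> n\<close>, in total at most \<open>log n\<close>.
\<close>

lemma psi_le_prime_pi:
  assumes n: "n \<ge> 2"
  shows "psi n \<le> real (prime_pi n) * ln (real n)"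
proof -
  define P where "P = {p. prime p \<and> p \<le> n}"
  have finP: "finite P" by (rule finite_subset[of _ "{..n}"]) (auto simp: P_def)
  define A where "A = {d\<in>{1..n}. primepow d}"
  have "(mangoldt d :: real) = (if primepow d then ln (real (aprimedivisor d)) else 0)" for d
    by (simp add: mangoldt_def)
  hence "psi n = (\<Sum>d\<in>A. ln (real (aprimedivisor d)))"
    unfolding psi_def A_def by (subst sum.inter_filter) auto
  also have "\<dots> = (\<Sum>p\<in>P. \<Sum>d\<in>{d\<in>A. aprimedivisor d = p}. ln (real (aprimedivisor d)))"
  proof (rule sum.group[symmetric])
    show "aprimedivisor ` A \<subseteq> P"
    proof (intro image_subsetI)
      fix d assume "d \<in> A"
      hence d: "1 \<le> d" "d \<le> n" "primepow d" by (auto simp: A_def)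
      then obtain p k where pk: "prime p" "k > 0" "d = p ^ k" by (auto simp: primepow_def)
      hence ap: "aprimedivisor d = p" by (simp add: aprimedivisor_prime_power)
      have "p dvd d" using pk by (simp add: dvd_power)
      hence "p \<le> d" using d by (intro dvd_imp_le) auto
      thus "aprimedivisor d \<in> P" using ap pk d by (simp add: P_def)
    qed
  qed (use finP in \<open>auto simp: A_def\<close>)
  also have "\<dots> \<le> (\<Sum>p\<in>P. ln (real n))"
  proof (rule sum_mono)
    fix p assume p: "p \<in> P"
    hence pp: "prime p" "p \<ge> 2" by (auto simp: P_def prime_ge_2_nat)
    define D where "D = {d\<in>A. aprimedivisor d = p}"
    define K where "K = {k\<in>{1..n}. p ^ k \<le> n}"
    have sub: "D \<subseteq> (\<lambda>k. p ^ k) ` K"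
    proof
      fix d assume "d \<in> D"
      hence d: "1 \<le> d" "d \<le> n" "primepow d" "aprimedivisor d = p" by (auto simp: D_def A_def)
      then obtain q k where pk: "prime q" "k > 0" "d = q ^ k" by (auto simp: primepow_def)
      hence "q = p" using d by (simp add: aprimedivisor_prime_power)
      moreover have "k < p ^ k" using pp by (intro power_gt_expt) auto
      ultimately show "d \<in> (\<lambda>k. p ^ k) ` K" using pk d by (auto simp: K_def)
    qed
    have finK: "finite K" by (simp add: K_def)
    have cD: "card D \<le> card K"
      using surj_card_le[OF finK sub] .
    have "real (card K) * ln (real p) \<le> ln (real n)"
    proof (cases "K = {}")
      case False
      define k where "k = Max K"
      have k: "k \<in> K" using False finK by (simp add: k_def)
      have "K \<subseteq> {1..k}" using finK by (auto simp: k_def K_def)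
      hence "card K \<le> k" using card_mono[of "{1..k}" K] by simp
      hence "real (card K) * ln (real p) \<le> real k * ln (real p)" using pp by (intro mult_right_mono) auto
      also have "\<dots> = ln (real (p ^ k))" using pp by (simp add: ln_realpow)
      also have "\<dots> \<le> ln (real n)" using k pp n by (subst ln_le_cancel_iff) (auto simp: K_def simp del: of_nat_power)
      finally show ?thesis .
    qed (use n in auto)
    moreover have "(\<Sum>d\<in>D. ln (real (aprimedivisor d))) = real (card D) * ln (real p)"
      by (simp add: D_def)
    moreover have "real (card D) * ln (real p) \<le> real (card K) * ln (real p)"
      using cD pp by (intro mult_right_mono) auto
    ultimately show "(\<Sum>d\<in>{d\<in>A. aprimedivisor d = p}. ln (real (aprimedivisor d))) \<le> ln (real n)"
      by (simp add: D_def)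
  qed
  also have "\<dots> = real (prime_pi n) * ln (real n)" by (simp add: prime_pi_def P_def)
  finally show ?thesis .
qed

section \<open>Mertens' theorem and the size of Upsilon\<close>

lemma finite_primes_le [simp]: "finite {p::nat. prime p \<and> p \<le> n}"
  by (rule finite_subset[of _ "{..n}"]) auto

definition mertens_sum :: "nat \<Rightarrow> real" where
  "mertens_sum n = (\<Sum>p | prime p \<and> p \<le> n. ln (real p) / real p)"

text \<open>
Replacing \<open>n div d\<close> by \<open>n / d\<close> in the identity for \<open>log n!\<close> costs at most \<open>psi n\<close>. With \<open>psi n \<le> 1.7 (n - 1)\<close>
and Stirling's formula, what remains above \<open>log n\<close> is \<open>0.7 + (log n - 0.7) / n\<close>.
\<close>

lemma mertens_sum_le:
  assumes n: "n \<ge> 1" shows "mertens_sum n \<le> ln (real n) + 95/100"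
proof -
  have x: "real n > 0" using n by simp
  have "real n * mertens_sum n = (\<Sum>p | prime p \<and> p \<le> n. real n * (mangoldt p / real p))"
    unfolding mertens_sum_def by (simp add: sum_distrib_left mangoldt_prime)
  also have "\<dots> \<le> (\<Sum>d=1..n. real n * (mangoldt d / real d))"
    by (intro sum_mono2) (auto simp: mangoldt_nonneg prime_ge_1_nat intro!: mult_nonneg_nonneg divide_nonneg_nonneg dest: prime_ge_1_nat)
  also have "\<dots> \<le> (\<Sum>d=1..n. mangoldt d * real (n div d) + mangoldt d)"
  proof (rule sum_mono)
    fix d assume d: "d \<in> {1..n}"
    have "real n = real (d * (n div d) + n mod d)" by simp
    hence "real n = real d * real (n div d) + real (n mod d)" by (simp only: of_nat_add of_nat_mult)
    moreover have "real (n mod d) \<le> real d" using d by (simp add: less_imp_le)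
    ultimately have "real n / real d \<le> real (n div d) + 1" using d by (simp add: field_simps)
    hence "mangoldt d * (real n / real d) \<le> mangoldt d * (real (n div d) + 1)" by (intro mult_left_mono mangoldt_nonneg)
    thus "real n * (mangoldt d / real d) \<le> mangoldt d * real (n div d) + mangoldt d" by (simp add: algebra_simps)
  qed
  also have "\<dots> = ln (fact n) + psi n" by (simp add: sum.distrib ln_fact_eq[of n n] psi_def)
  also have "\<dots> \<le> (real n * ln (real n) - real n + 1 + ln (real n)) + 17/10 * (real n - 1)"
    by (intro add_mono ln_fact_bounds psi_le n)
  also have "\<dots> = real n * (ln (real n) + 7/10) + (ln (real n) - 7/10)" by (simp add: field_simps)
  also have "ln (real n) - 7/10 \<le> real n * (1/4)"
  proof -
    have "ln (real n) \<le> real n / 4 - 1 + ln 4" using x by (intro ln_le_linear) auto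
    moreover have "ln 4 = 2 * ln (2::real)" using ln_realpow[of "2::real" 2] by simp
    ultimately show ?thesis using ln2_le_25_over_36 by simp
  qed
  finally have "real n * mertens_sum n \<le> real n * (ln (real n) + 95/100)" by (simp add: algebra_simps)
  thus ?thesis using x by simp
qed

lemma primes_le_Suc:
  "{p. prime p \<and> p \<le> Suc n} = (if prime (Suc n) then insert (Suc n) {p. prime p \<and> p \<le> n} else {p. prime p \<and> p \<le> n})"
  by (auto simp: le_Suc_eq)

lemma sum_primes_Suc:
  "(\<Sum>p | prime p \<and> p \<le> Suc n. f p) = (if prime (Suc n) then f (Suc n) else (0::real)) + (\<Sum>p | prime p \<and> p \<le> n. f p)"
  unfolding primes_le_Suc by (auto simp: sum.insert)

text \<open>
Abel summation with weights \<open>1 / log p\<close>, arranged as an induction. The step uses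
\<open>1 - a / b \<le> log b - log a\<close> for \<open>a = log n\<close> and \<open>b = log (n + 1)\<close>, which is where the double logarithm
comes from.
\<close>

lemma sum_inverse_primes_aux:
  assumes n: "n \<ge> 2"
  shows "(\<Sum>p | prime p \<and> p \<le> n. 1 / real p) \<le> mertens_sum n / ln (real n) + ln (ln (real n)) - ln (ln 2)
           + 95/100 * (1 / ln 2 - 1 / ln (real n))"
  using n
proof (induction n rule: dec_induct)
  case base
  have "{p::nat. prime p \<and> p \<le> 2} = {2}" by (auto dest: prime_ge_2_nat)
  thus ?case by (simp add: mertens_sum_def)
next
  case (step n)
  define a b where "a = ln (real n)" and "b = ln (real (Suc n))"
  have a: "a > 0" and ab: "a < b" using step.hyps by (auto simp: a_def b_def)
  define r where "r = (if prime (Suc n) then 1 / real (Suc n) else 0)"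
  have M: "mertens_sum (Suc n) = r * b + mertens_sum n"
    unfolding mertens_sum_def sum_primes_Suc by (simp add: r_def b_def)
  have S: "(\<Sum>p | prime p \<and> p \<le> Suc n. 1 / real p) = r + (\<Sum>p | prime p \<and> p \<le> n. 1 / real p)"
    unfolding sum_primes_Suc r_def by simp
  have "mertens_sum n \<le> a + 95/100" unfolding a_def using step.hyps by (intro mertens_sum_le) auto
  moreover have "1 / a - 1 / b \<ge> 0" using a ab by (simp add: field_simps)
  ultimately have "mertens_sum n * (1 / a - 1 / b) \<le> (a + 95/100) * (1 / a - 1 / b)" by (rule mult_right_mono)
  also have "\<dots> = (1 - a / b) + 95/100 * (1 / a - 1 / b)" using a ab by (simp add: field_simps)
  also have "1 - a / b \<le> ln b - ln a" using a ab by (intro ln_diff_ge) auto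
  finally have "mertens_sum n / a - mertens_sum n / b \<le> ln b - ln a + 95/100 * (1 / a - 1 / b)"
    by (simp add: right_diff_distrib)
  moreover have "mertens_sum (Suc n) / b = r + mertens_sum n / b" using a ab by (simp add: M add_divide_distrib)
  moreover have "(\<Sum>p | prime p \<and> p \<le> n. 1 / real p) \<le> mertens_sum n / a + ln a - ln (ln 2) + 95/100 * (1 / ln 2 - 1 / a)"
    using step.IH by (simp add: a_def)
  ultimately show ?case unfolding S a_def[symmetric] b_def[symmetric]
    unfolding right_diff_distrib by linarith
qed

lemma sum_inverse_primes_le:
  assumes n: "n \<ge> 2"
  shows "(\<Sum>p | prime p \<and> p \<le> n. 1 / real p) \<le> ln (ln (real n)) + 3"
proof -
  define a where "a = ln (real n)"
  have l2: "ln 2 \<ge> (2/3::real)" by (rule ln2_ge_two_thirds)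
  have a: "a > 0" using n by (simp add: a_def)
  have "mertens_sum n / a \<le> (a + 95/100) / a" using mertens_sum_le[of n] n a by (intro divide_right_mono) (auto simp: a_def)
  also have "\<dots> = 1 + 95/100 * (1 / a)" using a by (simp add: field_simps)
  finally have 1: "mertens_sum n / a \<le> 1 + 95/100 * (1 / a)" .
  have "1 - 1 / ln 2 \<le> ln (ln (2::real))" using ln_diff_le[of "ln 2" "1::real"] l2 by simp
  moreover have "1 / ln 2 \<le> 1 / (2/3::real)" using l2 by (intro divide_left_mono) auto
  ultimately have "- ln (ln (2::real)) \<le> 1/2" "1 / ln (2::real) \<le> 3/2" by simp_all
  moreover have "(\<Sum>p | prime p \<and> p \<le> n. 1 / real p) \<le> mertens_sum n / a + ln a - ln (ln 2) + (95/100 * (1 / ln 2) - 95/100 * (1 / a))"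
    using sum_inverse_primes_aux[OF n] unfolding a_def[symmetric] right_diff_distrib .
  ultimately show ?thesis using 1 unfolding a_def[symmetric] by linarith
qed

text \<open>
Legendre's formula \<open>v\<^sub>p(n!) = \<Sum> n div p ^ k\<close>, bounded by a geometric series.
\<close>

lemma multiplicity_fact_le:
  assumes p: "prime (p::nat)"
  shows "real (multiplicity p (fact n)) \<le> real n / (real p - 1)"
proof -
  have p2: "p \<ge> 2" using p by (rule prime_ge_2_nat)
  have "multiplicity p (fact n) = (\<Sum>m=1..n. multiplicity p m)"
  proof (induction n)
    case (Suc n)
    have "multiplicity p (fact (Suc n)) = multiplicity p (Suc n * fact n)" by (simp del: of_nat_Suc)
    also have "\<dots> = multiplicity p (Suc n) + multiplicity p (fact n)"
      using p by (intro prime_elem_multiplicity_mult_distrib) auto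
    finally show ?case using Suc by simp
  qed simp
  also have "\<dots> = (\<Sum>m=1..n. \<Sum>k=1..n. if p ^ k dvd m then 1 else 0)"
  proof (intro sum.cong refl)
    fix m assume m: "m \<in> {1..n}"
    have iff: "p ^ k dvd m \<longleftrightarrow> k \<le> multiplicity p m" for k
      using m p2 by (intro power_dvd_iff_le_multiplicity) auto
    have le: "multiplicity p m \<le> n"
    proof -
      have "p ^ multiplicity p m dvd m" by (rule multiplicity_dvd)
      hence "p ^ multiplicity p m \<le> m" using m by (intro dvd_imp_le) auto
      moreover have "multiplicity p m < p ^ multiplicity p m" using p2 by (intro power_gt_expt) auto
      ultimately show ?thesis using m by simp
    qed
    have eq: "{k\<in>{1..n}. p ^ k dvd m} = {1..multiplicity p m}" unfolding iff using le by auto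
    have "multiplicity p m = (\<Sum>k\<in>{k\<in>{1..n}. p ^ k dvd m}. 1)" unfolding eq by simp
    also have "\<dots> = (\<Sum>k=1..n. if p ^ k dvd m then 1 else 0)" by (rule sum.inter_filter) simp
    finally show "multiplicity p m = (\<Sum>k=1..n. if p ^ k dvd m then 1 else 0)" .
  qed
  also have "\<dots> = (\<Sum>k=1..n. \<Sum>m=1..n. if p ^ k dvd m then 1 else 0)" by (rule sum.swap)
  also have "\<dots> = (\<Sum>k=1..n. n div p ^ k)"
  proof (intro sum.cong refl)
    fix k
    have "(\<Sum>m=1..n. if p ^ k dvd m then 1 else 0) = (\<Sum>m\<in>{m\<in>{1..n}. p ^ k dvd m}. 1::nat)"
      by (rule sum.inter_filter[symmetric]) simp
    thus "(\<Sum>m=1..n. if p ^ k dvd m then 1 else 0) = n div p ^ k"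
      using card_multiples[of "p ^ k" n] p2 by simp
  qed
  finally have "real (multiplicity p (fact n)) = (\<Sum>k=1..n. real (n div p ^ k))" by simp
  also have "\<dots> \<le> (\<Sum>k=1..n. real n * (1 / real p) ^ k)"
  proof (rule sum_mono)
    fix k
    have "real (n div p ^ k * p ^ k) \<le> real n" by (intro of_nat_mono) simp
    thus "real (n div p ^ k) \<le> real n * (1 / real p) ^ k"
      using p2 by (simp add: field_simps power_divide)
  qed
  also have "\<dots> = real n * (\<Sum>k=1..n. (1 / real p) ^ k)" by (simp add: sum_distrib_left)
  also have "(\<Sum>k=1..n. (1 / real p) ^ k) \<le> 1 / (real p - 1)"
  proof -
    have "(\<Sum>k=1..n. (1 / real p) ^ k) \<le> 1 / (real p - 1) - (1 / real p) ^ n / (real p - 1)"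
    proof (induction n)
      case (Suc n)
      have "(1 / real p) ^ Suc n = (1 / real p) ^ n / (real p - 1) - (1 / real p) ^ Suc n / (real p - 1)"
      proof -
        have "1 / (w + 1) * y = y / w - 1 / (w + 1) * y / w" if "w > 0" for w y :: real
        proof -
          have "y / w - 1 / (w + 1) * y / w = y / w * (1 - 1 / (w + 1))" by (simp add: algebra_simps)
          also have "1 - 1 / (w + 1) = w / (w + 1)" using that by (simp add: field_simps)
          also have "y / w * (w / (w + 1)) = 1 / (w + 1) * y" using that by simp
          finally show ?thesis by simp
        qed
        from this[of "real p - 1" "(1 / real p) ^ n"] show ?thesis using p2
          by (simp only: power_Suc diff_add_cancel)
      qed
      moreover have "(\<Sum>k=1..Suc n. (1 / real p) ^ k) = (\<Sum>k=1..n. (1 / real p) ^ k) + (1 / real p) ^ Suc n" by simp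
      ultimately show ?case using Suc by linarith
    qed simp
    moreover have "(1 / real p) ^ n / (real p - 1) \<ge> 0" using p2 by simp
    ultimately show ?thesis by linarith
  qed
  finally show ?thesis by (simp add: mult_left_mono)
qed

text \<open>
Split \<open>1 / (p - 1)\<close> into \<open>1 / p\<close> and \<open>1 / (p (p - 1))\<close>; the second part telescopes to at most 1 when
summed over all integers from 2 on.
\<close>

lemma Upsilon_le:
  assumes n: "n \<ge> 2"
  shows "real (Upsilon n) \<le> real n * (ln (ln (real n)) + 4)"
proof -
  define P where "P = {p. prime p \<and> p \<le> n}"
  have "real (Upsilon n) = (\<Sum>p\<in>P. real (multiplicity p (fact n)))"
    by (simp add: Upsilon_def P_def)
  also have "\<dots> \<le> (\<Sum>p\<in>P. real n * (1 / real p + (1 / (real p - 1) - 1 / real p)))"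
    by (intro sum_mono) (use multiplicity_fact_le in \<open>auto simp: P_def\<close>)
  also have "\<dots> = real n * ((\<Sum>p\<in>P. 1 / real p) + (\<Sum>p\<in>P. 1 / (real p - 1) - 1 / real p))"
    by (simp only: sum.distrib[symmetric] sum_distrib_left)
  also have "\<dots> \<le> real n * ((ln (ln (real n)) + 3) + 1)"
  proof (intro mult_left_mono add_mono)
    show "(\<Sum>p\<in>P. 1 / real p) \<le> ln (ln (real n)) + 3" unfolding P_def by (rule sum_inverse_primes_le[OF n])
    have "(\<Sum>p\<in>P. 1 / (real p - 1) - 1 / real p) \<le> (\<Sum>m=2..n. 1 / (real m - 1) - 1 / real m)"
      by (intro sum_mono2) (auto simp: P_def field_simps dest: prime_ge_2_nat)
    also have "\<dots> \<le> 1 - 1 / real n" using n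
    proof (induction n rule: dec_induct)
      case (step n)
      have "{2..Suc n} = insert (Suc n) {2..n}" using step.hyps by auto
      hence "(\<Sum>m=2..Suc n. 1 / (real m - 1) - 1 / real m) = (1 / real n - 1 / real (Suc n)) + (\<Sum>m=2..n. 1 / (real m - 1) - 1 / real m)"
        by simp
      thus ?case using step.IH by simp
    qed simp
    also have "\<dots> \<le> 1" by simp
    finally show "(\<Sum>p\<in>P. 1 / (real p - 1) - 1 / real p) \<le> 1" .
  qed simp
  finally show ?thesis by (simp add: add.assoc)
qed

section \<open>Dirichlet series with bounded coefficients\<close>

lemma sum_inverse_powr_three_halves:
  "summable (\<lambda>n. real (Suc n) powr (- 3 / 2))" "(\<Sum>n. real (Suc n) powr (- 3 / 2)) \<le> 3"
proof -
  have le: "(\<Sum>n<N. real (Suc n) powr (- 3 / 2)) \<le> 3 - (if N = 0 then 0 else 2 / sqrt (real N))" for N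
  proof (induction N)
    case (Suc N)
    show ?case
    proof (cases "N = 0")
      case False
      define a where "a = sqrt (real N)"
      define b where "b = sqrt (real (Suc N))"
      have a: "a > 0" "a^2 = real N" and b: "b > 0" "b^2 = real N + 1"
        using False by (auto simp: a_def b_def)
      have "a \<le> b" by (simp add: a_def b_def)
      have "real (Suc N) powr (- 3 / 2) = 1 / b^3"
      proof -
        have "b powr 2 = real (Suc N)" using b by (simp add: add.commute)
        hence "real (Suc N) powr (- 3 / 2) = (b powr 2) powr (- 3/2)" by simp
        also have "\<dots> = b powr (-3)" by (subst powr_powr) simp
        also have "\<dots> = 1 / b^3" using b by (simp add: powr_minus divide_simps)
        finally show ?thesis .
      qed
      moreover have "1 / b^3 \<le> 2 / a - 2 / b"
      proof -
        have "(b - a) * (b + a) = 1" using a b by (simp add: algebra_simps power2_eq_square)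
        hence ba: "b - a = 1 / (b + a)" using a b by (simp add: field_simps)
        have "2 / a - 2 / b = 2 * (b - a) / (a * b)" using a b by (simp add: field_simps)
        also have "\<dots> = 2 / ((b + a) * a * b)" by (subst ba) (simp add: mult_ac)
        finally have e: "2 / a - 2 / b = 2 / ((b + a) * a * b)" .
        have "(b + a) * a * b \<le> (b + b) * b * b"
          using a b \<open>a \<le> b\<close> by (intro mult_mono) auto
        hence "2 / ((b + b) * b * b) \<le> 2 / ((b + a) * a * b)"
          using a b by (intro divide_left_mono) auto
        moreover have "2 / ((b + b) * b * b) = 1 / b^3" using b by (simp add: power3_eq_cube field_simps)
        ultimately show ?thesis using e by simp
      qed
      ultimately show ?thesis using Suc False by (simp add: a_def b_def)
    qed simp
  qed simp
  have le': "(\<Sum>n<N. real (Suc n) powr (- 3 / 2)) \<le> 3" for N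
  proof -
    have "0 \<le> (if N = 0 then 0 else 2 / sqrt (real N))" by simp
    with le[of N] show ?thesis by linarith
  qed
  show s: "summable (\<lambda>n. real (Suc n) powr (- 3 / 2))"
    by (rule summableI_nonneg_bounded[OF _ le']) simp
  show "(\<Sum>n. real (Suc n) powr (- 3 / 2)) \<le> 3"
    by (rule suminf_le_const[OF s le'])
qed

definition dirichlet :: "(nat \<Rightarrow> real) \<Rightarrow> complex \<Rightarrow> complex" where
  "dirichlet a s = (\<Sum>n. of_real (a n) * of_nat n powr (- s))"

lemma norm_nat_powr: "norm (of_nat n powr (s::complex)) = real n powr (Re s)"
  using norm_powr_real_powr[of "of_nat n" s] by (cases "n = 0") auto

lemma summable_nat_powr: "x < -1 \<Longrightarrow> summable (\<lambda>n. real n powr x)"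
  using summable_real_powr_iff by simp

lemma summable_ln_powr:
  assumes "x < -1" shows "summable (\<lambda>n. ln (real n) * real n powr x)"
proof -
  define e where "e = (- 1 - x) / 2"
  have e: "e > 0" "x + e < -1" using assms by (auto simp: e_def field_simps)
  show ?thesis
  proof (rule summable_comparison_test)
    show "summable (\<lambda>n. real n powr (x + e) / e)"
      using e by (intro summable_divide summable_nat_powr)
    have "norm (ln (real n) * real n powr x) \<le> real n powr (x + e) / e" if "n \<ge> 1" for n
    proof -
      have "ln (real n) \<le> real n powr e / e" using that e ln_powr_bound[of "real n" e] by simp
      hence "ln (real n) * real n powr x \<le> real n powr e / e * real n powr x"
        by (rule mult_right_mono) simp
      thus ?thesis using that by (simp add: powr_add mult_ac)
    qed
    thus "\<exists>N. \<forall>n\<ge>N. norm (ln (real n) * real n powr x) \<le> real n powr (x + e) / e" by blast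
  qed
qed

lemma dirichlet_sums:
  assumes "Re s > 1" "\<And>n. \<bar>a n\<bar> \<le> 1"
  shows "summable (\<lambda>n. norm (of_real (a n) * of_nat n powr (- s)))"
    and "(\<lambda>n. of_real (a n) * of_nat n powr (- s)) sums dirichlet a s"
proof -
  show *: "summable (\<lambda>n. norm (of_real (a n) * of_nat n powr (- s)))"
  proof (rule summable_comparison_test[OF _ summable_nat_powr[of "- Re s"]])
    show "\<exists>N. \<forall>n\<ge>N. norm (norm (of_real (a n) * of_nat n powr (- s))) \<le> real n powr (- Re s)"
      using assms(2) by (auto simp: norm_mult norm_nat_powr mult_left_le_one_le)
  qed (use assms in auto)
  show "(\<lambda>n. of_real (a n) * of_nat n powr (- s)) sums dirichlet a s"
    unfolding dirichlet_def using summable_norm_cancel[OF *] by (rule summable_sums)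
qed

text \<open>
Termwise differentiation. For the coefficients 1 and \<open>mangoldt n / log n\<close>, the two cases that
occur, it produces the derivative of the zeta function and the series of the von Mangoldt
function.
\<close>

lemma dirichlet_deriv:
  assumes s: "Re s > 1" and a: "\<And>n. \<bar>a n\<bar> \<le> 1"
  shows "(dirichlet a has_field_derivative - (\<Sum>n. of_real (a n * ln (real n)) * of_nat n powr (- s))) (at s)"
    and "summable (\<lambda>n. norm (of_real (a n * ln (real n)) * of_nat n powr (- s)))"
proof -
  define f where "f = (\<lambda>n s. of_real (a n) * of_nat n powr (- s) :: complex)"
  define f' where "f' = (\<lambda>n s. - (of_real (a n * ln (real n)) * of_nat n powr (- s)) :: complex)"
  define S where "S = {s. Re s > 1}"
  have opS: "open S" unfolding S_def by (rule open_halfspace_Re_gt)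
  have der: "(f n has_field_derivative f' n s) (at s)" for n s
  proof (cases "n = 0")
    case False
    hence "((\<lambda>s. of_nat n powr (- s) :: complex) has_field_derivative Ln (of_nat n) * of_nat n powr (- s) * (-1)) (at s)"
      by (intro DERIV_chain2[OF has_field_derivative_powr_right]) (auto intro!: derivative_eq_intros)
    from DERIV_cmult[OF this, of "of_real (a n)"] show ?thesis using False unfolding f_def f'_def
      by (simp add: Ln_of_nat mult_ac)
  qed (simp add: f_def f'_def)
  have loc: "\<exists>d h. 0 < d \<and> summable h \<and> range h \<subseteq> \<real>\<^sub>\<ge>\<^sub>0 \<and>
      (\<forall>\<^sub>F n in sequentially. \<forall>y\<in>ball x d \<inter> S. cmod (f n y) \<le> cmod (h n))" if "x \<in> S" for x
  proof -
    define d where "d = (Re x - 1) / 2"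
    define h where "h = (\<lambda>n. of_real (real n powr (- (Re x - d))) :: complex)"
    have d: "d > 0" "Re x - d > 1" using that by (auto simp: d_def S_def field_simps)
    have "summable h" unfolding h_def
      using summable_of_real summable_nat_powr[of "- (Re x - d)"] d by auto
    moreover have "cmod (f n y) \<le> cmod (h n)" if "n \<ge> 1" "y \<in> ball x d" for n y
    proof -
      have "\<bar>Re x - Re y\<bar> < d" using that abs_Re_le_cmod[of "x - y"] by (simp add: dist_norm)
      hence "real n powr (- Re y) \<le> real n powr (- (Re x - d))" using that by (intro powr_mono) auto
      moreover have "cmod (f n y) \<le> real n powr (- Re y)"
        using a by (auto simp: f_def norm_mult norm_nat_powr mult_left_le_one_le)
      ultimately show ?thesis by (simp add: h_def)
    qed
    moreover have "range h \<subseteq> \<real>\<^sub>\<ge>\<^sub>0" by (auto simp: h_def)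
    ultimately show ?thesis using d(1)
      by (intro exI[of _ d] exI[of _ h]) (auto intro!: eventually_sequentiallyI[of 1])
  qed
  obtain g g' where g: "\<And>x. x \<in> S \<Longrightarrow> (\<lambda>n. f n x) sums g x \<and> (\<lambda>n. f' n x) sums g' x \<and> (g has_field_derivative g' x) (at x)"
    using series_and_derivative_comparison_complex[OF opS der loc] by blast
  have sS: "s \<in> S" using s by (simp add: S_def)
  have g_eq: "g x = dirichlet a x" if "x \<in> S" for x
    using g[OF that] by (auto simp: dirichlet_def f_def sums_iff)
  have "(dirichlet a has_field_derivative g' s) (at s)"
    by (rule has_field_derivative_transform_within_open[of g _ s S]) (use g[OF sS] opS sS g_eq in auto)
  moreover have "g' s = - (\<Sum>n. of_real (a n * ln (real n)) * of_nat n powr (- s))"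
  proof -
    have "(\<lambda>n. - f' n s) sums - g' s" using g[OF sS] sums_minus by blast
    thus ?thesis by (simp add: f'_def sums_iff)
  qed
  ultimately show "(dirichlet a has_field_derivative - (\<Sum>n. of_real (a n * ln (real n)) * of_nat n powr (- s))) (at s)"
    by simp
  show "summable (\<lambda>n. norm (of_real (a n * ln (real n)) * of_nat n powr (- s)))"
  proof (rule summable_comparison_test[OF _ summable_ln_powr[of "- Re s"]])
    have "norm (norm (of_real (a n * ln (real n)) * of_nat n powr (- s))) \<le> ln (real n) * real n powr (- Re s)"
      if "n \<ge> 1" for n
    proof -
      have "\<bar>a n\<bar> * \<bar>ln (real n)\<bar> * real n powr (- Re s) \<le> 1 * ln (real n) * real n powr (- Re s)"
        using a that by (intro mult_mono) auto
      thus ?thesis by (simp add: norm_mult norm_nat_powr abs_mult)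
    qed
    thus "\<exists>N. \<forall>n\<ge>N. norm (norm (of_real (a n * ln (real n)) * of_nat n powr (- s))) \<le> ln (real n) * real n powr (- Re s)"
      by blast
  qed (use s in auto)
qed

text \<open>
Every term but the first tends to 0, and for \<open>x \<ge> 2\<close> the remainder is dominated by \<open>2 powr (- x)\<close> times
a convergent series. The limit fixes the constant in \<open>zeta s = exp (logzeta s)\<close>.
\<close>

lemma dirichlet_tendsto:
  assumes a: "\<And>n. \<bar>a n\<bar> \<le> 1"
  shows "((\<lambda>x. dirichlet a (of_real x)) \<longlongrightarrow> of_real (a 1)) at_top"
proof -
  define C where "C = (\<Sum>n. real n powr (- 2))"
  have sC: "summable (\<lambda>n. real n powr (- 2))" by (rule summable_nat_powr) simp
  have "norm (dirichlet a (of_real x) - of_real (a 1)) \<le> 4 * C * 2 powr (- x)" if x: "x \<ge> 2" for x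
  proof -
    define f where "f = (\<lambda>n. of_real (a n) * of_nat n powr (- of_real x) :: complex)"
    have "f sums dirichlet a (of_real x)" unfolding f_def using x a by (intro dirichlet_sums) auto
    hence "(\<lambda>n. f (n + 2)) sums (dirichlet a (of_real x) - (\<Sum>i<2. f i))" by (rule sums_split_initial_segment)
    moreover have "(\<Sum>i<2. f i) = of_real (a 1)" by (simp add: f_def numeral_2_eq_2)
    ultimately have s: "(\<lambda>n. f (n + 2)) sums (dirichlet a (of_real x) - of_real (a 1))" by simp
    have b: "norm (f (n + 2)) \<le> 4 * 2 powr (- x) * real (n + 2) powr (- 2)" for n
    proof -
      have "norm (f (n + 2)) \<le> real (n + 2) powr (- x)"
        using a[of "n+2"] by (auto simp: f_def norm_mult norm_nat_powr mult_left_le_one_le simp del: of_nat_add add_2_eq_Suc')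
      also have "\<dots> = real (n + 2) powr (2 - x) * real (n + 2) powr (- 2)" by (simp add: powr_add[symmetric])
      also have "real (n + 2) powr (2 - x) \<le> 2 powr (2 - x)" using x by (intro powr_mono2') auto
      also have "(2::real) powr (2 - x) = 4 * 2 powr (- x)" by (simp add: powr_diff powr_minus field_simps)
      finally show ?thesis by (simp add: mult_right_mono)
    qed
    have s2: "summable (\<lambda>n. real (n + 2) powr (- 2))" using sC by (rule summable_ignore_initial_segment)
    have "norm (suminf (\<lambda>n. f (n + 2))) \<le> (\<Sum>n. 4 * 2 powr (- x) * real (n + 2) powr (- 2))"
      by (rule norm_suminf_le[OF b]) (intro summable_mult s2)
    also have "\<dots> = 4 * 2 powr (- x) * (\<Sum>n. real (n + 2) powr (- 2))" by (rule suminf_mult[OF s2])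
    also have "(\<Sum>n. real (n + 2) powr (- 2)) \<le> C"
      unfolding C_def using suminf_split_initial_segment[OF sC, of 2] by (simp add: sum_nonneg)
    finally show ?thesis using sums_unique[OF s] by (simp add: mult_ac mult_left_mono)
  qed
  hence "eventually (\<lambda>x. norm (dirichlet a (of_real x) - of_real (a 1)) \<le> 4 * C * 2 powr (- x)) at_top"
    by (auto intro: eventually_at_top_linorderI[of 2])
  moreover have "((\<lambda>x::real. 4 * C * 2 powr (- x)) \<longlongrightarrow> 0) at_top"
  proof -
    have "((\<lambda>x::real. 2 powr (- x)) \<longlongrightarrow> 0) at_top"
      by real_asymp
    from tendsto_mult_right_zero[OF this] show ?thesis by simp
  qed
  ultimately have "((\<lambda>x. dirichlet a (of_real x) - of_real (a 1)) \<longlongrightarrow> 0) at_top"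
    by (rule Lim_null_comparison)
  thus ?thesis by (simp add: LIM_zero_iff)
qed

section \<open>The logarithm of the zeta function\<close>

text \<open>
The coefficients of the Dirichlet series of \<open>log zeta\<close>: the value at \<open>p ^ k\<close> is \<open>1 / k\<close>.
\<close>

definition mangoldt_over_ln :: "nat \<Rightarrow> real" where
  "mangoldt_over_ln n = mangoldt n / ln (real n)"

lemma mangoldt_over_ln_bounds: "0 \<le> mangoldt_over_ln n" "mangoldt_over_ln n \<le> 1"
proof -
  show "0 \<le> mangoldt_over_ln n" 
    by (cases "n = 0") (auto simp: mangoldt_over_ln_def mangoldt_nonneg intro!: divide_nonneg_nonneg)
  show "mangoldt_over_ln n \<le> 1"
  proof (cases "n \<le> 1")
    case True
    hence "n = 0 \<or> n = 1" by auto
    thus ?thesis by (auto simp: mangoldt_over_ln_def)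
  next
    case False
    thus ?thesis using mangoldt_le[of n] by (simp add: mangoldt_over_ln_def)
  qed
qed

lemma mangoldt_over_ln_ln: "mangoldt_over_ln n * ln (real n) = mangoldt n"
proof (cases "n \<le> 1")
  case True
  hence "n = 0 \<or> n = 1" by auto
  thus ?thesis by (auto simp: mangoldt_over_ln_def)
next
  case False
  thus ?thesis by (simp add: mangoldt_over_ln_def)
qed

abbreviation zeta :: "complex \<Rightarrow> complex" where "zeta \<equiv> dirichlet (\<lambda>_. 1)"
abbreviation logzeta :: "complex \<Rightarrow> complex" where "logzeta \<equiv> dirichlet mangoldt_over_ln"
definition mangoldt_series :: "complex \<Rightarrow> complex" where
  "mangoldt_series s = (\<Sum>n. of_real (mangoldt n) * of_nat n powr (- s))"
definition zeta' :: "complex \<Rightarrow> complex" where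
  "zeta' s = - (\<Sum>n. of_real (ln (real n)) * of_nat n powr (- s))"

lemma zeta_deriv: "Re s > 1 \<Longrightarrow> (zeta has_field_derivative zeta' s) (at s)"
  using dirichlet_deriv(1)[of s "\<lambda>_. 1"] by (simp add: zeta'_def)

lemma logzeta_deriv: "Re s > 1 \<Longrightarrow> (logzeta has_field_derivative - mangoldt_series s) (at s)"
  using dirichlet_deriv(1)[of s mangoldt_over_ln] mangoldt_over_ln_bounds
  by (simp add: mangoldt_series_def mangoldt_over_ln_ln del: of_real_mangoldt)

lemma mangoldt_series_abs_summable:
  "Re s > 1 \<Longrightarrow> summable (\<lambda>n. norm (of_real (mangoldt n) * of_nat n powr (- s)))"
  using dirichlet_deriv(2)[of s mangoldt_over_ln] mangoldt_over_ln_bounds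
  by (simp add: mangoldt_over_ln_ln del: of_real_mangoldt)

text \<open>
Both series converge absolutely, so their product may be summed over \<open>N = d m\<close>, and the inner sum
over the divisors of \<open>N\<close> is \<open>log N\<close>.
\<close>

lemma zeta_times_mangoldt_series:
  assumes s: "Re s > 1"
  shows "mangoldt_series s * zeta s = - zeta' s"
proof -
  define f where "f = (\<lambda>n. of_real (mangoldt n) * of_nat n powr (- s) :: complex)"
  define g where "g = (\<lambda>n. of_nat n powr (- s) :: complex)"
  define l where "l = (\<lambda>n. of_real (ln (real n)) * of_nat n powr (- s) :: complex)"
  have sf: "summable (\<lambda>n. norm (f n))" using mangoldt_series_abs_summable[OF s] by (simp add: f_def)
  have sg: "summable (\<lambda>n. norm (g n))" using dirichlet_sums(1)[of s "\<lambda>_. 1"] s by (simp add: g_def)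
  have sl: "summable (\<lambda>n. norm (l n))" using dirichlet_deriv(2)[of s "\<lambda>_. 1"] s by (simp add: l_def)
  have F: "(f has_sum mangoldt_series s) UNIV" and G: "(g has_sum zeta s) UNIV" and Lh: "(l has_sum (- zeta' s)) UNIV"
    using norm_summable_imp_has_sum[OF sf] norm_summable_imp_has_sum[OF sg] norm_summable_imp_has_sum[OF sl]
      summable_sums[OF summable_norm_cancel[OF sf]] summable_sums[OF summable_norm_cancel[OF sg]]
      summable_sums[OF summable_norm_cancel[OF sl]]
    by (simp_all add: mangoldt_series_def zeta'_def dirichlet_def f_def g_def l_def)
  have aF: "(\<lambda>x. norm (f x)) summable_on UNIV" and aG: "(\<lambda>x. norm (g x)) summable_on UNIV"
    using sf sg by (auto simp: summable_on_UNIV_nonneg_real_iff)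
  define h where "h = (\<lambda>(d, m). f d * g m)"
  have inner: "((\<lambda>m. h (d, m)) has_sum (f d * zeta s)) UNIV" for d
    unfolding h_def by (auto intro!: has_sum_cmult_right G)
  have "(\<lambda>x. norm (h x)) summable_on (UNIV \<times> UNIV)"
    unfolding Infinite_Sum.abs_summable_on_Sigma_iff
    using aF aG by (auto simp: h_def norm_mult infsum_cmult_right' abs_mult infsum_nonneg
        intro!: summable_on_cmult_right summable_on_cmult_left)
  hence "h summable_on (UNIV \<times> UNIV)" by (rule abs_summable_summable)
  hence "(h has_sum (mangoldt_series s * zeta s)) (UNIV \<times> UNIV)"
    using inner by (intro has_sum_SigmaI[where g = "\<lambda>d. f d * zeta s"] has_sum_cmult_left F) auto
  moreover have "(h has_sum (mangoldt_series s * zeta s)) (UNIV \<times> UNIV) \<longleftrightarrow>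
      (h has_sum (mangoldt_series s * zeta s)) ({0<..} \<times> {0<..})"
    by (rule has_sum_cong_neutral) (auto simp: h_def f_def g_def)
  ultimately have "(h has_sum (mangoldt_series s * zeta s)) ({0<..} \<times> {0<..})" by simp
  hence "((\<lambda>(N, d). of_real (mangoldt d) * of_nat N powr (- s)) has_sum (mangoldt_series s * zeta s))
          (Sigma {0<..} (\<lambda>N. {d. d dvd N}))"
  proof (subst has_sum_reindex_bij_witness[where i = "\<lambda>(d, m). (d * m, d)" and j = "\<lambda>(N, d). (d, N div d)"
        and T = "{0<..} \<times> {0<..}" and h = h and s' = "mangoldt_series s * zeta s"], goal_cases)
    case (5 a)
    obtain N d where a: "a = (N, d)" by (cases a)
    have "N = d * (N div d)" using 5 a by auto
    hence "(of_nat N :: complex) powr (- s) = (of_nat d * of_nat (N div d)) powr (- s)"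
      by (metis of_nat_mult)
    also have "\<dots> = of_nat d powr (- s) * of_nat (N div d) powr (- s)"
      by (rule powr_times_real) auto
    finally show ?case by (simp add: a h_def f_def g_def)
  qed (auto simp: dvd_div_eq_0_iff elim!: dvdE intro!: Nat.gr0I)
  moreover have "((\<lambda>d. (case (N, d) of (N, d) \<Rightarrow> of_real (mangoldt d) * of_nat N powr (- s))) has_sum l N) {d. d dvd N}"
    if "N \<in> {0<..}" for N
  proof (rule has_sum_finiteI)
    show "finite {d. d dvd N}" using that by auto
    have "(\<Sum>d | d dvd N. mangoldt d :: complex) = of_real (ln (real N))"
      using mangoldt_sum[of N] that by simp
    thus "l N = (\<Sum>d\<in>{d. d dvd N}. case (N, d) of (N, d) \<Rightarrow> of_real (mangoldt d) * of_nat N powr (- s))"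
      by (simp add: l_def flip: sum_distrib_right)
  qed
  ultimately have "(l has_sum (mangoldt_series s * zeta s)) {0<..}"
    by (rule has_sum_SigmaD)
  moreover have "(l has_sum (mangoldt_series s * zeta s)) {0<..} \<longleftrightarrow> (l has_sum (mangoldt_series s * zeta s)) UNIV"
    by (rule has_sum_cong_neutral) (auto simp: l_def)
  ultimately have "(l has_sum (mangoldt_series s * zeta s)) UNIV" by simp
  with Lh show ?thesis using has_sum_unique by blast
qed

text \<open>
By the previous lemma \<open>zeta s * exp (- logzeta s)\<close> has derivative 0, hence is constant on the half-plane;
letting \<open>s\<close> tend to infinity along the reals shows that the constant is 1. This replaces the Euler
product and also shows that \<open>zeta\<close> does not vanish for \<open>Re s > 1\<close>.
\<close>

lemma zeta_eq_exp_logzeta: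
  assumes s: "Re s > 1"
  shows "zeta s = exp (logzeta s)"
proof -
  define S where "S = {s::complex. Re s > 1}"
  have conv: "convex S" unfolding S_def by (rule convex_halfspace_Re_gt)
  have opS: "open S" unfolding S_def by (rule open_halfspace_Re_gt)
  define q where "q = (\<lambda>s. zeta s * exp (- logzeta s))"
  have "(q has_field_derivative 0) (at z within S)" if "z \<in> S" for z
  proof -
    have z: "Re z > 1" using that by (simp add: S_def)
    have "(q has_field_derivative (zeta' z * exp (- logzeta z) + exp (- logzeta z) * mangoldt_series z * zeta z)) (at z)"
      unfolding q_def
      by (rule derivative_eq_intros zeta_deriv[OF z] logzeta_deriv[OF z] refl | simp)+
    moreover have "zeta' z * exp (- logzeta z) + exp (- logzeta z) * mangoldt_series z * zeta z = 0"
    proof -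
      have "zeta' z = - (mangoldt_series z * zeta z)" using zeta_times_mangoldt_series[OF z] by simp
      thus ?thesis by simp
    qed
    ultimately show ?thesis using DERIV_subset by fastforce
  qed
  from has_field_derivative_zero_constant[OF conv this]
  obtain c where c: "\<And>z. z \<in> S \<Longrightarrow> q z = c" by blast
  have "((\<lambda>x. q (of_real x)) \<longlongrightarrow> of_real 1 * exp (- (of_real (mangoldt_over_ln 1)))) at_top"
    unfolding q_def using mangoldt_over_ln_bounds
    by (intro tendsto_intros dirichlet_tendsto[of "\<lambda>_. 1"] dirichlet_tendsto[of mangoldt_over_ln]) auto
  moreover have "((\<lambda>x. q (of_real x)) \<longlongrightarrow> c) at_top"
    by (rule tendsto_eventually) (auto intro!: eventually_at_top_linorderI[of 2] c simp: S_def)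
  ultimately have "c = of_real 1 * exp (- (of_real (mangoldt_over_ln 1)))"
    using tendsto_unique trivial_limit_at_top_linorder by blast
  hence "c = 1" by (simp add: mangoldt_over_ln_def)
  hence "zeta s * exp (- logzeta s) = 1" using c[of s] s by (simp add: S_def q_def)
  thus ?thesis by (simp add: exp_minus field_simps)
qed

text \<open>
The logarithm of the left-hand side has the coefficients of \<open>logzeta\<close>, which are nonnegative, times
\<open>3 + 4 cos y + cos 2y = 2 (1 + cos y)\<^sup>2\<close> with \<open>y = t log n\<close>.
\<close>

lemma zeta_3_4_1:
  assumes x: "x > 1"
  shows "norm (zeta (of_real x)) ^ 3 * norm (zeta (Complex x t)) ^ 4 * norm (zeta (Complex x (2 * t))) \<ge> 1"
proof -
  define f where "f = (\<lambda>u n. of_real (mangoldt_over_ln n) * of_nat n powr (- Complex x u) :: complex)"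
  have sm: "(\<lambda>n. Re (f u n)) sums Re (logzeta (Complex x u))" for u
    unfolding f_def by (intro sums_Re dirichlet_sums) (use x mangoldt_over_ln_bounds in auto)
  have Re_f: "Re (f u n) = mangoldt_over_ln n * real n powr (- x) * cos (u * ln (real n))" for u n
  proof (cases "n = 0")
    case False
    have "of_nat n powr (- Complex x u) = exp (of_real (- x * ln (real n)) + \<i> * of_real (- u * ln (real n)))"
      using False by (simp add: powr_def Ln_of_nat complex_eq_iff Complex_eq exp_eq_polar Re_exp Im_exp algebra_simps)
    hence "Re (of_nat n powr (- Complex x u)) = exp (- x * ln (real n)) * cos (u * ln (real n))"
      by (simp add: Re_exp)
    thus ?thesis using False by (simp add: f_def powr_def)
  qed (simp add: f_def)
  have "(\<lambda>n. 3 * Re (f 0 n) + 4 * Re (f t n) + Re (f (2 * t) n)) sums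
      (3 * Re (logzeta (Complex x 0)) + 4 * Re (logzeta (Complex x t)) + Re (logzeta (Complex x (2 * t))))"
    by (intro sums_add sums_mult sm)
  moreover have "3 * Re (f 0 n) + 4 * Re (f t n) + Re (f (2 * t) n) \<ge> 0" for n
  proof -
    define y where "y = t * ln (real n)"
    have "3 + 4 * cos y + cos (2 * y) = 2 * (1 + cos y)^2"
      using cos_double_cos[of y] by (simp add: power2_eq_square algebra_simps)
    hence "3 + 4 * cos y + cos (2 * y) \<ge> 0" by simp
    hence "mangoldt_over_ln n * real n powr (- x) * (3 + 4 * cos y + cos (2 * y)) \<ge> 0"
      using mangoldt_over_ln_bounds by (intro mult_nonneg_nonneg) auto
    thus ?thesis by (simp add: Re_f y_def algebra_simps)
  qed
  ultimately have *: "3 * Re (logzeta (Complex x 0)) + 4 * Re (logzeta (Complex x t)) + Re (logzeta (Complex x (2 * t))) \<ge> 0"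
    by (metis (no_types, lifting) sums_le sums_zero)
  have n: "norm (zeta (Complex x u)) = exp (Re (logzeta (Complex x u)))" for u
    using zeta_eq_exp_logzeta[of "Complex x u"] x by simp
  have "1 \<le> exp (3 * Re (logzeta (Complex x 0)) + 4 * Re (logzeta (Complex x t)) + Re (logzeta (Complex x (2 * t))))"
    using * by simp
  also have "\<dots> = norm (zeta (Complex x 0)) ^ 3 * norm (zeta (Complex x t)) ^ 4 * norm (zeta (Complex x (2 * t)))"
    by (simp add: n exp_add exp_of_nat_mult[symmetric])
  finally show ?thesis by (simp add: complex_of_real_def)
qed

section \<open>Continuation of (s - 1) zeta(s)\<close>

text \<open>
This is \<open>s - 1\<close> times the difference between \<open>n powr (- s)\<close> and the integral of \<open>x powr (- s)\<close> over
\<open>{n..n + 1}\<close>, with \<open>n\<close> shifted by one. Multiplying by \<open>s - 1\<close> makes each term entire, so that \<open>s = 1\<close>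
needs no special treatment.
\<close>

definition Z_term :: "nat \<Rightarrow> complex \<Rightarrow> complex" where
  "Z_term n s = (s - 1) * of_nat (Suc n) powr (- s) + of_nat (Suc (Suc n)) powr (1 - s) - of_nat (Suc n) powr (1 - s)"

definition Z :: "complex \<Rightarrow> complex" where
  "Z s = 1 + (\<Sum>n. Z_term n s)"

text \<open>
The term is the second-order Taylor remainder of \<open>u powr (1 - s)\<close> between \<open>n\<close> and \<open>n + 1\<close>.
\<close>

lemma norm_Z_term_le:
  assumes s: "Re s > 0"
  shows "norm (Z_term n s) \<le> norm s * norm (s - 1) * real (Suc n) powr (- Re s - 1)"
proof -
  define S where "S = closed_segment (complex_of_real (real (Suc n))) (complex_of_real (real (Suc (Suc n))))"
  have S: "\<exists>x\<ge>real (Suc n). u = complex_of_real x" if "u \<in> S" for u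
    using that unfolding S_def closed_segment_of_real by (auto simp: closed_segment_eq_real_ivl)
  define f where "f = (\<lambda>i::nat. if i = 0 then (\<lambda>u. u powr (1 - s)) else if i = 1 then (\<lambda>u. (1 - s) * u powr (- s))
       else (\<lambda>u. (1 - s) * (- s * u powr (- s - 1))))"
  have "norm (f 0 (of_nat (Suc (Suc n))) - (\<Sum>i\<le>1. f i (of_nat (Suc n)) * (of_nat (Suc (Suc n)) - of_nat (Suc n)) ^ i / fact i))
     \<le> norm s * norm (s - 1) * real (Suc n) powr (- Re s - 1) * norm (of_nat (Suc (Suc n)) - of_nat (Suc n) :: complex) ^ Suc 1 / fact 1"
  proof (rule complex_Taylor[of S])
    show "convex S" by (simp add: S_def)
    show "of_nat (Suc n) \<in> S" by (auto simp: S_def simp del: of_nat_Suc)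
    show "of_nat (Suc (Suc n)) \<in> S" by (auto simp: S_def simp del: of_nat_Suc)
    fix i :: nat and x assume x: "x \<in> S" and i: "i \<le> 1"
    obtain y where y: "y \<ge> real (Suc n)" "x = complex_of_real y" using S[OF x] by blast
    have nn: "x \<notin> \<real>\<^sub>\<le>\<^sub>0" using y by (auto simp: complex_nonpos_Reals_iff)
    have "(f i has_field_derivative f (Suc i) x) (at x)"
    proof (cases "i = 0")
      case True
      have "((\<lambda>u. u powr (1 - s)) has_field_derivative (1 - s) * x powr (1 - s - 1)) (at x)"
        by (rule has_field_derivative_powr[OF nn])
      thus ?thesis using True by (simp add: f_def)
    next
      case False
      hence "i = 1" using i by simp
      moreover have "((\<lambda>u. (1 - s) * u powr (- s)) has_field_derivative (1 - s) * (- s * x powr (- s - 1))) (at x)"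
        by (intro DERIV_cmult has_field_derivative_powr[OF nn])
      ultimately show ?thesis by (simp add: f_def)
    qed
    thus "(f i has_field_derivative f (Suc i) x) (at x within S)" by (rule has_field_derivative_at_within)
  next
    fix x assume x: "x \<in> S"
    obtain y where y: "y \<ge> real (Suc n)" "x = complex_of_real y" using S[OF x] by blast
    have "norm (x powr (- s - 1)) = y powr (- Re s - 1)"
      using y norm_powr_real_powr[of "of_real y" "- s - 1"] by simp
    also have "\<dots> \<le> real (Suc n) powr (- Re s - 1)"
      using y s by (intro powr_mono2') auto
    finally have "norm s * norm (s - 1) * norm (x powr (- s - 1)) \<le> norm s * norm (s - 1) * real (Suc n) powr (- Re s - 1)"
      by (intro mult_left_mono) auto
    thus "norm (f (Suc 1) x) \<le> norm s * norm (s - 1) * real (Suc n) powr (- Re s - 1)"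
      by (simp add: f_def norm_mult norm_minus_commute mult_ac)
  qed
  moreover have "f 0 (of_nat (Suc (Suc n))) - (\<Sum>i\<le>1. f i (of_nat (Suc n)) * (of_nat (Suc (Suc n)) - of_nat (Suc n)) ^ i / fact i) = Z_term n s"
    by (simp add: f_def Z_term_def algebra_simps)
  ultimately show ?thesis by simp
qed

lemma norm_Z_term_le_half:
  assumes "Re s \<ge> 1/2"
  shows "norm (Z_term n s) \<le> norm s * norm (s - 1) * real (Suc n) powr (- 3 / 2)"
proof -
  have "norm (Z_term n s) \<le> norm s * norm (s - 1) * real (Suc n) powr (- Re s - 1)"
    using assms by (intro norm_Z_term_le) auto
  also have "real (Suc n) powr (- Re s - 1) \<le> real (Suc n) powr (- 3 / 2)"
    using assms by (intro powr_mono) auto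
  finally show ?thesis by (simp add: mult_left_mono)
qed

lemma Z_minus_1_bound:
  assumes "Re s \<ge> 1/2"
  shows "norm (Z s - 1) \<le> 3 * norm s * norm (s - 1)"
proof -
  have "norm (\<Sum>n. Z_term n s) \<le> (\<Sum>n. norm s * norm (s - 1) * real (Suc n) powr (- 3 / 2))"
    by (rule norm_suminf_le[OF norm_Z_term_le_half[OF assms]]) (intro summable_mult sum_inverse_powr_three_halves)
  also have "\<dots> = norm s * norm (s - 1) * (\<Sum>n. real (Suc n) powr (- 3 / 2))"
    by (rule suminf_mult[OF sum_inverse_powr_three_halves(1)])
  also have "\<dots> \<le> norm s * norm (s - 1) * 3"
    by (intro mult_left_mono sum_inverse_powr_three_halves) auto
  finally show ?thesis by (simp add: Z_def mult_ac)
qed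

lemma Z_holomorphic: "Z holomorphic_on {s. Re s > 1/2}"
proof -
  define S where "S = {s::complex. Re s > 1/2}"
  have opS: "open S" unfolding S_def by (rule open_halfspace_Re_gt)
  have der: "(Z_term n has_field_derivative deriv (Z_term n) s) (at s)" for n s
  proof -
    have "Z_term n holomorphic_on UNIV" unfolding Z_term_def powr_def
      by (simp del: of_nat_Suc) (intro holomorphic_intros)
    hence "Z_term n field_differentiable (at s)" by (rule holomorphic_on_imp_differentiable_at) auto
    thus ?thesis by (simp add: DERIV_deriv_iff_field_differentiable)
  qed
  have loc: "\<exists>d h. 0 < d \<and> summable h \<and> range h \<subseteq> \<real>\<^sub>\<ge>\<^sub>0 \<and>
      (\<forall>\<^sub>F n in sequentially. \<forall>y\<in>ball x d \<inter> S. cmod (Z_term n y) \<le> cmod (h n))" for x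
  proof -
    define C where "C = (norm x + 1) * (norm x + 2)"
    define h where "h = (\<lambda>n. of_real (C * real (Suc n) powr (- 3 / 2)) :: complex)"
    have "C \<ge> 0" by (simp add: C_def)
    have "summable h" unfolding h_def
      by (intro summable_of_real summable_mult sum_inverse_powr_three_halves)
    moreover have "cmod (Z_term n y) \<le> cmod (h n)" if "y \<in> ball x 1 \<inter> S" for n y
    proof -
      have "norm y \<le> norm x + 1" using that norm_triangle_ineq2[of y x] by (simp add: dist_norm norm_minus_commute)
      moreover have "norm (y - 1) \<le> norm y + 1" using norm_triangle_ineq4[of y 1] by simp
      ultimately have "norm y * norm (y - 1) \<le> C" unfolding C_def by (intro mult_mono) auto
      moreover have "norm (Z_term n y) \<le> norm y * norm (y - 1) * real (Suc n) powr (- 3 / 2)"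
        using that by (intro norm_Z_term_le_half) (auto simp: S_def)
      ultimately have "norm (Z_term n y) \<le> C * real (Suc n) powr (- 3 / 2)"
        by (meson mult_right_mono order_trans powr_ge_zero)
      thus ?thesis using \<open>C \<ge> 0\<close> by (simp add: h_def norm_mult del: of_nat_Suc)
    qed
    moreover have "range h \<subseteq> \<real>\<^sub>\<ge>\<^sub>0" using \<open>C \<ge> 0\<close> by (auto simp: h_def simp del: of_real_mult of_nat_Suc)
    ultimately show ?thesis
      by (intro exI[of _ 1] exI[of _ h]) auto
  qed
  obtain g g' where g: "\<And>x. x \<in> S \<Longrightarrow> (\<lambda>n. Z_term n x) sums g x \<and> (g has_field_derivative g' x) (at x)"
    using series_and_derivative_comparison_complex[OF opS der loc] by blast
  have "g holomorphic_on S" using g opS by (auto simp: holomorphic_on_open)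
  hence "(\<lambda>s. 1 + g s) holomorphic_on S" by (intro holomorphic_intros)
  moreover have "1 + g x = Z x" if "x \<in> S" for x
    using g[OF that] by (simp add: Z_def sums_iff)
  ultimately show ?thesis unfolding S_def by (rule holomorphic_transform)
qed

text \<open>
The powers \<open>n powr (1 - s)\<close> telescope to -1, which the summand 1 in the definition of \<open>Z\<close> cancels.
\<close>

lemma Z_eq_zeta:
  assumes s: "Re s > 1"
  shows "Z s = (s - 1) * zeta s"
proof -
  have "(\<lambda>n. of_real 1 * of_nat n powr (- s)) sums zeta s" using s by (intro dirichlet_sums) auto
  \<comment> \<open>The term with index 0 vanishes because \<open>0 powr z = 0\<close>.\<close>
  from sums_split_initial_segment[OF this, of 1]
  have "(\<lambda>n. of_nat (Suc n) powr (- s)) sums zeta s" by simp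
  from sums_mult[OF this, of "s - 1"]
  have 1: "(\<lambda>n. (s - 1) * of_nat (Suc n) powr (- s)) sums ((s - 1) * zeta s)" .
  have "(\<lambda>n. real n powr (1 - Re s)) \<longlonglongrightarrow> 0"
    using s by (intro tendsto_neg_powr filterlim_real_sequentially) auto
  hence "(\<lambda>n. norm (of_nat (Suc n) powr (1 - s))) \<longlonglongrightarrow> 0"
    unfolding norm_nat_powr by (subst filterlim_sequentially_Suc) simp
  hence "(\<lambda>n. of_nat (Suc n) powr (1 - s)) \<longlonglongrightarrow> 0" by (rule tendsto_norm_zero_cancel)
  from telescope_sums[OF this]
  have 2: "(\<lambda>n. of_nat (Suc (Suc n)) powr (1 - s) - of_nat (Suc n) powr (1 - s)) sums (0 - 1)" by simp
  have "(\<lambda>n. Z_term n s) sums ((s - 1) * zeta s + (0 - 1))"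
    using sums_add[OF 1 2] by (simp add: Z_term_def algebra_simps)
  thus ?thesis by (simp add: Z_def sums_iff)
qed

lemma Z_nonzero: assumes "Re s > 1" shows "Z s \<noteq> 0"
  using Z_eq_zeta[OF assms] zeta_eq_exp_logzeta[OF assms] assms by auto

lemma mangoldt_series_eq:
  assumes s: "Re s > 1"
  shows "mangoldt_series s = 1 / (s - 1) - deriv Z s / Z s"
proof -
  have ne: "s \<noteq> 1" using s by auto
  have "((\<lambda>s. (s - 1) * zeta s) has_field_derivative (zeta s + (s - 1) * zeta' s)) (at s)"
    by (rule derivative_eq_intros zeta_deriv[OF s] refl | simp)+
  hence "(Z has_field_derivative (zeta s + (s - 1) * zeta' s)) (at s)"
    by (rule has_field_derivative_transform_within_open[where S = "{s. Re s > 1}"])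
       (use s Z_eq_zeta open_halfspace_Re_gt in auto)
  hence d: "deriv Z s = zeta s + (s - 1) * zeta' s" by (rule DERIV_imp_deriv)
  have z: "zeta s \<noteq> 0" using zeta_eq_exp_logzeta[OF s] by simp
  have z': "zeta' s = - (mangoldt_series s * zeta s)" using zeta_times_mangoldt_series[OF s] by simp
  define w where "w = s - 1"
  have "w \<noteq> 0" using ne by (simp add: w_def)
  thus ?thesis using z unfolding d Z_eq_zeta[OF s] z' w_def[symmetric] by (simp add: field_simps)
qed

section \<open>Bounds near the line Re s = 1\<close>

lemma Z_growth:
  assumes "1/2 \<le> Re w" "Re w \<le> 2" "\<bar>Im w\<bar> \<le> y" 
  shows "norm (Z w) \<le> 1 + 3 * (y + 2) * (y + 1)"
proof -
  have "norm w \<le> y + 2" using assms cmod_le[of w] by auto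
  moreover have "norm (w - 1) \<le> y + 1" using assms cmod_le[of "w - 1"] by auto
  ultimately have "norm w * norm (w - 1) \<le> (y + 2) * (y + 1)" by (intro mult_mono) (use assms in auto)
  moreover have "norm (Z w) \<le> norm (Z w - 1) + 1" using norm_triangle_ineq[of "Z w - 1" 1] by simp
  ultimately show ?thesis using Z_minus_1_bound[OF assms(1)] by (simp only: mult.assoc)
qed

text \<open>
Cauchy's inequality on the disc of radius \<open>1/2\<close> around \<open>s\<close>, which stays in the half-plane
\<open>Re w > 1/2\<close> where \<open>Z\<close> grows at most quadratically.
\<close>

lemma Z_deriv_bounds:
  assumes s: "1 < Re s" "Re s \<le> 3/2" "Im s = t" "t \<ge> 0"
  shows "norm (deriv Z s) \<le> 6 * (t + 3)^2" "norm (deriv (deriv Z) s) \<le> 24 * (t + 3)^2"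
proof -
  have sub: "cball s (1/2) \<subseteq> {s. Re s > 1/2}"
  proof
    fix w assume "w \<in> cball s (1/2)"
    thus "w \<in> {s. Re s > 1/2}" using s abs_Re_le_cmod[of "s - w"] by (auto simp: dist_norm)
  qed
  have hol: "Z holomorphic_on ball s (1/2)" and cont: "continuous_on (cball s (1/2)) Z"
    using holomorphic_on_subset[OF Z_holomorphic sub] holomorphic_on_subset ball_subset_cball
      holomorphic_on_imp_continuous_on by blast+
  have bd: "norm (Z w) \<le> 3 * (t + 3)^2" if "norm (s - w) = 1/2" for w
  proof -
    have "\<bar>Re s - Re w\<bar> \<le> 1/2" "\<bar>Im s - Im w\<bar> \<le> 1/2"
      using that abs_Re_le_cmod[of "s - w"] abs_Im_le_cmod[of "s - w"] by auto
    hence "norm (Z w) \<le> 1 + 3 * ((t + 1/2) + 2) * ((t + 1/2) + 1)"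
      using s by (intro Z_growth) linarith+
    also have "\<dots> = 3 * (t + 3)^2 - 6 * t - 59/4" by (simp add: power2_eq_square field_simps)
    also have "\<dots> \<le> 3 * (t + 3)^2" using s by simp
    finally show ?thesis .
  qed
  from Cauchy_inequality[OF hol cont _ bd, of 1] show "norm (deriv Z s) \<le> 6 * (t + 3)^2" by simp
  from Cauchy_inequality[OF hol cont _ bd, of 2] show "norm (deriv (deriv Z) s) \<le> 24 * (t + 3)^2"
    by (simp add: eval_nat_numeral)
qed

text \<open>
At distance \<open>\<eta>\<close> to the right of the line, the 3-4-1 inequality bounds \<open>norm Z\<close> from below by a
constant times \<open>\<eta> powr (3/4)\<close>. Moving from there to distance \<open>d < \<eta>\<close> changes \<open>Z\<close> by at most \<open>\<eta>\<close>
times the bound for its derivative. For small \<open>\<eta>\<close> the first quantity wins, and the given \<open>\<eta>\<close> is chosen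
to make it exactly twice as large as the second; the factor 145152 is \<open>7 * 12 ^ 4\<close>.
\<close>

lemma Z_lower_bound:
  fixes t d :: real
  defines "\<eta> \<equiv> t ^ 5 / (145152 * (t + 3) ^ 10)"
  assumes t: "t \<ge> 1/5" and d: "0 < d" "d \<le> \<eta>"
  shows "norm (Z (Complex (1 + d) t)) \<ge> 6 * (t + 3)^2 * \<eta>"
proof -
  define \<tau> where "\<tau> = t + 3"
  have \<tau>: "\<tau> \<ge> 3" "\<tau> > 0" using t by (auto simp: \<tau>_def)
  have \<eta>_def': "\<eta> = t ^ 5 / (145152 * \<tau> ^ 10)" by (simp add: \<eta>_def \<tau>_def)
  have \<eta>0: "\<eta> > 0" using t \<tau> by (simp add: \<eta>_def')
  have \<eta>1: "\<eta> \<le> 1/100"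
  proof -
    have "t ^ 5 * 100 \<le> \<tau> ^ 5 * \<tau> ^ 5"
    proof (rule mult_mono)
      show "t ^ 5 \<le> \<tau> ^ 5" using t by (intro power_mono) (auto simp: \<tau>_def)
      have "(3::real) ^ 5 \<le> \<tau> ^ 5" using \<tau> by (intro power_mono) auto
      thus "100 \<le> \<tau> ^ 5" by simp
    qed (use \<tau> in auto)
    also have "\<dots> = \<tau> ^ 10" by (simp flip: power_add)
    also have "\<dots> \<le> 145152 * \<tau> ^ 10" using \<tau> by simp
    finally show ?thesis using \<tau> by (simp add: \<eta>_def' divide_simps)
  qed
  define a where "a = norm (Z (of_real (1 + \<eta>)))"
  define b where "b = norm (Z (Complex (1 + \<eta>) t))"
  define c where "c = norm (Z (Complex (1 + \<eta>) (2 * t)))"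
  have a: "a \<le> 104/100"
  proof -
    have "a \<le> norm (Z (of_real (1 + \<eta>)) - 1) + 1"
      unfolding a_def using norm_triangle_ineq[of "Z (of_real (1 + \<eta>)) - 1" 1] by simp
    also have "norm (Z (of_real (1 + \<eta>)) - 1) \<le> 3 * norm (of_real (1 + \<eta>) :: complex) * norm (of_real (1 + \<eta>) - 1 :: complex)"
      using \<eta>0 by (intro Z_minus_1_bound) simp
    also have "\<dots> = 3 * (1 + \<eta>) * \<eta>"
    proof -
      have "norm (of_real (1 + \<eta>) :: complex) = 1 + \<eta>" using \<eta>0 by (simp only: norm_of_real)
      moreover have "norm (of_real (1 + \<eta>) - 1 :: complex) = \<eta>" using \<eta>0 by simp
      ultimately show ?thesis by simp
    qed
    also have "\<dots> \<le> 3 * (1 + 1/100) * (1/100)" using \<eta>0 \<eta>1 by (intro mult_mono) auto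
    finally show ?thesis by simp
  qed
  have c: "c \<le> 12 * \<tau>^2"
  proof -
    have "c \<le> 1 + 3 * (2 * t + 2) * (2 * t + 1)" unfolding c_def
      using \<eta>0 \<eta>1 t by (intro Z_growth) auto
    also have "\<dots> \<le> 12 * \<tau>^2" using t by (simp add: \<tau>_def power2_eq_square algebra_simps)
    finally show ?thesis .
  qed
  have nn: "a \<ge> 0" "b \<ge> 0" "c \<ge> 0" by (auto simp: a_def b_def c_def)
  define za where "za = norm (zeta (of_real (1 + \<eta>)))"
  define zb where "zb = norm (zeta (Complex (1 + \<eta>) t))"
  define zc where "zc = norm (zeta (Complex (1 + \<eta>) (2 * t)))"
  have za: "a = \<eta> * za" unfolding a_def za_def
    by (subst Z_eq_zeta) (use \<eta>0 in \<open>auto simp: norm_mult\<close>)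
  have zb: "b \<ge> t * zb" unfolding b_def zb_def
  proof (subst Z_eq_zeta)
    have "t \<le> norm (Complex (1 + \<eta>) t - 1)" using abs_Im_le_cmod[of "Complex (1 + \<eta>) t - 1"] by simp
    thus "t * norm (zeta (Complex (1 + \<eta>) t)) \<le> norm ((Complex (1 + \<eta>) t - 1) * zeta (Complex (1 + \<eta>) t))"
      by (auto simp: norm_mult intro!: mult_right_mono)
  qed (use \<eta>0 in auto)
  have zc: "c \<ge> 2 * t * zc" unfolding c_def zc_def
  proof (subst Z_eq_zeta)
    have "2 * t \<le> norm (Complex (1 + \<eta>) (2 * t) - 1)" using abs_Im_le_cmod[of "Complex (1 + \<eta>) (2 * t) - 1"] by simp
    thus "2 * t * norm (zeta (Complex (1 + \<eta>) (2 * t))) \<le> norm ((Complex (1 + \<eta>) (2 * t) - 1) * zeta (Complex (1 + \<eta>) (2 * t)))"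
      by (auto simp: norm_mult intro!: mult_right_mono)
  qed (use \<eta>0 in auto)
  have "1 \<le> za ^ 3 * zb ^ 4 * zc"
    unfolding za_def zb_def zc_def using \<eta>0 by (intro zeta_3_4_1) auto
  hence "\<eta> ^ 3 * t ^ 4 * (2 * t) * 1 \<le> \<eta> ^ 3 * t ^ 4 * (2 * t) * (za ^ 3 * zb ^ 4 * zc)"
    using \<eta>0 t by (intro mult_left_mono) auto
  also have "\<dots> = a ^ 3 * (t * zb) ^ 4 * (2 * t * zc)" by (simp add: za power_mult_distrib)
  also have "\<dots> \<le> (104/100) ^ 3 * b ^ 4 * (12 * \<tau>^2)"
  proof (rule mult_mono)
    show "a ^ 3 * (t * zb) ^ 4 \<le> (104/100) ^ 3 * b ^ 4"
      using nn a zb t by (intro mult_mono power_mono) (auto simp: zb_def)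
    show "2 * t * zc \<le> 12 * \<tau>^2" using zc c by linarith
  qed (use nn t in \<open>auto simp: zc_def\<close>)
  also have "\<dots> \<le> 14 * \<tau>^2 * b ^ 4"
  proof -
    have "(104/100::real) ^ 3 * 12 * (\<tau>^2 * b ^ 4) \<le> 14 * (\<tau>^2 * b ^ 4)"
      by (intro mult_right_mono) (auto simp: power3_eq_cube)
    thus ?thesis by (simp add: mult_ac)
  qed
  finally have "\<eta> ^ 3 * t ^ 5 \<le> 7 * \<tau>^2 * b ^ 4" by (simp add: eval_nat_numeral)
  moreover have "t ^ 5 = 145152 * \<tau> ^ 10 * \<eta>" using \<tau> by (simp add: \<eta>_def')
  ultimately have "\<eta> ^ 3 * (145152 * \<tau> ^ 10 * \<eta>) \<le> 7 * \<tau>^2 * b ^ 4" by simp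
  hence "7 * \<tau>^2 * (12 * \<tau>^2 * \<eta>) ^ 4 \<le> 7 * \<tau>^2 * b ^ 4"
    by (simp add: eval_nat_numeral algebra_simps)
  hence "(12 * \<tau>^2 * \<eta>) ^ 4 \<le> b ^ 4" using \<tau> by (subst (asm) mult_le_cancel_left_pos) auto
  hence b: "12 * \<tau>^2 * \<eta> \<le> b" using nn(2) by (rule power_le_imp_le_base[where n = 3, simplified])
  define S where "S = closed_segment (Complex (1 + d) t) (Complex (1 + \<eta>) t)"
  have "norm (Z (Complex (1 + \<eta>) t) - Z (Complex (1 + d) t)) \<le> 6 * \<tau>^2 * norm (Complex (1 + \<eta>) t - Complex (1 + d) t)"
  proof (rule field_differentiable_bound[of S Z "deriv Z"])
    show "convex S" by (simp add: S_def)
    fix w assume "w \<in> S"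
    hence w: "Im w = t" "1 < Re w" "Re w \<le> 3/2"
    proof -
      obtain u where u: "0 \<le> u" "u \<le> 1" "w = (1 - u) *\<^sub>R Complex (1 + d) t + u *\<^sub>R Complex (1 + \<eta>) t"
        using \<open>w \<in> S\<close> by (auto simp: S_def in_segment)
      have Re: "Re w = 1 + d + u * (\<eta> - d)" "Im w = t" unfolding u(3) by (simp_all add: algebra_simps)
      have u1: "0 \<le> u * (\<eta> - d)" using u d by (intro mult_nonneg_nonneg) auto
      have u2: "u * (\<eta> - d) \<le> 1 * (\<eta> - d)" using u d by (intro mult_right_mono) auto
      show "Im w = t" by (rule Re)
      show "1 < Re w" using u1 d Re by simp
      have "Re w \<le> 1 + d + 1 * (\<eta> - d)" unfolding Re using u2 by (intro add_left_mono)
      thus "Re w \<le> 3/2" using \<eta>1 by simp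
    qed
    show "norm (deriv Z w) \<le> 6 * \<tau>^2" using Z_deriv_bounds(1)[of w t] w t by (simp add: \<tau>_def)
    have "(Z has_field_derivative deriv Z w) (at w)"
      by (rule holomorphic_derivI[OF Z_holomorphic open_halfspace_Re_gt]) (use w in auto)
    thus "(Z has_field_derivative deriv Z w) (at w within S)" by (rule has_field_derivative_at_within)
  qed (auto simp: S_def)
  also have "Complex (1 + \<eta>) t - Complex (1 + d) t = of_real (\<eta> - d)" by (simp add: complex_eq_iff)
  also have "6 * \<tau>^2 * norm (of_real (\<eta> - d) :: complex) \<le> 6 * \<tau>^2 * \<eta>"
    using d by (intro mult_left_mono) (simp_all only: norm_of_real, auto)
  finally have "norm (Z (Complex (1 + \<eta>) t) - Z (Complex (1 + d) t)) \<le> 6 * \<tau>^2 * \<eta>" .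
  moreover have "b \<le> norm (Z (Complex (1 + d) t)) + norm (Z (Complex (1 + \<eta>) t) - Z (Complex (1 + d) t))"
    unfolding b_def using norm_triangle_ineq2[of "Z (Complex (1 + \<eta>) t)" "Z (Complex (1 + d) t)"] by linarith
  ultimately show ?thesis using b by (simp add: \<tau>_def)
qed

text \<open>
For \<open>t \<le> 1/5\<close> the value of \<open>Z\<close> stays within \<open>9/10\<close> of \<open>Z 1 = 1\<close>. Otherwise the lower bound for \<open>Z\<close> and the upper
bounds for its derivatives have the common factor \<open>(t + 3)\<^sup>2\<close>, and only \<open>1 / \<eta>\<close> remains. For \<open>t \<ge> 1\<close>
this is at most \<open>145152 * 4 ^ 5 * (t + 3) ^ 5\<close>, whence the constant in \<open>Q\<close>; for \<open>t\<close> between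
\<open>1/5\<close> and 1 it is bounded by an absolute constant, which \<open>T \<ge> 100\<close> absorbs.
\<close>

lemma Z_log_deriv_bounds:
  fixes T t d :: real
  defines "Q \<equiv> 150000000 * (T + 3) ^ 5"
  assumes T: "T \<ge> 100" and t: "0 \<le> t" "t \<le> T" and d: "0 < d" "d \<le> 1 / Q"
  shows "norm (deriv Z (Complex (1 + d) t) / Z (Complex (1 + d) t)) \<le> Q"
        "norm (deriv (deriv Z) (Complex (1 + d) t) / Z (Complex (1 + d) t)) \<le> 4 * Q"
proof -
  define \<tau> where "\<tau> = t + 3"
  define s where "s = Complex (1 + d) t"
  have "(T + 3) ^ 5 \<ge> 103 ^ 5" using T by (intro power_mono) auto
  hence Q: "Q \<ge> 1000000000000000000" by (simp add: Q_def)
  have "d \<le> 1 / 100" using d Q by (smt (verit) frac_le)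
  hence s: "1 < Re s" "Re s \<le> 3/2" "Im s = t" using d by (auto simp: s_def)
  note D = Z_deriv_bounds[OF s t(1)]
  have "norm (deriv Z s) \<le> Q * norm (Z s) \<and> norm (deriv (deriv Z) s) \<le> 4 * Q * norm (Z s)"
  proof (cases "t \<le> 1/5")
    case True
    have "norm s \<le> 121/100" using True t \<open>d \<le> 1/100\<close> d cmod_le[of s] by (auto simp: s_def)
    moreover have "norm (s - 1) \<le> 21/100" using True t \<open>d \<le> 1/100\<close> d cmod_le[of "s - 1"] by (auto simp: s_def)
    ultimately have "norm s * norm (s - 1) \<le> (121/100) * (21/100)" by (intro mult_mono) auto
    hence "norm (Z s - 1) \<le> 9/10" using Z_minus_1_bound[of s] s by simp
    hence *: "norm (Z s) \<ge> 1/10" using norm_triangle_ineq2[of 1 "1 - Z s"] by (simp add: norm_minus_commute)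
    have "(t + 3) ^ 2 \<le> (4::real) ^ 2" using True t by (intro power_mono) auto
    hence "norm (deriv Z s) \<le> 96" "norm (deriv (deriv Z) s) \<le> 384" using D by auto
    moreover have "Q * (1/10) \<le> Q * norm (Z s)" using * Q by (intro mult_left_mono) auto
    ultimately show ?thesis using Q by linarith
  next
    case False
    define \<eta> where "\<eta> = t ^ 5 / (145152 * \<tau> ^ 10)"
    have \<tau>: "\<tau> > 0" using t by (simp add: \<tau>_def)
    have "\<eta> > 0" using False \<tau> by (simp add: \<eta>_def)
    have Q\<eta>: "1 \<le> Q * \<eta>"
    proof (cases "t \<le> 1")
      case True
      have "(1/5) ^ 5 \<le> t ^ 5" using False by (intro power_mono) auto
      moreover have "\<tau> ^ 10 \<le> 4 ^ 10" using True t by (intro power_mono) (auto simp: \<tau>_def)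
      hence "145152 * \<tau> ^ 10 \<le> 200000000000" by simp
      ultimately have "(1/5) ^ 5 / 200000000000 \<le> \<eta>"
        unfolding \<eta>_def using \<tau> t by (intro frac_le) auto
      moreover have "1 \<le> Q * ((1/5) ^ 5 / 200000000000)" using Q by (simp add: eval_nat_numeral)
      ultimately show ?thesis using Q by (smt (verit) mult_left_mono)
    next
      case False
      hence "\<tau> ^ 5 \<le> (4 * t) ^ 5" using t by (intro power_mono) (auto simp: \<tau>_def)
      hence 1: "\<tau> ^ 5 \<le> 1024 * t ^ 5" by (simp add: power_mult_distrib)
      have 2: "\<tau> ^ 5 \<le> (T + 3) ^ 5" using t by (intro power_mono) (auto simp: \<tau>_def)
      have "145152 * \<tau> ^ 10 = 145152 * \<tau> ^ 5 * \<tau> ^ 5" by (simp flip: power_add)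
      also have "\<dots> \<le> 145152 * (T + 3) ^ 5 * (1024 * t ^ 5)"
        using 1 2 \<tau> t T by (intro mult_mono) auto
      also have "\<dots> \<le> Q * t ^ 5" using T t by (simp add: Q_def)
      finally show ?thesis using \<tau> by (simp add: \<eta>_def field_simps)
    qed
    hence "1 / Q \<le> \<eta>" using Q by (simp add: field_simps)
    hence "d \<le> \<eta>" using d by linarith
    have low: "6 * \<tau>^2 * \<eta> \<le> norm (Z s)"
      unfolding s_def \<tau>_def \<eta>_def using False d \<open>d \<le> \<eta>\<close> by (intro Z_lower_bound) (auto simp: \<eta>_def \<tau>_def)
    have "6 * \<tau>^2 * 1 \<le> 6 * \<tau>^2 * (Q * \<eta>)" using Q\<eta> by (intro mult_left_mono) auto
    also have "\<dots> \<le> Q * norm (Z s)" using mult_left_mono[OF low, of Q] Q by (simp add: mult_ac)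
    finally have "6 * \<tau>^2 \<le> Q * norm (Z s)" by simp
    thus ?thesis using D unfolding \<tau>_def by linarith
  qed
  moreover have "norm (Z s) > 0" using Z_nonzero[of s] s by simp
  ultimately show "norm (deriv Z (Complex (1 + d) t) / Z (Complex (1 + d) t)) \<le> Q"
        "norm (deriv (deriv Z) (Complex (1 + d) t) / Z (Complex (1 + d) t)) \<le> 4 * Q"
    by (auto simp: s_def[symmetric] norm_divide divide_simps mult_ac)
qed

section \<open>The Laplace transform of psi(exp v)\<close>

lemma has_integral_atLeast_lborel:
  fixes f :: "real \<Rightarrow> real"
  assumes hi: "(f has_integral I) {a..}" and nonneg: "\<And>v. v \<ge> a \<Longrightarrow> f v \<ge> 0"
    and meas [measurable]: "f \<in> borel_measurable borel"
  shows "integrable lborel (\<lambda>v. indicator {a..} v * f v)"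
    and "(\<integral>v. indicator {a..} v * f v \<partial>lborel) = I"
proof -
  have "f absolutely_integrable_on {a..}"
    using hi nonneg by (intro nonnegative_absolutely_integrable_1) (auto simp: has_integral_integrable)
  hence "integrable lebesgue (\<lambda>v. indicator {a..} v * f v)"
    by (simp add: set_integrable_def)
  thus 1: "integrable lborel (\<lambda>v. indicator {a..} v * f v)"
    by (subst (asm) integrable_completion) auto
  hence "set_integrable lborel {a..} f" by (simp add: set_integrable_def)
  from set_borel_integral_eq_integral(2)[OF this]
  show "(\<integral>v. indicator {a..} v * f v \<partial>lborel) = I"
    using integral_unique[OF hi] by (simp add: set_lebesgue_integral_def)
qed

lemma exp_tail_real:
  fixes b a :: real assumes b: "b > 0"
  shows "integrable lborel (\<lambda>v. indicator {a..} v * exp (- b * v))"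
    and "(\<integral>v. indicator {a..} v * exp (- b * v) \<partial>lborel) = exp (- b * a) / b"
  by (rule has_integral_atLeast_lborel[OF has_integral_exp_minus_to_infinity[OF b]]; simp)+

lemma exp_tail_complex:
  fixes s :: complex and a :: real assumes s: "Re s > 0"
  shows "integrable lborel (\<lambda>v. indicator {a..} v *\<^sub>R exp (- s * of_real v))"
    and "(\<integral>v. indicator {a..} v *\<^sub>R exp (- s * of_real v) \<partial>lborel) = exp (- s * of_real a) / s"
    and "(\<integral>v. norm (indicator {a..} v *\<^sub>R exp (- s * of_real v)) \<partial>lborel) = exp (- Re s * a) / Re s"
proof -
  have nrm: "norm (indicator {a..} v *\<^sub>R exp (- s * of_real v)) = indicator {a..} v * exp (- Re s * v)" for v
    by (simp add: norm_exp_eq_Re)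
  show i: "integrable lborel (\<lambda>v. indicator {a..} v *\<^sub>R exp (- s * of_real v))"
    by (rule Bochner_Integration.integrable_bound[OF exp_tail_real(1)[OF s, of a]]) (auto simp: nrm norm_exp_eq_Re indicator_def)
  show "(\<integral>v. norm (indicator {a..} v *\<^sub>R exp (- s * of_real v)) \<partial>lborel) = exp (- Re s * a) / Re s"
    unfolding nrm by (rule exp_tail_real(2)[OF s])
  define F where "F = (\<lambda>v. - (exp (- s * of_real v) / s))"
  have s0: "s \<noteq> 0" using s by auto
  have ieq: "(\<integral>v. indicator {a<..} v *\<^sub>R exp (- s * of_real v) \<partial>lborel) = (\<integral>v. indicator {a..} v *\<^sub>R exp (- s * of_real v) \<partial>lborel)"
  proof (rule integral_cong_AE)
    show "AE v in lborel. indicator {a<..} v *\<^sub>R exp (- s * of_real v) = indicator {a..} v *\<^sub>R exp (- s * of_real v)"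
      using AE_lborel_singleton[of a] by eventually_elim (auto simp: indicator_def)
  qed auto
  have "(LBINT v=ereal a..\<infinity>. exp (- s * of_real v)) = 0 - F a"
  proof (rule interval_integral_FTC_integrable)
    fix x :: real
    have "((\<lambda>z. - (exp (- s * z) / s)) has_field_derivative exp (- s * of_real x)) (at (of_real x))"
      using s0 by (auto intro!: derivative_eq_intros)
    from has_vector_derivative_real_field[OF this]
    show "(F has_vector_derivative exp (- s * of_real x)) (at x)" by (simp add: F_def)
    show "isCont (\<lambda>v. exp (- s * of_real v)) x" by (intro continuous_intros)
  next
    have "integrable lborel (\<lambda>v. indicator {a<..} v *\<^sub>R exp (- s * of_real v))"
      by (rule Bochner_Integration.integrable_bound[OF i]) (auto simp: indicator_def)
    thus "set_integrable lborel (einterval (ereal a) \<infinity>) (\<lambda>v. exp (- s * of_real v))"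
      by (simp add: set_integrable_def)
    have "isCont F a" using s0 unfolding F_def by (intro continuous_intros) auto
    hence "(F \<longlongrightarrow> F a) (at_right a)" by (simp add: isCont_def filterlim_at_split)
    thus "((F \<circ> real_of_ereal) \<longlongrightarrow> F a) (at_right (ereal a))" by (simp add: ereal_tendsto_simps)
    have "((\<lambda>v. exp (- Re s * v) / norm s) \<longlongrightarrow> 0 / norm s) at_top"
    proof (intro tendsto_divide tendsto_const)
      show "((\<lambda>v. exp (- Re s * v)) \<longlongrightarrow> 0) at_top"
        using s by (intro filterlim_compose[OF exp_at_bot] filterlim_tendsto_neg_mult_at_bot[OF tendsto_const _ filterlim_ident]) auto
    qed (use s0 in auto)
    hence "((\<lambda>v. norm (F v)) \<longlongrightarrow> 0) at_top"
      by (simp add: F_def norm_divide norm_exp_eq_Re)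
    hence "(F \<longlongrightarrow> 0) at_top" by (rule tendsto_norm_zero_cancel)
    thus "((F \<circ> real_of_ereal) \<longlongrightarrow> 0) (at_left \<infinity>)" by (simp add: ereal_tendsto_simps)
  qed auto
  hence "(\<integral>v. indicator {a<..} v *\<^sub>R exp (- s * of_real v) \<partial>lborel) = exp (- s * of_real a) / s"
    by (simp add: interval_integral_to_infinity_eq set_lebesgue_integral_def F_def)
  thus "(\<integral>v. indicator {a..} v *\<^sub>R exp (- s * of_real v) \<partial>lborel) = exp (- s * of_real a) / s"
    using ieq by simp
qed

definition psi_exp :: "real \<Rightarrow> real" where
  "psi_exp v = psi (nat \<lfloor>exp v\<rfloor>)"

lemma psi_exp_mono: "u \<le> v \<Longrightarrow> psi_exp u \<le> psi_exp v"
  unfolding psi_exp_def by (intro psi_mono nat_mono floor_mono) auto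

lemma psi_exp_nonneg: "psi_exp v \<ge> 0" by (simp add: psi_exp_def psi_nonneg)

lemma psi_exp_measurable [measurable]: "psi_exp \<in> borel_measurable borel"
  by (rule borel_measurable_mono) (simp add: mono_def psi_exp_mono)

lemma psi_exp_le: "v \<ge> 0 \<Longrightarrow> psi_exp v \<le> 17/10 * exp v"
proof -
  assume v: "v \<ge> 0"
  hence e: "exp v \<ge> 1" by simp
  hence f: "nat \<lfloor>exp v\<rfloor> \<ge> 1" by linarith
  from psi_le[OF f] have "psi_exp v \<le> 17/10 * (real (nat \<lfloor>exp v\<rfloor>) - 1)" by (simp add: psi_exp_def)
  also have "real (nat \<lfloor>exp v\<rfloor>) \<le> exp v" using e by simp
  finally show ?thesis by simp
qed

text \<open>
The prime powers as unit steps, starting at their logarithms. This form is what the Laplace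
transform is taken of, term by term.
\<close>

lemma psi_exp_sums:
  "(\<lambda>n. indicator {ln (real n)..} v * mangoldt n) sums (indicator {0..} v * psi_exp v)"
proof (cases "v \<ge> 0")
  case False
  have "indicator {ln (real n)..} v * mangoldt n = (0::real)" for n
    using False by (cases "n = 0") (auto simp: indicator_def not_le intro: less_le_trans)
  hence "(\<lambda>n. indicator {ln (real n)..} v * mangoldt n) = (\<lambda>_. 0 :: real)" by (rule ext)
  thus ?thesis using False by (simp only:) simp
next
  case True
  define N where "N = nat \<lfloor>exp v\<rfloor>"
  have iff: "ln (real n) \<le> v \<longleftrightarrow> n \<le> N" if "n \<ge> 1" for n
  proof -
    have "ln (real n) \<le> v \<longleftrightarrow> real n \<le> exp v" using that by (metis exp_le_cancel_iff exp_ln of_nat_0_less_iff less_le_trans zero_less_one)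
    also have "\<dots> \<longleftrightarrow> n \<le> N" unfolding N_def by (metis exp_ge_zero le_nat_floor le_nat_iff le_floor_iff nat_0_le of_int_of_nat_eq zero_le_floor nat_floor_neg of_nat_floor order_trans of_nat_le_iff)
    finally show ?thesis .
  qed
  have "(\<lambda>n. indicator {ln (real n)..} v * mangoldt n) sums (\<Sum>n\<in>{1..N}. indicator {ln (real n)..} v * mangoldt n :: real)"
  proof (rule sums_finite)
    fix n assume "n \<notin> {1..N}"
    hence "n = 0 \<or> n > N \<and> n \<ge> 1" by auto
    thus "indicator {ln (real n)..} v * mangoldt n = (0::real)" using iff[of n] by (auto simp: indicator_def)
  qed auto
  also have "(\<Sum>n\<in>{1..N}. indicator {ln (real n)..} v * mangoldt n :: real) = (\<Sum>n\<in>{1..N}. mangoldt n)"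
    using iff by (intro sum.cong) (auto simp: indicator_def)
  also have "\<dots> = indicator {0..} v * psi_exp v" using True by (simp add: psi_exp_def psi_def N_def)
  finally show ?thesis .
qed

lemma psi_exp_laplace:
  assumes s: "Re s > 1"
  shows "integrable lborel (\<lambda>v. (indicator {0..} v * psi_exp v) *\<^sub>R exp (- s * of_real v))"
    and "(\<integral>v. (indicator {0..} v * psi_exp v) *\<^sub>R exp (- s * of_real v) \<partial>lborel) = mangoldt_series s / s"
proof -
  define g where "g = (\<lambda>n v. mangoldt n *\<^sub>R (indicator {ln (real n)..} v *\<^sub>R exp (- s * of_real v)))"
  have s0: "Re s > 0" using s by simp
  note E = exp_tail_complex[OF s0]
  have gi: "integrable lborel (g n)" for n
    unfolding g_def by (intro integrable_scaleR_right E)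
  have pw: "of_nat n powr (- s) = exp (- s * of_real (ln (real n)))" if "n > 0" for n
    using that by (simp add: powr_def Ln_of_nat)
  have pwr: "exp (- Re s * ln (real n)) = real n powr (- Re s)" if "n > 0" for n
    using that by (simp add: powr_def)
  have g1: "integral\<^sup>L lborel (g n) = of_real (mangoldt n) * of_nat n powr (- s) / s" for n
  proof -
    have "integral\<^sup>L lborel (g n) = mangoldt n *\<^sub>R (exp (- s * of_real (ln (real n))) / s)"
      unfolding g_def by (subst integral_scaleR_right) (simp only: E(2))
    thus ?thesis using pw[of n] by (cases "n = 0") (auto simp: scaleR_conv_of_real)
  qed
  have g2: "(\<integral>v. norm (g n v) \<partial>lborel) = norm (of_real (mangoldt n) * of_nat n powr (- s)) / Re s" for n
  proof -
    have "(\<integral>v. norm (g n v) \<partial>lborel) = (\<integral>v. mangoldt n * norm (indicator {ln (real n)..} v *\<^sub>R exp (- s * of_real v)) \<partial>lborel)"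
      by (simp only: g_def norm_scaleR abs_mangoldt)
    also have "\<dots> = mangoldt n * (exp (- Re s * ln (real n)) / Re s)"
      by (subst integral_mult_right_zero) (simp only: E(3))
    finally show ?thesis using pwr[of n] by (cases "n = 0") (auto simp: norm_mult norm_nat_powr)
  qed
  have psum: "(\<lambda>n. g n v) sums ((indicator {0..} v * psi_exp v) *\<^sub>R exp (- s * of_real v))" for v
  proof -
    have "(\<lambda>n. (indicator {ln (real n)..} v * mangoldt n) *\<^sub>R exp (- s * of_real v)) sums ((indicator {0..} v * psi_exp v) *\<^sub>R exp (- s * of_real v))"
      by (intro sums_scaleR_left psi_exp_sums)
    thus ?thesis by (simp add: g_def mult.commute)
  qed
  have pabs: "summable (\<lambda>n. norm (g n v))" for v
  proof -
    have "norm (g n v) = (indicator {ln (real n)..} v * mangoldt n) * norm (exp (- s * of_real v))" for n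
      by (auto simp only: g_def norm_scaleR abs_mangoldt indicator_def) (auto split: if_splits)
    moreover have "summable (\<lambda>n. (indicator {ln (real n)..} v * mangoldt n) * norm (exp (- s * of_real v)))"
      by (intro summable_mult2 sums_summable[OF psi_exp_sums])
    ultimately show ?thesis by (simp only:)
  qed
  have sumn: "summable (\<lambda>n. \<integral>v. norm (g n v) \<partial>lborel)"
    unfolding g2 by (intro summable_divide mangoldt_series_abs_summable s)
  have sf: "(\<lambda>v. \<Sum>n. g n v) = (\<lambda>v. (indicator {0..} v * psi_exp v) *\<^sub>R exp (- s * of_real v))"
    using psum by (simp add: sums_iff fun_eq_iff)
  show "integrable lborel (\<lambda>v. (indicator {0..} v * psi_exp v) *\<^sub>R exp (- s * of_real v))"
    using integrable_suminf[OF gi _ sumn] pabs unfolding sf by simp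
  have "(\<integral>v. (\<Sum>n. g n v) \<partial>lborel) = (\<Sum>n. integral\<^sup>L lborel (g n))"
    using integral_suminf[OF gi _ sumn] pabs by simp
  also have "\<dots> = (\<Sum>n. of_real (mangoldt n) * of_nat n powr (- s)) / s"
    unfolding g1 by (rule suminf_divide[OF summable_norm_cancel[OF mangoldt_series_abs_summable[OF s]]])
  finally show "(\<integral>v. (indicator {0..} v * psi_exp v) *\<^sub>R exp (- s * of_real v) \<partial>lborel) = mangoldt_series s / s"
    unfolding sf mangoldt_series_def .
qed

section \<open>The Fejer kernel\<close>

text \<open>
The transform of the triangle \<open>1 - \<bar>t\<bar> / T\<close> on \<open>{- T..T}\<close>. It is nonnegative, decays like
\<open>1 / (T u\<^sup>2)\<close>, and tests a function against frequencies up to \<open>T\<close> only.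
\<close>

definition fejer :: "real \<Rightarrow> real \<Rightarrow> real" where
  "fejer T u = (if u = 0 then T else 2 * (1 - cos (T * u)) / (T * u^2))"

lemma fejer_integral:
  assumes T: "T > 0"
  shows "((\<lambda>t. (1 - t / T) * (2 * cos (t * u))) has_integral fejer T u) {0..T}"
proof (cases "u = 0")
  case True
  have "((\<lambda>t. (1 - t / T) * 2) has_integral ((2 * T - T^2 / T) - (2 * 0 - 0^2 / T))) {0..T}"
    using T by (intro fundamental_theorem_of_calculus)
      (auto intro!: derivative_eq_intros simp: has_real_derivative_iff_has_vector_derivative[symmetric] field_simps)
  thus ?thesis using True T by (simp add: fejer_def power2_eq_square)
next
  case False
  define F where "F = (\<lambda>t. (1 - t / T) * (2 * sin (t * u) / u) - 2 * cos (t * u) / (T * u^2))"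
  have "((\<lambda>t. (1 - t / T) * (2 * cos (t * u))) has_integral (F T - F 0)) {0..T}"
    using T False unfolding F_def by (intro fundamental_theorem_of_calculus)
      (auto intro!: derivative_eq_intros simp: has_real_derivative_iff_has_vector_derivative[symmetric] field_simps power2_eq_square)
  moreover have "F T - F 0 = fejer T u"
    using T False by (simp add: F_def fejer_def field_simps)
  ultimately show ?thesis by simp
qed

lemma fejer_nonneg: "T > 0 \<Longrightarrow> fejer T u \<ge> 0"
  by (auto simp: fejer_def)

lemma fejer_le: "T > 0 \<Longrightarrow> u \<noteq> 0 \<Longrightarrow> fejer T u \<le> 4 / (T * u^2)"
proof -
  assume "T > 0" "u \<noteq> 0"
  moreover have "2 * (1 - c) \<le> 4" if "- 1 \<le> c" for c :: real using that by simp
  from this[OF cos_ge_minus_one] have "2 * (1 - cos (T * u)) \<le> 4" .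
  ultimately show ?thesis by (auto simp: fejer_def intro!: divide_right_mono)
qed

lemma fejer_measurable [measurable]: "fejer T \<in> borel_measurable borel"
  unfolding fejer_def by measurable

lemma cos_le_Taylor4: "cos (x::real) \<le> 1 - x^2 / 2 + x^4 / 24"
proof -
  have aux: "cos x \<le> 1 - x^2 / 2 + x^4 / 24" if x: "x \<ge> 0" for x :: real
  proof -
    have s1: "sin y \<le> y" if "y \<ge> 0" for y :: real using that by (rule sin_x_le_x)
    have c1: "cos y \<ge> 1 - y^2 / 2" if y: "y \<ge> 0" for y :: real
    proof -
      have "(\<lambda>y. cos y - (1 - y^2 / 2)) 0 \<le> (\<lambda>y. cos y - (1 - y^2 / 2)) y"
      proof (rule DERIV_nonneg_imp_nondecreasing[OF y])
        fix z :: real assume "0 \<le> z"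
        moreover have "((\<lambda>y. cos y - (1 - y^2 / 2)) has_real_derivative (z - sin z)) (at z)"
          by (rule derivative_eq_intros refl | simp)+
        ultimately show "\<exists>d. ((\<lambda>y. cos y - (1 - y^2 / 2)) has_real_derivative d) (at z) \<and> 0 \<le> d"
          using s1[of z] by (intro exI[of _ "z - sin z"]) simp
      qed
      thus ?thesis by simp
    qed
    have s2: "sin y \<ge> y - y^3 / 6" if y: "y \<ge> 0" for y :: real
    proof -
      have "(\<lambda>y. sin y - (y - y^3 / 6)) 0 \<le> (\<lambda>y. sin y - (y - y^3 / 6)) y"
      proof (rule DERIV_nonneg_imp_nondecreasing[OF y])
        fix z :: real assume "0 \<le> z"
        moreover have "((\<lambda>y. sin y - (y - y^3 / 6)) has_real_derivative (cos z - (1 - z^2 / 2))) (at z)"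
          by (rule derivative_eq_intros refl | simp)+
        ultimately show "\<exists>d. ((\<lambda>y. sin y - (y - y^3 / 6)) has_real_derivative d) (at z) \<and> 0 \<le> d"
          using c1[of z] by (intro exI[of _ "cos z - (1 - z^2 / 2)"]) simp
      qed
      thus ?thesis by simp
    qed
    have "(\<lambda>y. (1 - y^2 / 2 + y^4 / 24) - cos y) 0 \<le> (\<lambda>y. (1 - y^2 / 2 + y^4 / 24) - cos y) x"
    proof (rule DERIV_nonneg_imp_nondecreasing[OF x])
      fix z :: real assume "0 \<le> z"
      moreover have "((\<lambda>y. (1 - y^2 / 2 + y^4 / 24) - cos y) has_real_derivative (sin z - (z - z^3 / 6))) (at z)"
        by (rule derivative_eq_intros refl | simp)+
      ultimately show "\<exists>d. ((\<lambda>y. (1 - y^2 / 2 + y^4 / 24) - cos y) has_real_derivative d) (at z) \<and> 0 \<le> d"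
        using s2[of z] by (intro exI[of _ "sin z - (z - z^3 / 6)"]) simp
    qed
    thus ?thesis by simp
  qed
  from aux[of "\<bar>x\<bar>"] show ?thesis by (simp add: power_even_abs)
qed

lemma fejer_ge: "T > 0 \<Longrightarrow> fejer T u \<ge> T - T^3 * u^2 / 12"
proof -
  assume T: "T > 0"
  show ?thesis
  proof (cases "u = 0")
    case False
    have "2 * (1 - cos (T * u)) \<ge> (T * u)^2 - (T * u)^4 / 12"
      using cos_le_Taylor4[of "T * u"] by simp
    hence "fejer T u \<ge> ((T * u)^2 - (T * u)^4 / 12) / (T * u^2)"
      using False T unfolding fejer_def by (auto intro!: divide_right_mono)
    also have "((T * u)^2 - (T * u)^4 / 12) / (T * u^2) = T - T^3 * u^2 / 12"
      using T False by (simp add: field_simps eval_nat_numeral)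
    finally show ?thesis .
  qed (simp add: fejer_def)
qed

lemma fejer_tail:
  fixes V :: real
  assumes T: "T > 0" and h: "h > 0"
  defines "w \<equiv> \<lambda>v. indicator {v. \<bar>v - V\<bar> \<ge> h} v * (4 / (T * (V - v)^2))"
  shows "integrable lborel w" "(\<integral>v. w v \<partial>lborel) = 8 / (T * h)"
proof -
  define w0 where "w0 = (\<lambda>u. indicator {h..} u * (4 / T * (1 / u ^ 2)))"
  have "((\<lambda>u. 4 / T * (1 / u ^ 2)) has_integral 4 / T * (1 / (real (2 - 1) * h ^ (2 - 1)))) {h..}"
    using h by (intro has_integral_mult_right has_integral_inverse_power_to_inf) auto
  from has_integral_atLeast_lborel[OF this] 
  have w0: "integrable lborel w0" "(\<integral>u. w0 u \<partial>lborel) = 4 / (T * h)"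
    unfolding w0_def using T by auto
  have i1: "integrable lborel (\<lambda>v. w0 (- V + 1 * v))" "integrable lborel (\<lambda>v. w0 (V + (-1) * v))"
    using w0(1) by (intro lborel_integrable_real_affine; simp)+
  have i2: "(\<integral>v. w0 (- V + 1 * v) \<partial>lborel) = 4 / (T * h)" "(\<integral>v. w0 (V + (-1) * v) \<partial>lborel) = 4 / (T * h)"
    using w0(2) lborel_integral_real_affine[of 1 w0 "- V"] lborel_integral_real_affine[of "-1" w0 V] by auto
  have weq: "w = (\<lambda>v. w0 (- V + 1 * v) + w0 (V + (-1) * v))"
    using h by (auto simp: fun_eq_iff w_def w0_def indicator_def abs_real_def power2_commute)
  show "integrable lborel w" unfolding weq by (intro Bochner_Integration.integrable_add i1)
  have "(\<integral>v. w v \<partial>lborel) = 4 / (T * h) + 4 / (T * h)"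
    unfolding weq by (subst Bochner_Integration.integral_add[OF i1]) (simp only: i2)
  thus "(\<integral>v. w v \<partial>lborel) = 8 / (T * h)" by simp
qed

text \<open>
One integration by parts: the triangle vanishes at \<open>T\<close>, and both the boundary term at 0 and the
remaining integral carry a factor \<open>1 / V\<close>.
\<close>

lemma oscillatory_bound:
  fixes H H' :: "real \<Rightarrow> complex"
  assumes T: "T > 0" and V: "V > 0"
    and der: "\<And>t. t \<in> {0..T} \<Longrightarrow> (H has_vector_derivative H' t) (at t within {0..T})"
    and M0: "\<And>t. t \<in> {0..T} \<Longrightarrow> norm (H t) \<le> M0"
    and M1: "\<And>t. t \<in> {0..T} \<Longrightarrow> norm (H' t) \<le> M1"
  shows "norm (integral {0..T} (\<lambda>t. of_real (1 - t / T) * (exp (\<i> * of_real (t * V)) * H t))) \<le> (2 * M0 + T * M1) / V"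
proof -
  define e where "e = (\<lambda>t. exp (\<i> * of_real (t * V)))"
  define P where "P = (\<lambda>t. of_real (1 - t / T) * (e t * H t) / (\<i> * of_real V))"
  define p where "p = (\<lambda>t. of_real (1 - t / T) * (e t * H t))"
  define q where "q = (\<lambda>t. e t * (of_real (1 - t / T) * H' t - H t / of_real T) / (\<i> * of_real V))"
  have e_der: "(e has_vector_derivative (\<i> * of_real V * e t)) (at t within A)" for t A
  proof -
    have "((\<lambda>z. exp (\<i> * (z * of_real V))) has_field_derivative (\<i> * of_real V * e t)) (at (of_real t))"
      by (auto intro!: derivative_eq_intros simp: e_def mult_ac)
    from has_vector_derivative_real_field[OF this] show ?thesis
      by (auto simp: e_def intro: has_vector_derivative_at_within)
  qed
  have l_der: "((\<lambda>t. of_real (1 - t / T) :: complex) has_vector_derivative (of_real (- 1 / T))) (at t within A)" for t A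
    by (intro has_vector_derivative_of_real) (use T in \<open>auto intro!: derivative_eq_intros\<close>)
  have contH: "continuous_on {0..T} H"
    using der by (intro continuous_on_vector_derivative) auto
  have cont_e: "continuous_on {0..T} e" unfolding e_def by (intro continuous_intros)
  have "(P has_vector_derivative (p t + q t)) (at t within {0..T})" if "t \<in> {0..T}" for t
  proof -
    have "(P has_vector_derivative
       ((of_real (1 - t / T) * (e t * H' t + (\<i> * of_real V * e t) * H t) + of_real (- 1 / T) * (e t * H t)) / (\<i> * of_real V))) (at t within {0..T})"
      unfolding P_def
      by (intro has_vector_derivative_divide has_vector_derivative_mult l_der e_der der that)
    moreover have "(of_real (1 - t / T) * (e t * H' t + (\<i> * of_real V * e t) * H t) + of_real (- 1 / T) * (e t * H t)) / (\<i> * of_real V) = p t + q t"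
      using V T by (simp add: p_def q_def field_simps)
    ultimately show ?thesis by simp
  qed
  hence 1: "((\<lambda>t. p t + q t) has_integral (P T - P 0)) {0..T}"
    using T by (intro fundamental_theorem_of_calculus) auto
  have "p integrable_on {0..T}" unfolding p_def
    by (intro integrable_continuous_real continuous_intros contH cont_e) (use T in auto)
  hence 2: "(p has_integral integral {0..T} p) {0..T}" by (rule integrable_integral)
  have 3: "(q has_integral (P T - P 0 - integral {0..T} p)) {0..T}"
    using has_integral_diff[OF 1 2] by simp
  have M: "M0 \<ge> 0" "M1 \<ge> 0" using M0[of 0] M1[of 0] T norm_ge_zero order_trans by (auto intro: order_trans[OF norm_ge_zero])
  have ne: "norm (e t) = 1" for t by (simp add: e_def norm_exp_eq_Re)
  have "norm (P T - P 0 - integral {0..T} p) \<le> (M1 + M0 / T) / V * measure lborel (cbox 0 T)"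
  proof (rule has_integral_bound)
    show "(q has_integral (P T - P 0 - integral {0..T} p)) (cbox 0 T)" using 3 by simp
    fix t assume "t \<in> cbox 0 T"
    hence t: "t \<in> {0..T}" by simp
    have "norm (of_real (1 - t / T) * H' t - H t / of_real T) \<le> norm (of_real (1 - t / T) * H' t) + norm (H t / of_real T)"
      by (rule norm_triangle_ineq4)
    also have "norm (of_real (1 - t / T) * H' t) \<le> 1 * M1" 
      using t T unfolding norm_mult by (intro mult_mono M1) (auto simp only: norm_of_real, auto simp: field_simps)
    also have "norm (H t / of_real T) \<le> M0 / T" using M0[OF t] T by (simp add: norm_divide divide_right_mono)
    finally show "norm (q t) \<le> (M1 + M0 / T) / V" using V
      by (simp add: q_def norm_divide norm_mult ne divide_right_mono)
  qed (use M T V in auto)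
  also have "\<dots> = (T * M1 + M0) / V" using T V by (simp add: field_simps)
  finally have "norm (P T - P 0 - integral {0..T} p) \<le> (T * M1 + M0) / V" .
  moreover have "P T = 0" using T by (simp add: P_def)
  moreover have "norm (P 0) \<le> M0 / V" using M0[of 0] T V by (simp add: P_def norm_divide norm_mult ne divide_right_mono)
  moreover have "norm (integral {0..T} p) \<le> norm (P 0) + norm (P T - P 0 - integral {0..T} p)"
    using norm_triangle_ineq4[of "- P 0" "- P 0 - integral {0..T} p"] \<open>P T = 0\<close> by (simp add: norm_minus_commute)
  ultimately have "norm (integral {0..T} p) \<le> M0 / V + (T * M1 + M0) / V" by linarith
  thus ?thesis using V by (simp add: p_def e_def add_divide_distrib[symmetric] algebra_simps)
qed

text \<open>
Parseval's identity for the Fejer kernel: insert the integral defining the kernel and exchange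
the two integrations. Because \<open>f\<close> is real, nonnegative frequencies suffice.
\<close>

lemma fejer_fubini:
  fixes f :: "real \<Rightarrow> real" and V T :: real
  assumes f: "integrable lborel f" and T: "T > 0"
  shows "(\<integral>v. f v * fejer T (V - v) \<partial>lborel) = 
     integral {0..T} (\<lambda>t. (1 - t / T) * (2 * Re (exp (\<i> * of_real (t * V)) * (\<integral>v. f v *\<^sub>R exp (- \<i> * of_real (t * v)) \<partial>lborel))))"
proof -
  define g where "g = (\<lambda>v t. f v * (indicator {0..T} t * ((1 - t / T) * (2 * cos (t * (V - v))))))"
  have fm [measurable]: "f \<in> borel_measurable borel" using f by auto
  have bd: "\<bar>g v t\<bar> \<le> \<bar>f v\<bar> * (2 * indicator {0..T} t)" for v t
  proof -
    have "\<bar>(1 - t / T) * (2 * cos (t * (V - v)))\<bar> \<le> 1 * (2 * 1)" if "t \<in> {0..T}"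
      unfolding abs_mult using that T by (intro mult_mono) (auto simp: field_simps)
    from mult_left_mono[OF this, of "\<bar>f v\<bar>"] show ?thesis
      by (auto simp: g_def abs_mult indicator_def)
  qed
  have iT: "integrable lborel (indicator {0..T} :: real \<Rightarrow> real)"
    using T by (intro integrable_real_indicator) auto
  have gint: "integrable lborel (g v)" for v
    by (rule Bochner_Integration.integrable_bound[of _ "\<lambda>t. \<bar>f v\<bar> * (2 * indicator {0..T} t)"])
       (use bd iT in \<open>auto simp: g_def intro!: AE_I2\<close>)
  have "integrable (lborel \<Otimes>\<^sub>M lborel) (case_prod g)"
  proof (rule lborel_pair.Fubini_integrable)
    show "case_prod g \<in> borel_measurable (lborel \<Otimes>\<^sub>M lborel)"
      unfolding g_def by measurable
    show "AE v in lborel. integrable lborel (\<lambda>t. case_prod g (v, t))" using gint by simp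
    show "integrable lborel (\<lambda>v. \<integral>t. norm (case_prod g (v, t)) \<partial>lborel)"
    proof (rule Bochner_Integration.integrable_bound[of _ "\<lambda>v. \<bar>f v\<bar> * (2 * T)"])
      show "integrable lborel (\<lambda>v. \<bar>f v\<bar> * (2 * T))" using f by simp
      show "(\<lambda>v. \<integral>t. norm (case_prod g (v, t)) \<partial>lborel) \<in> borel_measurable lborel"
        unfolding g_def by measurable
      show "AE v in lborel. norm (\<integral>t. norm (case_prod g (v, t)) \<partial>lborel) \<le> norm (\<bar>f v\<bar> * (2 * T))"
      proof (rule AE_I2)
        fix v
        have "(\<integral>t. norm (g v t) \<partial>lborel) \<le> (\<integral>t. \<bar>f v\<bar> * (2 * indicator {0..T} t) \<partial>lborel)"
          using gint[of v] bd iT by (intro integral_mono) auto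
        also have "\<dots> = \<bar>f v\<bar> * (2 * T)" using T by simp
        finally show "norm (\<integral>t. norm (case_prod g (v, t)) \<partial>lborel) \<le> norm (\<bar>f v\<bar> * (2 * T))"
          using T by simp
      qed
    qed
  qed
  from lborel_pair.Fubini_integral[OF this]
  have fub: "(\<integral>t. (\<integral>v. g v t \<partial>lborel) \<partial>lborel) = (\<integral>v. (\<integral>t. g v t \<partial>lborel) \<partial>lborel)" .
  have inner1: "(\<integral>t. g v t \<partial>lborel) = f v * fejer T (V - v)" for v
  proof -
    have c: "continuous_on {0..T} (\<lambda>t. (1 - t / T) * (2 * cos (t * (V - v))))"
      using T by (intro continuous_intros) auto
    have "(\<integral>t. g v t \<partial>lborel) = f v * (LINT t:{0..T}|lborel. (1 - t / T) * (2 * cos (t * (V - v))))"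
      by (simp add: g_def set_lebesgue_integral_def)
    also have "(LINT t:{0..T}|lborel. (1 - t / T) * (2 * cos (t * (V - v)))) = integral {0..T} (\<lambda>t. (1 - t / T) * (2 * cos (t * (V - v))))"
      by (intro set_borel_integral_eq_integral borel_integrable_atLeastAtMost') (rule c)
    also have "\<dots> = fejer T (V - v)" by (rule integral_unique[OF fejer_integral[OF T]])
    finally show ?thesis .
  qed
  define fh where "fh = (\<lambda>t. \<integral>v. f v *\<^sub>R exp (- \<i> * of_real (t * v)) \<partial>lborel)"
  have fhi: "integrable lborel (\<lambda>v. f v *\<^sub>R exp (- \<i> * of_real (t * v)))" for t
    by (rule Bochner_Integration.integrable_bound[OF f]) (auto simp: norm_exp_eq_Re)
  define r where "r = (\<lambda>t. (1 - t / T) * (2 * Re (exp (\<i> * of_real (t * V)) * fh t)))"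
  have inner2: "(\<integral>v. g v t \<partial>lborel) = indicator {0..T} t * r t" for t
  proof -
    have "Re (exp (\<i> * of_real (t * V)) * fh t) = Re (\<integral>v. exp (\<i> * of_real (t * V)) * (f v *\<^sub>R exp (- \<i> * of_real (t * v))) \<partial>lborel)"
      unfolding fh_def by (simp only: integral_mult_right_zero)
    also have "\<dots> = (\<integral>v. Re (exp (\<i> * of_real (t * V)) * (f v *\<^sub>R exp (- \<i> * of_real (t * v)))) \<partial>lborel)"
      by (rule integral_Re[symmetric]) (intro integrable_mult_right fhi)
    also have "\<dots> = (\<integral>v. f v * cos (t * (V - v)) \<partial>lborel)"
    proof (rule Bochner_Integration.integral_cong[OF refl])
      fix v
      have eq: "exp (\<i> * of_real (t * V)) * (f v *\<^sub>R exp (- \<i> * of_real (t * v))) = f v *\<^sub>R exp (\<i> * of_real (t * (V - v)))"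
        by (simp add: exp_add[symmetric] algebra_simps)
      show "Re (exp (\<i> * of_real (t * V)) * (f v *\<^sub>R exp (- \<i> * of_real (t * v)))) = f v * cos (t * (V - v))"
        unfolding eq by (simp only: scaleR_complex.sel Re_exp) simp
    qed
    finally have A: "Re (exp (\<i> * of_real (t * V)) * fh t) = (\<integral>v. f v * cos (t * (V - v)) \<partial>lborel)" .
    have "(\<integral>v. g v t \<partial>lborel) = (\<integral>v. (indicator {0..T} t * ((1 - t / T) * 2)) * (f v * cos (t * (V - v))) \<partial>lborel)"
      by (intro Bochner_Integration.integral_cong refl) (simp add: g_def algebra_simps)
    also have "\<dots> = (indicator {0..T} t * ((1 - t / T) * 2)) * (\<integral>v. f v * cos (t * (V - v)) \<partial>lborel)"
      by (rule integral_mult_right_zero)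
    also have "\<dots> = indicator {0..T} t * r t" unfolding r_def A by (simp only: mult.assoc)
    finally show ?thesis .
  qed
  have "(\<integral>t. indicator {0..T} t * r t \<partial>lborel) = (\<integral>v. f v * fejer T (V - v) \<partial>lborel)"
    using fub unfolding inner1 inner2 .
  moreover have "integrable lborel (\<lambda>t. indicator {0..T} t * r t)"
    using lborel_pair.integrable_snd[OF \<open>integrable (lborel \<Otimes>\<^sub>M lborel) (case_prod g)\<close>] unfolding inner2 .
  hence "set_integrable lborel {0..T} r" by (simp add: set_integrable_def)
  hence "(LINT t:{0..T}|lborel. r t) = integral {0..T} r" by (rule set_borel_integral_eq_integral)
  ultimately show ?thesis by (simp add: r_def fh_def set_lebesgue_integral_def)
qed

section \<open>An explicit lower bound in the prime number theorem\<close>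

lemma fejer_le_2T: assumes T: "T > 0" shows "fejer T u \<le> 2 * T"
proof -
  have "norm (fejer T u) \<le> 2 * measure lborel (cbox 0 T)"
  proof (rule has_integral_bound)
    show "((\<lambda>t. (1 - t / T) * (2 * cos (t * u))) has_integral fejer T u) (cbox 0 T)"
      using fejer_integral[OF T] by simp
    fix t assume "t \<in> cbox 0 T"
    hence "\<bar>1 - t / T\<bar> * (2 * \<bar>cos (t * u)\<bar>) \<le> 1 * (2 * 1)"
      using T by (intro mult_mono) (auto simp: field_simps)
    thus "norm ((1 - t / T) * (2 * cos (t * u))) \<le> 2" by (simp add: abs_mult)
  qed simp
  thus ?thesis using T by simp
qed

lemma fejer_window_integrable:
  assumes T: "T > 0" 
  shows "integrable lborel (\<lambda>v. indicator {V - h..V + h} v * fejer T (V - v))"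
proof (rule Bochner_Integration.integrable_bound[of _ "\<lambda>v. indicator {V - h..V + h} v * (2 * T)"])
  have "integrable lborel (indicator {V - h..V + h} :: real \<Rightarrow> real)"
    by (intro integrable_real_indicator) (auto simp: emeasure_lborel_Icc_eq)
  thus "integrable lborel (\<lambda>v. indicator {V - h..V + h} v * (2 * T))" by simp
  show "AE v in lborel. norm (indicator {V - h..V + h} v * fejer T (V - v)) \<le> norm (indicator {V - h..V + h} v * (2 * T))"
    using fejer_le_2T[OF T] fejer_nonneg[OF T] T by (auto simp: abs_mult intro!: AE_I2 mult_left_mono)
qed auto

text \<open>
The mass of the kernel is \<open>2 \<pi>\<close>. The Taylor bound for the cosine captures \<open>9 / 2\<close> of it on the
interval \<open>\<bar>u\<bar> \<le> 3 / T\<close>, which is accurate enough.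
\<close>

lemma fejer_window_ge:
  fixes V :: real
  assumes T: "T > 0" and h: "T * h \<ge> 3"
  shows "(\<integral>v. indicator {V - h..V + h} v * fejer T (V - v) \<partial>lborel) \<ge> 9 / 2"
proof -
  define k where "k = 3 / T"
  have k: "k > 0" "k \<le> h" "T * k = 3" using T h by (auto simp: k_def field_simps)
  define p where "p = (\<lambda>v. T - T^3 * (V - v)^2 / 12)"
  define P where "P = (\<lambda>v. T * v + T^3 * (V - v)^3 / 36)"
  have "(p has_integral (P (V + k) - P (V - k))) {V - k..V + k}"
    unfolding p_def P_def using k by (intro fundamental_theorem_of_calculus)
      (auto intro!: derivative_eq_intros simp: has_real_derivative_iff_has_vector_derivative[symmetric] field_simps)
  moreover have "P (V + k) - P (V - k) = 9 / 2"
  proof -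
    have "P (V + k) - P (V - k) = 2 * (T * k) - (T * k)^3 / 18" by (simp add: P_def field_simps power_mult_distrib)
    thus ?thesis by (simp add: k)
  qed
  ultimately have "(p has_integral 9/2) {V - k..V + k}" by simp
  hence ip: "integral {V - k..V + k} p = 9/2" by (rule integral_unique)
  have sp: "set_integrable lborel {V - k..V + k} p"
    unfolding p_def by (intro borel_integrable_atLeastAtMost' continuous_intros) auto
  have "9 / 2 = (LINT v:{V - k..V + k}|lborel. p v)"
    using set_borel_integral_eq_integral(2)[OF sp] ip by simp
  also have "\<dots> \<le> (\<integral>v. indicator {V - h..V + h} v * fejer T (V - v) \<partial>lborel)"
    unfolding set_lebesgue_integral_def
  proof (rule integral_mono)
    show "integrable lborel (\<lambda>v. indicator {V - k..V + k} v *\<^sub>R p v)" using sp by (simp add: set_integrable_def)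
    show "integrable lborel (\<lambda>v. indicator {V - h..V + h} v * fejer T (V - v))"
      by (rule fejer_window_integrable[OF T])
    show "indicator {V - k..V + k} v *\<^sub>R p v \<le> indicator {V - h..V + h} v * fejer T (V - v)" for v
      using fejer_ge[OF T, of "V - v"] fejer_nonneg[OF T, of "V - v"] k by (auto simp: indicator_def p_def)
  qed
  finally show ?thesis .
qed

text \<open>
The transform of \<open>f\<close> at frequency \<open>t\<close> is \<open>mangoldt_series s / s - 1 / (s - 1)\<close> for \<open>s = 1 + d + \<i> t\<close>.
Expressed through \<open>Z\<close> the pole cancels and \<open>- 1 / s - Z' / (Z s)\<close> remains; this function and its derivative
are bounded by \<open>1 + Q\<close> and \<open>2 Q\<^sup>2\<close>, independently of \<open>d\<close>.
\<close>

lemma psi_exp_fourier_bound: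
  fixes T V d :: real
  defines "Q \<equiv> 150000000 * (T + 3) ^ 5"
  assumes T: "T \<ge> 100" and V: "V > 0" and d: "0 < d" "d \<le> 1 / Q"
  defines "f \<equiv> \<lambda>v. indicator {0..} v * (psi_exp v * exp (- v) - 1) * exp (- d * v)"
  shows "integrable lborel f" "(\<integral>v. f v * fejer T (V - v) \<partial>lborel) \<ge> - (6 * T * Q^2 / V)"
proof -
  have "(T + 3) ^ 5 \<ge> 103 ^ 5" using T by (intro power_mono) auto
  hence Q: "Q \<ge> 100" by (simp add: Q_def)
  have T0: "T > 0" using T by simp
  show fi: "integrable lborel f"
  proof (rule Bochner_Integration.integrable_bound[of _ "\<lambda>v. 27/10 * (indicator {0..} v * exp (- d * v))"])
    show "integrable lborel (\<lambda>v. 27/10 * (indicator {0..} v * exp (- d * v)))"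
      by (intro integrable_mult_right exp_tail_real d)
    show "f \<in> borel_measurable lborel" unfolding f_def by measurable
    show "AE v in lborel. norm (f v) \<le> norm (27/10 * (indicator {0..} v * exp (- d * v)))"
    proof (rule AE_I2)
      fix v
      show "norm (f v) \<le> norm (27/10 * (indicator {0..} v * exp (- d * v)))"
      proof (cases "v \<ge> 0")
        case True
        have "psi_exp v * exp (- v) \<le> (17/10 * exp v) * exp (- v)" using psi_exp_le[OF True] by (intro mult_right_mono) auto
        hence "psi_exp v * exp (- v) \<le> 17/10" by (simp add: mult.assoc exp_add[symmetric])
        moreover have "psi_exp v * exp (- v) \<ge> 0" by (simp add: psi_exp_nonneg)
        ultimately have "\<bar>psi_exp v * exp (- v) - 1\<bar> \<le> 27/10" by linarith
        thus ?thesis using True by (auto simp: f_def abs_mult intro!: mult_right_mono)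
      qed (simp add: f_def)
    qed
  qed
  define s where "s = (\<lambda>t. Complex (1 + d) t)"
  have sRe: "Re (s t) > 1" for t using d by (simp add: s_def)
  define \<phi> where "\<phi> = (\<lambda>z. - (1 / z) - deriv Z z / (Z z * z))"
  define \<phi>' where "\<phi>' = (\<lambda>z. 1 / z^2 + (deriv Z z / Z z) / z^2 - (deriv (deriv Z) z / Z z) / z + (deriv Z z / Z z)^2 / z)"
  have transf: "(\<integral>v. f v *\<^sub>R exp (- \<i> * of_real (t * v)) \<partial>lborel) = \<phi> (s t)" for t
  proof -
    have s1: "Re (s t - 1) > 0" using sRe[of t] by simp
    have "f v *\<^sub>R exp (- \<i> * of_real (t * v)) = (indicator {0..} v * psi_exp v) *\<^sub>R exp (- s t * of_real v) - indicator {0..} v *\<^sub>R exp (- (s t - 1) * of_real v)" for v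
    proof -
      have 1: "exp (- s t * of_real v) = of_real (exp (- v) * exp (- d * v)) * exp (- \<i> * of_real (t * v))"
        unfolding exp_of_real[symmetric] exp_add[symmetric] 
        by (simp add: s_def Complex_eq exp_of_real[symmetric] exp_add[symmetric] algebra_simps)
      have 2: "exp (- (s t - 1) * of_real v) = of_real (exp (- d * v)) * exp (- \<i> * of_real (t * v))"
        by (simp add: s_def Complex_eq exp_of_real[symmetric] exp_add[symmetric] algebra_simps)
      show ?thesis unfolding 1 2 f_def by (auto simp: indicator_def scaleR_conv_of_real algebra_simps)
    qed
    hence "(\<integral>v. f v *\<^sub>R exp (- \<i> * of_real (t * v)) \<partial>lborel) = mangoldt_series (s t) / s t - exp (- (s t - 1) * of_real 0) / (s t - 1)"
      using psi_exp_laplace[OF sRe] exp_tail_complex[OF s1, of 0] by (simp del: of_real_0)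
    also have "\<dots> = \<phi> (s t)"
    proof -
      have ne: "s t \<noteq> 0" "s t \<noteq> 1" "Z (s t) \<noteq> 0" using sRe[of t] Z_nonzero[OF sRe] by auto
      define w where "w = s t - 1"
      have "w \<noteq> 0" "s t = w + 1" using ne by (auto simp: w_def)
      moreover have "w + 1 \<noteq> 0" using ne \<open>s t = w + 1\<close> by simp
      ultimately show ?thesis using ne unfolding mangoldt_series_eq[OF sRe] \<phi>_def
        by (simp add: divide_simps) (simp add: algebra_simps)
    qed
    finally show ?thesis .
  qed
  have \<phi>_der: "(\<phi> has_field_derivative \<phi>' z) (at z)" if z: "Re z > 1" for z
  proof -
    have zS: "z \<in> {z. Re z > 1/2}" using z by simp
    have d1: "(Z has_field_derivative deriv Z z) (at z)"
      by (rule holomorphic_derivI[OF Z_holomorphic open_halfspace_Re_gt zS])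
    have d2: "(deriv Z has_field_derivative deriv (deriv Z) z) (at z)"
      by (rule holomorphic_derivI[OF holomorphic_deriv[OF Z_holomorphic open_halfspace_Re_gt] open_halfspace_Re_gt zS])
    have ne: "z \<noteq> 0" "Z z \<noteq> 0" using z Z_nonzero[OF z] by auto
    have "(\<phi> has_field_derivative (- (- 1 / z^2) - (deriv (deriv Z) z * (Z z * z) - deriv Z z * (deriv Z z * z + Z z)) / (Z z * z)^2)) (at z)"
      unfolding \<phi>_def
      by (rule derivative_eq_intros d1 d2 refl | use ne in \<open>simp add: power2_eq_square\<close>)+
    moreover have "(- (- 1 / z^2) - (deriv (deriv Z) z * (Z z * z) - deriv Z z * (deriv Z z * z + Z z)) / (Z z * z)^2) = \<phi>' z"
      using ne by (simp add: \<phi>'_def field_simps power2_eq_square)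
    ultimately show ?thesis by simp
  qed
  have H_der: "((\<lambda>t. \<phi> (s t)) has_vector_derivative (\<i> * \<phi>' (s t))) (at t within A)" for t A
  proof -
    have st: "of_real (1 + d) + \<i> * of_real t = s t" for t by (simp add: s_def Complex_eq)
    have d0: "((\<lambda>z. of_real (1 + d) + \<i> * z) has_field_derivative \<i>) (at (of_real t))"
      by (auto intro!: derivative_eq_intros)
    have "(\<phi> has_field_derivative \<phi>' (s t)) (at (of_real (1 + d) + \<i> * of_real t))"
      unfolding st by (rule \<phi>_der[OF sRe])
    from DERIV_chain2[OF this d0]
    have "((\<lambda>z. \<phi> (of_real (1 + d) + \<i> * z)) has_field_derivative (\<phi>' (s t) * \<i>)) (at (of_real t))" .
    from has_vector_derivative_real_field[OF this] show ?thesis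
      unfolding st by (auto simp: mult.commute intro: has_vector_derivative_at_within)
  qed
  have bd: "norm (\<phi> (s t)) \<le> 1 + Q \<and> norm (\<i> * \<phi>' (s t)) \<le> 2 * Q^2" if t: "t \<in> {0..T}" for t
  proof -
    note B = Z_log_deriv_bounds[OF T, of t d, folded Q_def s_def]
    have B1: "norm (deriv Z (s t) / Z (s t)) \<le> Q" and B2: "norm (deriv (deriv Z) (s t) / Z (s t)) \<le> 4 * Q"
      using B t d by auto
    have n1: "norm (s t) \<ge> 1" using complex_Re_le_cmod[of "s t"] sRe[of t] by linarith
    have dv: "norm (x / s t) \<le> norm x" for x
      using n1 by (simp add: norm_divide divide_le_eq mult_left_le field_simps) (metis mult_le_cancel_left1 norm_ge_zero not_less)
    have dv2: "norm (x / (s t)^2) \<le> norm x" for x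
      using order_trans[OF dv[of "x / s t"] dv[of x]] by (simp add: power2_eq_square)
    have "norm (\<phi> (s t)) \<le> norm (- (1 / s t)) + norm (deriv Z (s t) / (Z (s t) * s t))"
      unfolding \<phi>_def by (rule norm_triangle_ineq4)
    also have "\<dots> \<le> 1 + Q" using dv[of 1] dv[of "deriv Z (s t) / Z (s t)"] B1 by simp
    finally have 1: "norm (\<phi> (s t)) \<le> 1 + Q" .
    have "norm (\<phi>' (s t)) \<le> norm (1 / (s t)^2) + norm ((deriv Z (s t) / Z (s t)) / (s t)^2) + norm ((deriv (deriv Z) (s t) / Z (s t)) / s t) + norm ((deriv Z (s t) / Z (s t))^2 / s t)"
      unfolding \<phi>'_def by (intro order_trans[OF norm_triangle_ineq] add_mono order_trans[OF norm_triangle_ineq4] order_refl)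
    also have "\<dots> \<le> 1 + Q + 4 * Q + Q^2"
    proof (intro add_mono)
      show "norm (1 / (s t)^2) \<le> 1" using dv2[of 1] by simp
      show "norm ((deriv Z (s t) / Z (s t)) / (s t)^2) \<le> Q" using dv2 B1 by (rule order_trans)
      show "norm ((deriv (deriv Z) (s t) / Z (s t)) / s t) \<le> 4 * Q" using dv B2 by (rule order_trans)
      have "norm ((deriv Z (s t) / Z (s t))^2) \<le> Q^2" unfolding norm_power using B1 by (intro power_mono) auto
      with dv show "norm ((deriv Z (s t) / Z (s t))^2 / s t) \<le> Q^2" by (rule order_trans)
    qed
    also have "\<dots> \<le> 2 * Q^2"
    proof -
      have "100 * Q \<le> Q * Q" using Q by (intro mult_right_mono) auto
      thus ?thesis unfolding power2_eq_square using Q by linarith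
    qed
    finally show ?thesis using 1 by (simp add: norm_mult)
  qed
  define g where "g = (\<lambda>t. of_real (1 - t / T) * (exp (\<i> * of_real (t * V)) * \<phi> (s t)))"
  have osc: "norm (integral {0..T} g) \<le> (2 * (1 + Q) + T * (2 * Q^2)) / V"
    unfolding g_def by (rule oscillatory_bound[OF T0 V H_der]) (use bd in auto)
  have "continuous_on {0..T} (\<lambda>t. \<phi> (s t))"
    by (rule continuous_on_vector_derivative[OF H_der])
  hence "g integrable_on {0..T}" unfolding g_def
    by (intro integrable_continuous_real continuous_intros) (use T0 in auto)
  from integral_linear[OF this bounded_linear_Re]
  have Re_int: "integral {0..T} (\<lambda>t. Re (g t)) = Re (integral {0..T} g)" by (simp add: o_def)
  have "(\<integral>v. f v * fejer T (V - v) \<partial>lborel) = integral {0..T} (\<lambda>t. (1 - t / T) * (2 * Re (exp (\<i> * of_real (t * V)) * \<phi> (s t))))"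
    using fejer_fubini[OF fi T0] unfolding transf .
  also have "\<dots> = integral {0..T} (\<lambda>t. 2 * Re (g t))"
  proof (rule arg_cong[where f = "integral {0..T}"], rule ext)
    fix t
    have "Re (g t) = (1 - t / T) * Re (exp (\<i> * of_real (t * V)) * \<phi> (s t))"
      by (simp only: g_def times_complex.sel Re_complex_of_real Im_complex_of_real)
    thus "(1 - t / T) * (2 * Re (exp (\<i> * of_real (t * V)) * \<phi> (s t))) = 2 * Re (g t)" by simp
  qed
  also have "\<dots> = 2 * Re (integral {0..T} g)" by (simp add: Re_int)
  finally have *: "(\<integral>v. f v * fejer T (V - v) \<partial>lborel) = 2 * Re (integral {0..T} g)" .
  have "\<bar>Re (integral {0..T} g)\<bar> \<le> (2 * (1 + Q) + T * (2 * Q^2)) / V"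
    using abs_Re_le_cmod osc order_trans by blast
  also have "\<dots> \<le> (3 * T * Q^2) / V"
  proof (rule divide_right_mono)
    have "100 * Q \<le> Q * Q" using Q by (intro mult_right_mono) auto
    hence "2 + 2 * Q \<le> Q * Q" using Q by linarith
    hence "2 * (1 + Q) \<le> 1 * Q^2" by (simp add: power2_eq_square)
    also have "\<dots> \<le> T * Q^2" using T by (intro mult_right_mono) auto
    finally show "2 * (1 + Q) + T * (2 * Q^2) \<le> 3 * T * Q^2" by simp
  qed (use V in auto)
  finally have "\<bar>Re (integral {0..T} g)\<bar> \<le> (3 * T * Q^2) / V" .
  hence "2 * Re (integral {0..T} g) \<ge> - (2 * ((3 * T * Q^2) / V))" by linarith
  thus "(\<integral>v. f v * fejer T (V - v) \<partial>lborel) \<ge> - (6 * T * Q^2 / V)" unfolding * by simp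
qed

text \<open>
In the window \<open>{V - h..V + h}\<close> monotonicity of \<open>psi\<close> bounds \<open>psi (exp v) exp (- v)\<close> by \<open>exp (2 h)\<close> times its
value at the right end. Outside the window it is at most \<open>17/10\<close>, and the tail of the
kernel is at most \<open>8 / (T h)\<close>. So if the value at \<open>V + h\<close> were too small, the average against the kernel would
contradict the Fourier bound. The factor \<open>9 / 2\<close> is the mass of the kernel in the window.
\<close>

lemma psi_exp_lower_smoothed:
  fixes T V h :: real
  defines "Q \<equiv> 150000000 * (T + 3) ^ 5"
  assumes T: "T \<ge> 100" and h: "T * h \<ge> 3" and V: "V > h"
  shows "psi_exp (V + h) * exp (- (V + h)) \<ge> exp (- 2 * h) * (1 - (6 * T * Q^2 / V + 68 / (5 * (T * h))) / (9 / 2))"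
proof -
  have T0: "T > 0" using T by simp
  have "0 < T * h" using h by linarith
  hence h0: "h > 0" using T0 by (rule zero_less_mult_pos)
  have V0: "V > 0" using V h0 by simp
  have "Q > 0" using T by (simp add: Q_def)
  define S where "S = psi_exp (V + h) * exp (- (V + h))"
  define S2 where "S2 = S * exp (2 * h)"
  define J where "J = (\<integral>v. indicator {V - h..V + h} v * fejer T (V - v) \<partial>lborel)"
  define w where "w = (\<lambda>v. indicator {v. \<bar>v - V\<bar> \<ge> h} v * (4 / (T * (V - v)^2)))"
  have J: "J \<ge> 9/2" unfolding J_def by (rule fejer_window_ge[OF T0 h])
  have w: "integrable lborel w" "(\<integral>v. w v \<partial>lborel) = 8 / (T * h)"
    unfolding w_def by (rule fejer_tail[OF T0 h0])+
  define R where "R = 6 * T * Q^2 / V + 68 / (5 * (T * h))"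
  have R0: "R \<ge> 0" unfolding R_def using T0 h0 V0 by (intro add_nonneg_nonneg divide_nonneg_nonneg) auto
  \<comment> \<open>The bound \<open>R\<close> does not depend on \<open>d\<close>, so the limit \<open>d \<longrightarrow> 0\<close> may be taken afterwards.\<close>
  have key: "(exp (- d * (V + h)) - S2) * J \<le> R" if d: "0 < d" "d \<le> 1 / Q" for d
  proof -
    define f where "f = (\<lambda>v. indicator {0..} v * (psi_exp v * exp (- v) - 1) * exp (- d * v))"
    have fi: "integrable lborel f" and fl: "(\<integral>v. f v * fejer T (V - v) \<partial>lborel) \<ge> - (6 * T * Q^2 / V)"
      using psi_exp_fourier_bound[OF T V0, of d] d unfolding f_def Q_def by auto
    define m where "m = S2 - exp (- d * (V + h))"
    define B where "B = (\<lambda>v. m * (indicator {V - h..V + h} v * fejer T (V - v)) + 17/10 * w v)"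
    have Bi: "integrable lborel B" unfolding B_def
      by (intro Bochner_Integration.integrable_add integrable_mult_right fejer_window_integrable T0 w)
    have fB: "f v * fejer T (V - v) \<le> B v" for v
    proof (cases "v \<in> {V - h..V + h}")
      case True
      hence v: "V - h \<le> v" "v \<le> V + h" by auto
      have v0: "v \<ge> 0" using v V by simp
      have "psi_exp v * exp (- v) \<le> psi_exp (V + h) * exp (- (V - h))"
        using v by (intro mult_mono psi_exp_mono) (auto simp: psi_exp_nonneg)
      also have "\<dots> = S2" by (simp add: S2_def S_def mult.assoc exp_add[symmetric])
      finally have 1: "psi_exp v * exp (- v) \<le> S2" .
      have "psi_exp v * exp (- v) * exp (- d * v) \<le> psi_exp v * exp (- v) * 1"
        using v0 d by (intro mult_left_mono) (auto simp: psi_exp_nonneg)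
      with 1 have 2: "psi_exp v * exp (- v) * exp (- d * v) \<le> S2" by simp
      have 3: "exp (- d * (V + h)) \<le> exp (- d * v)" using v d by simp
      have "f v = psi_exp v * exp (- v) * exp (- d * v) - exp (- d * v)"
        using v0 by (simp add: f_def left_diff_distrib)
      also have "\<dots> \<le> m" unfolding m_def by (rule diff_mono[OF 2 3])
      finally have "f v \<le> m" .
      hence "f v * fejer T (V - v) \<le> m * fejer T (V - v)" by (rule mult_right_mono[OF _ fejer_nonneg[OF T0]])
      moreover have "w v \<ge> 0" using T0 by (simp add: w_def)
      ultimately show ?thesis using True by (simp add: B_def)
    next
      case False
      hence far: "\<bar>v - V\<bar> \<ge> h" "V - v \<noteq> 0" using h0 by auto
      have "f v \<le> 17/10"
      proof (cases "v \<ge> 0")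
        case True
        have "psi_exp v * exp (- v) \<le> (17/10 * exp v) * exp (- v)" using psi_exp_le[OF True] by (intro mult_right_mono) auto
        hence 1: "psi_exp v * exp (- v) \<le> 17/10" by (simp add: mult.assoc exp_add[symmetric])
        have "(psi_exp v * exp (- v) - 1) * exp (- d * v) \<le> psi_exp v * exp (- v) * exp (- d * v)" by simp
        also have "\<dots> \<le> psi_exp v * exp (- v) * 1"
          using True d by (intro mult_left_mono) (auto simp: psi_exp_nonneg)
        finally show ?thesis using True 1 by (simp add: f_def)
      qed (simp add: f_def)
      hence "f v * fejer T (V - v) \<le> 17/10 * fejer T (V - v)" by (rule mult_right_mono[OF _ fejer_nonneg[OF T0]])
      also have "\<dots> \<le> 17/10 * (4 / (T * (V - v)^2))"
        using fejer_le[OF T0 far(2)] by (intro mult_left_mono) auto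
      also have "\<dots> = 17/10 * w v" using far by (simp add: w_def)
      finally show ?thesis using False by (simp add: B_def)
    qed
    have "- (6 * T * Q^2 / V) \<le> (\<integral>v. f v * fejer T (V - v) \<partial>lborel)" by (rule fl)
    also have "\<dots> \<le> (\<integral>v. B v \<partial>lborel)"
    proof (rule integral_mono)
      show "integrable lborel (\<lambda>v. f v * fejer T (V - v))"
      proof (rule Bochner_Integration.integrable_bound[of _ "\<lambda>v. f v * (2 * T)"])
        show "integrable lborel (\<lambda>v. f v * (2 * T))" using fi by simp
        show "(\<lambda>v. f v * fejer T (V - v)) \<in> borel_measurable lborel" unfolding f_def by measurable
        show "AE v in lborel. norm (f v * fejer T (V - v)) \<le> norm (f v * (2 * T))"
          using fejer_le_2T[OF T0] fejer_nonneg[OF T0] T0 by (auto simp: abs_mult intro!: AE_I2 mult_left_mono)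
      qed
    qed (use Bi fB in auto)
    also have "\<dots> = m * J + 17/10 * (8 / (T * h))"
    proof -
      have "(\<integral>v. B v \<partial>lborel) = (\<integral>v. m * (indicator {V - h..V + h} v * fejer T (V - v)) \<partial>lborel) + (\<integral>v. 17/10 * w v \<partial>lborel)"
        unfolding B_def by (intro Bochner_Integration.integral_add integrable_mult_right fejer_window_integrable T0 w)
      thus ?thesis by (simp only: integral_mult_right_zero J_def w)
    qed
    finally show ?thesis by (simp add: m_def R_def algebra_simps)
  qed
  have "((\<lambda>d. (exp (- d * (V + h)) - S2) * J) \<longlongrightarrow> (exp (- 0 * (V + h)) - S2) * J) (at_right 0)"
    by (intro tendsto_intros)
  moreover have "eventually (\<lambda>d. (exp (- d * (V + h)) - S2) * J \<le> R) (at_right 0)"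
    unfolding eventually_at_right_field using key \<open>Q > 0\<close> by (intro exI[of _ "1 / Q"]) auto
  ultimately have lim: "(1 - S2) * J \<le> R"
    by (intro tendsto_upperbound[of _ "(1 - S2) * J" "at_right 0" R]) auto
  have "(1 - S2) * (9/2) \<le> R"
  proof (cases "S2 \<ge> 1")
    case True
    hence "(1 - S2) * (9/2) \<le> 0" by simp
    thus ?thesis using R0 by linarith
  next
    case False
    hence "(1 - S2) * (9/2) \<le> (1 - S2) * J" using J by (intro mult_left_mono) auto
    thus ?thesis using lim by linarith
  qed
  hence "1 - R / (9/2) \<le> S2" by simp
  hence "exp (- 2 * h) * (1 - R / (9/2)) \<le> exp (- 2 * h) * S2" by (intro mult_left_mono) auto
  also have "\<dots> = S" by (simp add: S2_def mult.assoc mult.left_commute exp_add[symmetric])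
  finally show ?thesis by (simp add: S_def R_def)
qed

text \<open>
Take \<open>T\<close> of order \<open>l\<^sup>2\<close> and \<open>h\<close> of order \<open>1 / l\<close>. The window costs \<open>6 / l\<close> and the tail of the kernel about
\<open>5.55 / l\<close>. The Fourier error is of order \<open>l ^ 22 / exp l\<close>, and \<open>exp l \<ge> l ^ 28\<close> for \<open>l \<ge> 140\<close>.
\<close>

lemma psi_prime_number_theorem_lower:
  assumes n: "n \<ge> 3" and l: "ln (ln (real n)) \<ge> 140"
  shows "psi n \<ge> (1 - 12 / ln (ln (real n))) * real n"
proof -
  define L l where "L = ln (real n)" and "l = ln L"
  have l: "l \<ge> 140" using l by (simp add: L_def l_def)
  have "L > 0" using n by (simp add: L_def)
  hence L: "L = exp l" by (simp add: l_def)
  define T h where "T = 2 * l^2 / 11" and "h = 3 / l"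
  define Q where "Q = 150000000 * (T + 3) ^ 5"
  have l2: "140^2 \<le> l^2" using l by (intro power_mono) auto
  have T: "T \<ge> 100" using l2 by (simp add: T_def)
  have h: "h > 0" "h \<le> 1" using l by (auto simp: h_def)
  have Th: "T * h = 6 * l / 11" using l by (simp add: T_def h_def field_simps power2_eq_square)
  have Th3: "T * h \<ge> 3" using l by (simp add: Th)
  have ln_l: "28 * ln l \<le> l"
  proof -
    have "(27/10)^5 \<le> exp (1::real)^5" using exp_1_ge by (intro power_mono) auto
    also have "exp (1::real)^5 = exp (real 5 * 1)" by (rule exp_of_nat_mult[symmetric])
    finally have "ln ((27/10)^5) \<le> real 5 * 1" by (subst ln_exp[symmetric], intro ln_mono) simp_all
    moreover have "ln (140::real) \<le> ln ((27/10)^5)" by (intro ln_mono) (simp_all add: power_divide)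
    ultimately have "ln 140 \<le> real 5 * 1" by (rule order_trans[rotated])
    hence "ln l \<le> l / 140 - 1 + 5" using ln_le_linear[of l 140] l by simp
    thus ?thesis using l by simp
  qed
  have Lbig: "l ^ 28 \<le> L"
  proof -
    have "l ^ 28 = exp (real 28 * ln l)" using l by (subst exp_of_nat_mult) simp
    also have "\<dots> \<le> exp l" using ln_l by (subst exp_le_cancel_iff) simp
    finally show ?thesis by (simp add: L)
  qed
  define V where "V = L - h"
  have L2: "2 \<le> L"
  proof -
    have "(2::real) \<le> l ^ 1" using l by simp
    also have "\<dots> \<le> l ^ 28" using l by (intro power_increasing) auto
    finally show ?thesis using Lbig by simp
  qed
  hence V: "V > h \<or> V \<ge> L / 2" "V \<ge> L / 2" using h by (auto simp: V_def)
  have Vh: "V > h"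
  proof -
    have "(140::real) ^ 1 \<le> l ^ 1" using l by simp
    also have "l ^ 1 \<le> l ^ 28" using l by (intro power_increasing) auto
    finally have "140 \<le> L" using Lbig by simp
    thus ?thesis using h by (simp add: V_def)
  qed
  have Q: "Q \<le> 48000 * l ^ 10"
  proof -
    have "T + 3 \<le> l^2 / 5" using l2 by (simp add: T_def)
    hence "(T + 3) ^ 5 \<le> (l^2 / 5) ^ 5" using T by (intro power_mono) auto
    also have "\<dots> = l ^ 10 / 3125" by (simp add: power_divide flip: power_mult)
    finally show ?thesis by (simp add: Q_def)
  qed
  have Q0: "Q \<ge> 0" using T by (simp add: Q_def)
  have err: "6 * T * Q^2 / V \<le> 1 / (10 * l)"
  proof -
    have "Q^2 \<le> (48000 * l ^ 10)^2" using Q Q0 by (intro power_mono) auto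
    hence "6 * T * Q^2 \<le> 6 * (2 * l^2 / 11) * (48000 * l ^ 10)^2"
      unfolding T_def by (intro mult_left_mono) auto
    also have "\<dots> = (6 * 2 / 11 * 48000^2) * l ^ 22" by (simp add: power_mult_distrib field_simps flip: power_mult power_add)
    also have "\<dots> \<le> 2600000000 * l ^ 22" by (intro mult_right_mono) (use l in auto)
    finally have 1: "6 * T * Q^2 \<le> 2600000000 * l ^ 22" .
    have "l ^ 28 / 2 \<le> V" using Lbig V by linarith
    hence "6 * T * Q^2 / V \<le> 2600000000 * l ^ 22 / (l ^ 28 / 2)"
      using 1 l by (intro frac_le) auto
    also have "\<dots> = 5200000000 / l ^ 5 / l"
    proof -
      have "l ^ 28 = l ^ 22 * l ^ 5 * l" by (simp flip: power_add power_Suc2)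
      thus ?thesis using l by (simp add: field_simps)
    qed
    also have "\<dots> \<le> (1 / 10) / l"
    proof (rule divide_right_mono)
      have "(140::real) ^ 5 \<le> l ^ 5" using l by (intro power_mono) auto
      thus "5200000000 / l ^ 5 \<le> 1 / 10" using l by (simp add: divide_le_eq)
    qed (use l in simp)
    finally show ?thesis by simp
  qed
  have main: "psi_exp (V + h) * exp (- (V + h)) \<ge> exp (- 2 * h) * (1 - (6 * T * Q^2 / V + 68 / (5 * (T * h))) / (9 / 2))"
    unfolding Q_def by (rule psi_exp_lower_smoothed[OF T Th3 Vh])
  have Vh_eq: "V + h = L" by (simp add: V_def)
  have nL: "exp L = real n" using n by (simp add: L_def)
  have lhs: "psi_exp (V + h) * exp (- (V + h)) = psi n / real n"
    unfolding Vh_eq exp_minus nL psi_exp_def by (simp add: divide_inverse)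
  have "(1 - 6 / l) * (1 - 57/10 / l) \<le> exp (- 2 * h) * (1 - (6 * T * Q^2 / V + 68 / (5 * (T * h))) / (9 / 2))"
  proof (rule mult_mono)
    show "1 - 6 / l \<le> exp (- 2 * h)" using exp_ge_add_one_self[of "- 2 * h"] by (simp add: h_def)
    have "68 / (5 * (T * h)) = 748 / 30 / l" unfolding Th using l by (simp add: field_simps)
    hence "(6 * T * Q^2 / V + 68 / (5 * (T * h))) / (9 / 2) \<le> (1 / 10 / l + 748 / 30 / l) / (9 / 2)"
      using err by (intro divide_right_mono add_mono) auto
    also have "\<dots> \<le> 57/10 / l" using l by (simp add: field_simps)
    finally show "1 - 57/10 / l \<le> 1 - (6 * T * Q^2 / V + 68 / (5 * (T * h))) / (9 / 2)" by simp
    show "0 \<le> 1 - 57/10 / l" using l by (simp add: field_simps)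
  qed auto
  moreover have "1 - 12 / l \<le> (1 - 6 / l) * (1 - 57/10 / l)"
    using l by (simp add: field_simps)
  ultimately have "1 - 12 / l \<le> psi n / real n" using main unfolding lhs by linarith
  thus ?thesis using n by (simp add: field_simps L_def[symmetric] l_def[symmetric])
qed

section \<open>The constant c4\<close>

text \<open>
The numerator minus \<open>7.3\<close> times the denominator decreases in \<open>log 2\<close> on the relevant range, so it is
expanded around the upper bound \<open>25/36\<close> for \<open>log 2\<close>.
\<close>

lemma c1_ge: "c1 \<ge> 73/10"
proof -
  define l :: real where "l = ln 2"
  define d where "d = 25/36 - l"
  have l: "l \<ge> 2/3" and d: "d \<ge> 0" "d \<le> 1/36" using ln2_ge_two_thirds ln2_le_25_over_36 by (auto simp: l_def d_def)
  have "7.3 * (600 * l^3) \<le> - 5937 * l^2 + 3965 * l + 1586"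
  proof -
    have "- 5937 * l^2 + 3965 * l + 1586 - 7.3 * (600 * l^3)
      = (- 5937 * (25/36)^2 + 3965 * (25/36) + 1586 - 4380 * (25/36)^3) + d * (2 * 5937 * (25/36) - 3965 + 3 * 4380 * (25/36)^2 - d * (5937 + 3 * 4380 * (25/36)) + 4380 * d^2)"
      by (simp add: d_def power2_eq_square power3_eq_cube field_simps)
    moreover have "d * (2 * 5937 * (25/36) - 3965 + 3 * 4380 * (25/36)^2 - d * (5937 + 3 * 4380 * (25/36)) + 4380 * d^2) \<ge> 0"
    proof (intro mult_nonneg_nonneg d)
      have "d * (5937 + 3 * 4380 * (25/36)) \<le> 1/36 * (5937 + 3 * 4380 * (25/36))"
        using d by (intro mult_right_mono) auto
      moreover have "4380 * d^2 \<ge> 0" by simp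
      ultimately show "0 \<le> 2 * 5937 * (25/36) - 3965 + 3 * 4380 * (25/36)^2 - d * (5937 + 3 * 4380 * (25/36)) + 4380 * d^2"
        by (simp add: power2_eq_square)
    qed
    moreover have "- 5937 * (25/36)^2 + 3965 * (25/36) + 1586 - 4380 * (25/36)^3 \<ge> (0::real)"
      by (simp add: power2_eq_square power3_eq_cube)
    ultimately show ?thesis by linarith
  qed
  moreover have "600 * l^3 > 0" using l by simp
  ultimately show ?thesis unfolding c1_def l_def[symmetric] by (simp add: field_simps)
qed

lemma Ei_nonneg: "Ei (a::real) z \<ge> 0"
proof (cases "(\<lambda>t::real. exp (- of_real t * z) * of_real t powr (- a)) integrable_on {1..}")
  case True
  thus ?thesis unfolding Ei_def by (intro integral_nonneg) auto
next
  case False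
  thus ?thesis unfolding Ei_def by (simp add: not_integrable_integral)
qed

text \<open>
In terms of \<open>u = x - 1\<close> the rational factor is a polynomial in \<open>1 / u\<close>. Replacing \<open>1 / log x\<close> by a smaller
linear function of \<open>1 / u\<close> gives an elementary antiderivative.
\<close>

lemma c2_ge: "c2 \<ge> 115/10"
proof -
  define e :: real where "e = exp 1"
  have e: "e \<ge> 27/10" "e \<le> 272/100" using exp_1_ge e_less_272 by (auto simp: e_def)
  define f where "f = (\<lambda>x::real. (1200 * x^3 + 365 * x^2 + 9944 * x - 1993) / (1200 * (x - 1)^4 * ln x))"
  define v where "v = (\<lambda>x::real. 1 / (x - 1))"
  define w where "w = (\<lambda>x::real. ln (x - 1))"
  define G where "G = (\<lambda>x::real. 18/100 * (w x - 3965/1200 * v x - 14274/2400 * v x ^ 2 - 9516/3600 * v x ^ 3)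
     + 124/100 * (- v x - 3965/2400 * v x ^ 2 - 14274/3600 * v x ^ 3 - 9516/4800 * v x ^ 4))"
  define g where "g = (\<lambda>x::real. (18/100 + 124/100 * v x) * (v x + 3965/1200 * v x ^ 2 + 14274/1200 * v x ^ 3 + 9516/1200 * v x ^ 4))"
  have "(g has_integral (G (e + 1) - G 2)) {2..e + 1}"
  proof (rule fundamental_theorem_of_calculus)
    fix x assume x: "x \<in> {2..e + 1}"
    have dv: "(v has_real_derivative - (v x ^ 2)) (at x)"
      unfolding v_def using x by (auto intro!: derivative_eq_intros simp: power2_eq_square)
    have dl: "(w has_real_derivative v x) (at x)"
      unfolding v_def w_def using x by (auto intro!: derivative_eq_intros)
    have "(G has_real_derivative g x) (at x)"
      unfolding G_def
      by (rule derivative_eq_intros dv dl refl)+ (simp add: g_def field_simps eval_nat_numeral)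
    thus "(G has_vector_derivative g x) (at x within {2..e + 1})"
      unfolding has_real_derivative_iff_has_vector_derivative[symmetric]
      by (rule has_field_derivative_at_within)
  qed (use e in auto)
  hence gi: "g integrable_on {2..e + 1}" and gI: "integral {2..e + 1} g = G (e + 1) - G 2"
    by (auto simp: integrable_on_def integral_unique)
  have fi: "f integrable_on {2..e + 1}" unfolding f_def
    by (intro integrable_continuous_real continuous_intros) auto
  have "G (e + 1) - G 2 \<le> integral {2..e + 1} f"
    unfolding gI[symmetric]
  proof (rule integral_le[OF gi fi])
    fix x assume x: "x \<in> {2..e + 1}"
    define u where "u = x - 1"
    have u: "u \<ge> 1" "u \<le> 272/100" using x e by (auto simp: u_def)
    have x': "x = u + 1" by (simp add: u_def)
    have "ln x \<le> x / 2 - 1 + ln 2" using x by (intro ln_le_linear) auto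
    hence "ln x \<le> x / 2 - 1 + 25/36" using ln2_le_25_over_36 by linarith
    also have "\<dots> \<le> (u + 4/10) / 2" by (simp add: x' field_simps)
    finally have lnx: "ln x \<le> (u + 4/10) / 2" .
    have lpos: "ln x > 0" using x by simp
    have "(18/100 + 124/100 / u) * ln x \<le> (18/100 + 124/100 / u) * ((u + 4/10) / 2)"
      using lnx u by (intro mult_left_mono) auto
    also have "\<dots> \<le> 1"
    proof -
      \<comment> \<open>The linear upper bound \<open>(u + 0.4) / 2\<close> for \<open>log (u + 1)\<close> has a reciprocal that is concave in \<open>1 / u\<close>;
        \<open>0.18 + 1.24 / u\<close> lies just below its chord over \<open>1 \<le> u \<le> 2.72\<close>.\<close>
      have "(u - 1) * (276/100 - u) \<ge> 0" using u by (intro mult_nonneg_nonneg) auto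
      moreover have "2 * u - (18/100 * u + 124/100) * (u + 4/10) = 18/100 * ((u - 1) * (276/100 - u)) + (112/10000 * u + 8/10000)"
        by (simp add: field_simps)
      ultimately have "(18/100 * u + 124/100) * (u + 4/10) \<le> 2 * u" using u by linarith
      thus ?thesis using u by (simp add: field_simps)
    qed
    finally have k: "18/100 + 124/100 / u \<le> 1 / ln x" using lpos by (simp add: field_simps)
    define p where "p = 1 / u + 3965/1200 / u^2 + 14274/1200 / u^3 + 9516/1200 / u^4"
    have p: "p \<ge> 0" using u by (simp add: p_def)
    have "g x = (18/100 + 124/100 / u) * p" by (simp add: g_def v_def p_def u_def power_divide)
    also have "\<dots> \<le> 1 / ln x * p" using k p by (rule mult_right_mono)
    also have "p = (1200 * x^3 + 365 * x^2 + 9944 * x - 1993) / (1200 * u^4)"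
      unfolding p_def x' using u by (simp add: field_simps eval_nat_numeral)
    also have "1 / ln x * ((1200 * x^3 + 365 * x^2 + 9944 * x - 1993) / (1200 * u^4)) = f x"
      by (simp add: f_def u_def)
    finally show "g x \<le> f x" .
  qed
  also have "integral {2..e + 1} f = c2" by (simp add: c2_def f_def e_def)
  finally have "G (e + 1) - G 2 \<le> c2" .
  moreover have "G (e + 1) - G 2 \<ge> 115/10"
  proof -
    define y where "y = 1 / e"
    have y: "y \<ge> 0" "y \<le> 10/27" using e by (auto simp: y_def field_simps)
    have G1: "G (e + 1) = 18/100 * (1 - 3965/1200 * y - 14274/2400 * y^2 - 9516/3600 * y^3) + 124/100 * (- y - 3965/2400 * y^2 - 14274/3600 * y^3 - 9516/4800 * y^4)"
      by (simp add: G_def v_def w_def y_def power_divide) (simp add: e_def)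
    have G2: "G 2 = 18/100 * (- 3965/1200 - 14274/2400 - 9516/3600) + 124/100 * (- 1 - 3965/2400 - 14274/3600 - 9516/4800)"
      by (simp add: G_def v_def w_def)
    have yk: "y^2 \<le> (10/27)^2" "y^3 \<le> (10/27)^3" "y^4 \<le> (10/27)^4" using y by (intro power_mono; simp)+
    have yk': "y^2 \<le> 138/1000" "y^3 \<le> 51/1000" "y^4 \<le> 19/1000" "y \<le> 371/1000"
      using yk y by (simp_all add: power_divide)
    have "G (e + 1) - G 2 = 18/100 + 18/100 * (3965/1200 + 14274/2400 + 9516/3600) + 124/100 * (1 + 3965/2400 + 14274/3600 + 9516/4800)
       - ((18/100 * (3965/1200) + 124/100) * y + (18/100 * (14274/2400) + 124/100 * (3965/2400)) * y^2 + (18/100 * (9516/3600) + 124/100 * (14274/3600)) * y^3 + (124/100 * (9516/4800)) * y^4)"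
      unfolding G1 G2 by (simp add: field_simps)
    thus ?thesis using yk' by simp
  qed
  ultimately show ?thesis by linarith
qed

text \<open>
The exponential integrals are nonnegative, so \<open>c1 + c2\<close> is a lower bound; the true value of \<open>c4\<close> is
about \<open>21.18\<close>.
\<close>

lemma c4_ge: "c4 \<ge> 185/10"
proof -
  have "793/240 * Ei 1 1 + 2379/200 * Ei 1 2 + 793/100 * Ei 1 (3::real) \<ge> 0"
    by (intro add_nonneg_nonneg mult_nonneg_nonneg Ei_nonneg) auto
  thus ?thesis using c1_ge c2_ge unfolding c4_def c3_def by linarith
qed

section \<open>The bound for the mean\<close>

lemma ln_20000_ge: "ln (20000::real) \<ge> 9"
proof -
  have "exp (real 9 * 1) = exp (1::real) ^ 9" by (rule exp_of_nat_mult)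
  also have "\<dots> \<le> (272/100) ^ 9" using e_less_272 by (intro power_mono) auto
  also have "\<dots> \<le> (20000::real)" by (simp add: power_divide)
  finally have "real 9 * 1 \<le> ln (20000::real)" by (subst ln_ge_iff) (simp_all only: zero_less_numeral)
  thus ?thesis by simp
qed

lemma ln_3_gt_1: "ln (3::real) > 1"
proof -
  have "ln (272/100) < ln (3::real)" by (subst ln_less_cancel_iff) auto
  thus ?thesis using ln_272_gt_1 by linarith
qed

lemma Upsilon_mean_le:
  assumes n: "n \<ge> 3" and r: "r > 0" "psi n \<ge> r * real n"
  shows "Upsilon_mean n \<le> ln (real n) * (ln (ln (real n)) + 4) / r"
proof -
  define L l where "L = ln (real n)" and "l = ln L"
  have "ln 3 \<le> L" unfolding L_def using n by (intro ln_mono) auto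
  hence L: "L > 1" using ln_3_gt_1 by linarith
  have l: "l > 0" using L by (simp add: l_def)
  have n0: "real n > 0" using n by simp
  have "r * real n \<le> real (prime_pi n) * L" using psi_le_prime_pi[of n] n r by (simp add: L_def)
  hence "r * real n / L \<le> real (prime_pi n)" using L by (simp add: field_simps)
  moreover have "r * real n / L > 0" using r n0 L by simp
  moreover have "real (Upsilon n) \<le> real n * (l + 4)" using Upsilon_le[of n] n by (simp add: l_def L_def)
  ultimately have "Upsilon_mean n \<le> real n * (l + 4) / (r * real n / L)"
    unfolding Upsilon_mean_def using l by (intro frac_le) auto
  also have "\<dots> = L * (l + 4) / r" using n0 L r by (simp add: field_simps)
  finally show ?thesis by (simp add: L_def l_def)
qed

lemma bound_factored:
  fixes L l1 c K :: real assumes "L > 0"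
  shows "L / (1 + L) * L * l1 + c * L^2 / (1 + L) + L / (1 + L) + K / ((1 + L) * L^3)
    = L / (1 + L) * (L * (l1 + c) + 1 + K / L^4)"
proof -
  have "K / ((1 + L) * L^3) = L / (1 + L) * (K / L^4)"
  proof -
    have "L / (1 + L) * (K / (L * M)) = K / ((1 + L) * M)" for M using assms by simp
    from this[of "L^3"] show ?thesis by (simp add: eval_nat_numeral)
  qed
  thus ?thesis by (simp add: algebra_simps power2_eq_square add_divide_distrib)
qed

theorem theorem1p2:
  fixes n :: nat
  assumes "n \<ge> 3"
  shows "Upsilon_mean n <
      ln (real n) / (1 + ln (real n)) * ln (real n) * ln (ln (real n - 1))
      + c4 * (ln (real n))^2 / (1 + ln (real n))
      + ln (real n) / (1 + ln (real n))
      + 1717433 / ((1 + ln (real n)) * (ln (real n))^3)"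
proof -
  define L l l1 where "L = ln (real n)" and "l = ln L" and "l1 = ln (ln (real n - 1))"
  define X where "X = L * (l1 + c4) + 1 + 1717433 / L^4"
  have "ln 3 \<le> L" unfolding L_def using assms by (intro ln_mono) auto
  hence L: "L > 1" using ln_3_gt_1 by linarith
  have l: "l > 0" using L by (simp add: l_def)
  have lL: "l + 4 \<le> L / 4 + 439/100"
  proof -
    have "l \<le> L / 4 - 1 + ln 4" unfolding l_def using L by (intro ln_le_linear) auto
    moreover have "ln 4 = 2 * ln (2::real)" using ln_realpow[of "2::real" 2] by simp
    ultimately show ?thesis using ln2_le_25_over_36 by linarith
  qed
  \<comment> \<open>Everything comes down to an admissible ratio \<open>r\<close> between \<open>psi n\<close> and \<open>n\<close>.\<close>
  have reduce: "Upsilon_mean n < L / (1 + L) * X" if r: "r > 0" "psi n \<ge> r * real n" "(1 + L) * (l + 4) < r * X" for r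
  proof -
    have "Upsilon_mean n \<le> L * (l + 4) / r"
      using Upsilon_mean_le[OF assms r(1,2)] by (simp add: L_def l_def)
    also have "\<dots> = L / (1 + L) * ((1 + L) * (l + 4) / r)" using L by simp
    also have "\<dots> < L / (1 + L) * X"
      using r L by (intro mult_strict_left_mono) (auto simp: divide_less_eq mult.commute)
    finally show ?thesis .
  qed
  have "Upsilon_mean n < L / (1 + L) * X"
  proof (cases "n < 20000")
    case True
    have "L \<le> ln 20000" unfolding L_def using True assms by (intro ln_mono) auto
    hence L10: "L \<le> 10" using ln_20000_le by linarith
    have "ln 2 \<le> ln (real n - 1)" using assms by (intro ln_mono) auto
    hence "2/3 \<le> ln (real n - 1)" using ln2_ge_two_thirds by linarith
    hence "ln (2/3) \<le> l1" unfolding l1_def by (intro ln_mono) auto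
    moreover have "- 1/2 \<le> ln (2/3::real)" using ln_diff_le[of "2/3" "1::real"] by simp
    \<comment> \<open>For \<open>n = 3\<close> the double logarithm of \<open>n - 1\<close> is negative, but at least \<open>- 1/2\<close>.\<close>
    ultimately have "18 \<le> l1 + c4" using c4_ge by linarith
    hence "L * 18 \<le> L * (l1 + c4)" using L by (intro mult_left_mono) auto
    moreover have "171 \<le> 1717433 / L^4"
    proof -
      have "L^4 \<le> 10^4" using L L10 by (intro power_mono) auto
      hence "1717433 / 10^4 \<le> 1717433 / L^4" using L by (intro divide_left_mono) auto
      thus ?thesis by simp
    qed
    ultimately have X: "18 * L + 172 \<le> X" by (simp add: X_def)
    have "(1 + L) * (l + 4) \<le> (1 + L) * (L / 4 + 439/100)"
      using lL L by (intro mult_left_mono) auto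
    also have "\<dots> = L * L / 4 + 464/100 * L + 439/100" by (simp add: field_simps)
    also have "\<dots> \<le> 10 * L / 4 + 464/100 * L + 439/100"
      using L L10 by (intro add_right_mono divide_right_mono mult_right_mono) auto
    also have "\<dots> < 22/100 * (18 * L + 172)" using L10 by simp
    also have "\<dots> \<le> 22/100 * X" using X by simp
    finally show ?thesis using psi_ge[of n] assms by (intro reduce[of "22/100"]) auto
  next
    case False
    hence n: "n \<ge> 20000" by simp
    have "ln 20000 \<le> L" unfolding L_def using n by (intro ln_mono) auto
    hence L9: "L \<ge> 9" using ln_20000_ge by linarith
    define L1 where "L1 = ln (real n - 1)"
    have "ln 3 \<le> L1" unfolding L1_def using n by (intro ln_mono) auto
    hence L1: "L1 > 1" using ln_3_gt_1 by linarith
    have "L - L1 \<le> 1 / (real n - 1)"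
      unfolding L_def L1_def using ln_diff_le[of "real n - 1" "real n"] n by (simp add: field_simps)
    moreover have "L1 \<le> L" unfolding L_def L1_def using n by (intro ln_mono) auto
    moreover have "l - l1 \<le> (L - L1) / L1"
      unfolding l_def l1_def L1_def[symmetric] using ln_diff_le[of L1 L] L L1 by (simp add: field_simps)
    moreover have "(L - L1) / L1 \<le> (L - L1) / 1" using L1 \<open>L1 \<le> L\<close> by (intro divide_left_mono) auto
    ultimately have "l - l1 \<le> 1 / (real n - 1)" by simp
    hence "L * (l - l1) \<le> L * (1 / (real n - 1))" using L by (intro mult_left_mono) auto
    also have "\<dots> \<le> (real n - 1) * (1 / (real n - 1))"
      using n ln_le_minus_one[of "real n"] by (intro mult_right_mono) (auto simp: L_def)
    also have "\<dots> = 1" using n by simp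
    \<comment> \<open>Replacing \<open>n - 1\<close> by \<open>n\<close> in the double logarithm costs 1, which the summand 1 of \<open>X\<close> compensates.\<close>
    finally have "L * l - 1 \<le> L * l1" by (simp add: right_diff_distrib)
    moreover have "L * (185/10) \<le> L * c4" using c4_ge L by (intro mult_left_mono) auto
    moreover have "1717433 / L^4 > 0" using L by simp
    ultimately have X: "L * (l + 185/10) < X" unfolding X_def distrib_left by linarith
    have "(1 + L) * (l + 4) = (l + 4) + L * (l + 4)" by (simp add: algebra_simps)
    also have "\<dots> \<le> L * (74/100) + L * (l + 4)" using lL L9 by simp
    also have "\<dots> = L * (l + 474/100)" by (simp add: algebra_simps)
    finally have low: "(1 + L) * (l + 4) \<le> L * (l + 474/100)" .
    have fin: "(1 + L) * (l + 4) < r * X" if r: "r > 0" "l + 474/100 \<le> r * (l + 185/10)" for r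
    proof -
      have "L * (l + 474/100) \<le> L * (r * (l + 185/10))" using r L by (intro mult_left_mono) auto
      also have "\<dots> = r * (L * (l + 185/10))" by simp
      also have "\<dots> < r * X" using X r by (intro mult_strict_left_mono) auto
      finally show ?thesis using low by linarith
    qed
    show ?thesis
    proof (cases "l < 140")
      case True
      have "l + 474/100 \<le> 914/1000 * (l + 185/10)" using True by simp
      thus ?thesis using psi_chebyshev_914[OF n] by (intro reduce[of "914/1000"] fin) auto
    next
      case False
      hence l140: "l \<ge> 140" by simp
      have "222 / l \<le> 222 / 140" using l140 by (intro divide_left_mono) auto
      moreover have "(1 - 12 / l) * (l + 185/10) = l + 65/10 - 222 / l"
        using l by (simp add: field_simps)
      ultimately have "l + 474/100 \<le> (1 - 12 / l) * (l + 185/10)" by simp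
      moreover have "1 - 12 / l > 0" using l140 by (simp add: field_simps)
      moreover have "(1 - 12 / l) * real n \<le> psi n"
        using psi_prime_number_theorem_lower[OF assms] l140 by (simp add: L_def l_def)
      ultimately show ?thesis by (intro reduce[of "1 - 12 / l"] fin) auto
    qed
  qed
  also have "L / (1 + L) * X = L / (1 + L) * L * l1 + c4 * L^2 / (1 + L) + L / (1 + L) + 1717433 / ((1 + L) * L^3)"
    unfolding X_def using L by (intro bound_factored[symmetric]) auto
  finally show ?thesis unfolding L_def l1_def .
qed

end
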